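(* Let $\overline M$ be a $7$-dimensional Riemannian manifold with a $G_2$-structure of type $\mathcal X_3$. Let $\iota:M\to\overline M$ be an orientable hypersurface with unit normal vector field $n$, with the induced $SU(3)$-structure determined by $n$ and the constant function $\theta=0$ (resp. $\theta=\pi/2$). Then $M$ is of type $\mathcal W_1^++\mathcal W_1^-+\mathcal W_2^++\mathcal W_2^-+\mathcal W_3+\mathcal W_5$. Moreover, the $SU(3)$-structure on $M$ is of the type given on the left if and only if the condition on the right holds: 1. $\mathcal W_1^++\mathcal W_1^-+\mathcal W_2^++\mathcal W_2^-+\mathcal W_3$: $\overline r(\varphi)(\iota_*\cdot,n)=0$ (both for $\theta=0$ and for $\theta=\pi/2$). 2. $\mathcal W_1^++\mathcal W_1^-+\mathcal W_2^++\mathcal W_2^-+\mathcal W_5$: $(I_{(1)}+I_{(2)})\iota^*\overline r(\varphi)=(1-I)B$ (both for $\theta=0$ and for $\theta=\pi/2$). 3. $\mathcal W_1^++\mathcal W_1^-+\mathcal W_2^++\mathcal W_3+\mathcal W_5$: for $\theta=0$, $3(1+I)\iota^*\overline r(\varphi)=-\overline r(\varphi)(n,n)\langle\cdot,\cdot\rangle$; for $\theta=\pi/2$, $(1+I)B=2h\langle\cdot,\cdot\rangle$. 4. $\mathcal W_1^++\mathcal W_1^-+\mathcal W_2^-+\mathcal W_3+\mathcal W_5$: for $\theta=0$, $(1+I)B=2h\langle\cdot,\cdot\rangle$; for $\theta=\pi/2$, $3(1+I)\iota^*\overline r(\varphi)=-\overline r(\varphi)(n,n)\langle\cdot,\cdot\rangle$.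 5. $\mathcal W_1^++\mathcal W_2^++\mathcal W_2^-+\mathcal W_3+\mathcal W_5$: for $\theta=0$, $\overline r(\varphi)(n,n)=0$; for $\theta=\pi/2$, $M$ is a minimal variety. 6. $\mathcal W_1^-+\mathcal W_2^++\mathcal W_2^-+\mathcal W_3+\mathcal W_5$: for $\theta=0$, $M$ is a minimal variety; for $\theta=\pi/2$, $\overline r(\varphi)(n,n)=0$.
   Context: $G_2$-structures: a $G_2$-structure on a Riemannian $7$-manifold $(\overline M,\langle\cdot,\cdot\rangle)$ is given by a global three-form $\varphi$ such that locally there is an orthonormal frame $\{e_0,\dots,e_6\}$ (indices in $\mathbb Z_7$) with $\varphi=\sum_ie_i\wedge e_{i+1}\wedge e_{i+3}$ (vectors are identified with one-forms via the metric). $\langle P(x,y),z\rangle=\varphi(x,y,z)$, and $*\varphi=-\sum_{i}e_{i+2}\wedge e_{i+4}\wedge e_{i+5}\wedge e_{i+6}$ (Hodge dual for the orientation $e_0\wedge\dots\wedge e_6$). $\overline\nabla$ is the Levi-Civita connection and $\overline r(\varphi)(x,y)=\frac14\langle\overline\nabla_x\varphi,y\lrcorner*\varphi\rangle$, where $\langle a,b\rangle=\frac1{p!}\sum a(e_{i_1},\dots)b(e_{i_1},\dots)$ for $p$-forms. Type $\mathcal X_3$: $\overline r(\varphi)$ is symmetric and trace-free. Induced structure on $M$: the induced metric, $Ix=P(n,x)$, and $\Psi=\psi_++i\psi_-$ with $\psi_+=\cos\theta\,\iota^*\varphi-\sin\theta\,\iota^*(n\lrcorner*\varphi)$, $\psi_-=\sin\theta\,\iota^*\varphi+\cos\theta\,\iota^*(n\lrcorner*\varphi)$.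 $B(x,y)=\langle II(x,y),n\rangle=\langle\overline\nabla_xy,n\rangle$ is the second fundamental form, $h=\frac16\mathrm{Tr}\,B$ (so $h=\langle H,n\rangle$, $H$ the mean curvature); minimal variety means $h=0$. For a bilinear form $b$ on $M$, $(I_{(1)}b)(x,y)=-b(Ix,y)$, $(I_{(2)}b)(x,y)=-b(x,Iy)$, $(Ib)(x,y)=b(Ix,Iy)$; for a one-form $\mu$, $(I\mu)(x)=-\mu(Ix)$. Types of $SU(3)$-structure: $\nabla$ is the Levi-Civita connection of $M$, $\omega(x,y)=\langle x,Iy\rangle$. $\nabla\omega$ lies in $\{\alpha\mid\alpha(x,y,z)=-\alpha(x,z,y)=-\alpha(x,Iy,Iz)\}=\mathcal W_1\oplus\mathcal W_2\oplus\mathcal W_3\oplus\mathcal W_4$ (Gray–Hervella), where $\mathcal W_1$: $\alpha$ totally skew; $\mathcal W_2$: cyclic sum of $\alpha(x,y,z)$ is zero; $\mathcal W_3$: $\alpha(Ix,Iy,z)=\alpha(x,y,z)$ and $\sum_i\alpha(e_i,e_i,z)=0$; $\mathcal W_4$: $\alpha(x,y,z)=\langle x,y\rangle\tau(z)-\langle x,z\rangle\tau(y)-\langle x,Iy\rangle\tau(Iz)+\langle x,Iz\rangle\tau(Iy)$ for some one-form $\tau$. With $r(\alpha)(x,y)=\frac12\langle x\lrcorner\alpha,y\lrcorner\psi_+\rangle$, for $i=1,2$ one has $\mathcal W_i=\mathcal W_i^+\oplus\mathcal W_i^-$, where $\mathcal W_i^+$ (resp. $\mathcal W_i^-$) is the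 set of $\alpha\in\mathcal W_i$ with $r(\alpha)$ symmetric (resp. skew-symmetric). The $\mathcal W_5$-part of the torsion is the one-form $\eta$ determined by requiring that the metric connection $\nabla+\eta+\xi$, with $\eta_XY=(I\eta)(X)IY$ and $\xi_XY=-\frac12I(\nabla_XI)Y$, makes $\omega,\psi_+,\psi_-$ parallel; equivalently $(I\eta)(X)=-\frac1{12}\langle\nabla_X\psi_+,\psi_-\rangle$. $M$ is of type $\mathcal U$, a sum of some of $\mathcal W_1^\pm,\mathcal W_2^\pm,\mathcal W_3,\mathcal W_4,\mathcal W_5$, if the components of $\nabla\omega$ in the $\mathcal W$'s not occurring in $\mathcal U$ vanish everywhere and, when $\mathcal W_5$ does not occur, $\eta=0$. *)

theory Defs
  imports "HOL-Analysis.Analysis"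
begin

section \<open>Smooth manifolds, described through charts\<close>

primrec Ck_on :: "nat \<Rightarrow> 'e::real_normed_vector set \<Rightarrow> ('e \<Rightarrow> 'f::real_normed_vector) \<Rightarrow> bool" where
  "Ck_on 0 S f = continuous_on S f"
| "Ck_on (Suc k) S f = ((\<forall>u\<in>S. f differentiable (at u)) \<and>
     (\<forall>v. Ck_on k S (\<lambda>u. frechet_derivative f (at u) v)))"

definition smooth_on :: "'e::real_normed_vector set \<Rightarrow> ('e \<Rightarrow> 'f::real_normed_vector) \<Rightarrow> bool" where
  "smooth_on S f \<longleftrightarrow> (\<forall>k. Ck_on k S f)"

record ('a, 'n) chart =
  cdom :: "'a set"
  cmap :: "'a \<Rightarrow> real ^ 'n"

definition is_chart :: "('a::topological_space, 'n::finite) chart \<Rightarrow> bool" where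
  "is_chart c \<longleftrightarrow> open (cdom c) \<and> open (cmap c ` cdom c) \<and>
     homeomorphism (cdom c) (cmap c ` cdom c) (cmap c) (inv_into (cdom c) (cmap c))"

text \<open>The coordinate expression of a function of points.\<close>

definition in_coords :: "('a, 'n::finite) chart \<Rightarrow> ('a \<Rightarrow> 'f) \<Rightarrow> real ^ 'n \<Rightarrow> 'f" where
  "in_coords c F = (\<lambda>u. F (inv_into (cdom c) (cmap c) u))"

definition smooth_in :: "('a, 'n::finite) chart \<Rightarrow> 'a set \<Rightarrow> ('a \<Rightarrow> 'f::real_normed_vector) \<Rightarrow> bool" where
  "smooth_in c U F \<longleftrightarrow> smooth_on (cmap c ` U) (in_coords c F)"

text \<open>\<open>dir_deriv c F p x\<close> is the derivative at the point \<open>p\<close> of a vector-valued function \<open>F\<close> of points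
  in the direction of the tangent vector with components \<open>x\<close> in the chart \<open>c\<close>.
  With \<open>F = cmap d\<close> it is the change of components from \<open>c\<close> to \<open>d\<close>; with \<open>F = cmap d \<circ> f\<close> it
  is the differential of the map \<open>f\<close> in the charts \<open>c\<close> and \<open>d\<close>.\<close>

definition dir_deriv :: "('a, 'n::finite) chart \<Rightarrow> ('a \<Rightarrow> 'f::real_normed_vector) \<Rightarrow> 'a \<Rightarrow> real ^ 'n \<Rightarrow> 'f" where
  "dir_deriv c F p x = frechet_derivative (in_coords c F) (at (cmap c p)) x"

definition carrier_of :: "('a, 'n::finite) chart set \<Rightarrow> 'a set" where
  "carrier_of A = (\<Union>c\<in>A. cdom c)"

definition smooth_atlas :: "('a::topological_space, 'n::finite) chart set \<Rightarrow> bool" where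
  "smooth_atlas A \<longleftrightarrow> (\<forall>c\<in>A. is_chart c) \<and>
     (\<forall>c\<in>A. \<forall>d\<in>A. smooth_in c (cdom c \<inter> cdom d) (cmap d))"

definition chart_at :: "('a, 'n::finite) chart set \<Rightarrow> 'a \<Rightarrow> ('a, 'n) chart" where
  "chart_at A p = (SOME c. c \<in> A \<and> p \<in> cdom c)"


section \<open>Multilinear algebra in a Euclidean vector space with metric \<open>b\<close>\<close>

type_synonym 'n form1 = "real ^ 'n \<Rightarrow> real"
type_synonym 'n form2 = "real ^ 'n \<Rightarrow> real ^ 'n \<Rightarrow> real"
type_synonym 'n form3 = "real ^ 'n \<Rightarrow> real ^ 'n \<Rightarrow> real ^ 'n \<Rightarrow> real"
type_synonym 'n form4 = "real ^ 'n \<Rightarrow> real ^ 'n \<Rightarrow> real ^ 'n \<Rightarrow> real ^ 'n \<Rightarrow> real"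

definition trilinear :: "'n::finite form3 \<Rightarrow> bool" where
  "trilinear \<alpha> \<longleftrightarrow> (\<forall>y z. linear (\<lambda>x. \<alpha> x y z)) \<and> (\<forall>x z. linear (\<lambda>y. \<alpha> x y z)) \<and>
     (\<forall>x y. linear (\<lambda>z. \<alpha> x y z))"

definition orthonormal_basis :: "'n::finite form2 \<Rightarrow> ('n \<Rightarrow> real ^ 'n) \<Rightarrow> bool" where
  "orthonormal_basis b e \<longleftrightarrow> (\<forall>i j. b (e i) (e j) = (if i = j then 1 else 0))"

definition some_onb :: "'n::finite form2 \<Rightarrow> 'n \<Rightarrow> real ^ 'n" where
  "some_onb b = (SOME e. orthonormal_basis b e)"

definition trace_form :: "'n::finite form2 \<Rightarrow> 'n form2 \<Rightarrow> real" where
  "trace_form b T = (\<Sum>i\<in>UNIV. T (some_onb b i) (some_onb b i))"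

text \<open>Inner products of \<open>p\<close>-forms with the normalisation \<open>1 / p!\<close>, for \<open>p = 2, 3\<close>.\<close>

definition inner_form2 :: "'n::finite form2 \<Rightarrow> 'n form2 \<Rightarrow> 'n form2 \<Rightarrow> real" where
  "inner_form2 b \<alpha> \<beta> = (let e = some_onb b in
     (\<Sum>i\<in>UNIV. \<Sum>j\<in>UNIV. \<alpha> (e i) (e j) * \<beta> (e i) (e j)) / 2)"

definition inner_form3 :: "'n::finite form2 \<Rightarrow> 'n form3 \<Rightarrow> 'n form3 \<Rightarrow> real" where
  "inner_form3 b \<alpha> \<beta> = (let e = some_onb b in
     (\<Sum>i\<in>UNIV. \<Sum>j\<in>UNIV. \<Sum>k\<in>UNIV. \<alpha> (e i) (e j) (e k) * \<beta> (e i) (e j) (e k)) / 6)"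

text \<open>Wedge products of one-forms, \<open>(a\<^sub>1 \<and> \<dots> \<and> a\<^sub>k) (x\<^sub>1, \<dots>, x\<^sub>k) = det (a\<^sub>i (x\<^sub>j))\<close>,
  by expansion along the first one-form.\<close>

definition wedge2 :: "'n::finite form1 \<Rightarrow> 'n form1 \<Rightarrow> 'n form2" where
  "wedge2 a\<^sub>1 a\<^sub>2 x y = a\<^sub>1 x * a\<^sub>2 y - a\<^sub>1 y * a\<^sub>2 x"

definition wedge3 :: "'n::finite form1 \<Rightarrow> 'n form1 \<Rightarrow> 'n form1 \<Rightarrow> 'n form3" where
  "wedge3 a\<^sub>1 a\<^sub>2 a\<^sub>3 x y z =
     a\<^sub>1 x * wedge2 a\<^sub>2 a\<^sub>3 y z - a\<^sub>1 y * wedge2 a\<^sub>2 a\<^sub>3 x z + a\<^sub>1 z * wedge2 a\<^sub>2 a\<^sub>3 x y"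

definition wedge4 :: "'n::finite form1 \<Rightarrow> 'n form1 \<Rightarrow> 'n form1 \<Rightarrow> 'n form1 \<Rightarrow> 'n form4" where
  "wedge4 a\<^sub>1 a\<^sub>2 a\<^sub>3 a\<^sub>4 x y z w =
     a\<^sub>1 x * wedge3 a\<^sub>2 a\<^sub>3 a\<^sub>4 y z w - a\<^sub>1 y * wedge3 a\<^sub>2 a\<^sub>3 a\<^sub>4 x z w
     + a\<^sub>1 z * wedge3 a\<^sub>2 a\<^sub>3 a\<^sub>4 x y w - a\<^sub>1 w * wedge3 a\<^sub>2 a\<^sub>3 a\<^sub>4 x y z"

text \<open>The index type \<open>7\<close> has arithmetic modulo 7. The one-form identified with \<open>e i\<close> is \<open>b (e i)\<close>.\<close>

definition g2_form :: "7 form2 \<Rightarrow> (7 \<Rightarrow> real ^ 7) \<Rightarrow> 7 form3" where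
  "g2_form b e = (\<lambda>x y z. \<Sum>i\<in>UNIV. wedge3 (b (e i)) (b (e (i + 1))) (b (e (i + 3))) x y z)"

text \<open>The Hodge dual of a three-form \<open>f\<close> of the shape \<open>g2_form b e\<close>. Such frames \<open>e\<close> all induce the
  same orientation and so the value does not depend on the one selected.\<close>

definition g2_star :: "7 form2 \<Rightarrow> 7 form3 \<Rightarrow> 7 form4" where
  "g2_star b f = (let e = (SOME e. orthonormal_basis b e \<and> f = g2_form b e) in
     (\<lambda>x y z w. - (\<Sum>i\<in>UNIV. wedge4 (b (e (i + 2))) (b (e (i + 4))) (b (e (i + 5))) (b (e (i + 6))) x y z w)))"

definition cross_product :: "7 form2 \<Rightarrow> 7 form3 \<Rightarrow> real ^ 7 \<Rightarrow> real ^ 7 \<Rightarrow> real ^ 7" where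
  "cross_product b f x y = (THE w. \<forall>z. b w z = f x y z)"


section \<open>Riemannian manifolds\<close>

text \<open>A covariant tensor field \<open>T\<close> is given by its components: \<open>T c p\<close> is the multilinear form at the
  point \<open>p\<close>, acting on tangent vectors written in the chart \<open>c\<close>.\<close>

record ('a, 'n) riem =
  charts :: "('a, 'n) chart set"
  metric :: "('a, 'n) chart \<Rightarrow> 'a \<Rightarrow> 'n form2"

definition riemannian_manifold :: "('a::topological_space, 'n::finite, 'z) riem_scheme \<Rightarrow> bool" where
  "riemannian_manifold N \<longleftrightarrow> smooth_atlas (charts N) \<and>
     (\<forall>c\<in>charts N. \<forall>p\<in>cdom c. bilinear (metric N c p) \<and>
        (\<forall>x y. metric N c p x y = metric N c p y x) \<and> (\<forall>x. x \<noteq> 0 \<longrightarrow> metric N c p x x > 0)) \<and>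
     (\<forall>c\<in>charts N. \<forall>x y. smooth_in c (cdom c) (\<lambda>p. metric N c p x y)) \<and>
     (\<forall>c\<in>charts N. \<forall>d\<in>charts N. \<forall>p\<in>cdom c \<inter> cdom d. \<forall>x y.
        metric N c p x y = metric N d p (dir_deriv c (cmap d) p x) (dir_deriv c (cmap d) p y))"

text \<open>The Levi-Civita connection in the chart \<open>c\<close>: \<open>\<nabla>\<^sub>x Y = D\<^sub>x Y + \<Gamma> x Y\<close>, where \<open>\<Gamma> x y\<close> is the
  covariant derivative of the vector field with constant components \<open>y\<close>. Coordinate
  fields commute, so symmetry of \<open>\<Gamma>\<close> is vanishing torsion; the last clause is metricity.\<close>

definition levi_civita :: "('a, 'n::finite, 'z) riem_scheme \<Rightarrow> ('a, 'n) chart \<Rightarrow> 'a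
    \<Rightarrow> real ^ 'n \<Rightarrow> real ^ 'n \<Rightarrow> real ^ 'n" where
  "levi_civita N c p = (THE \<Gamma>. bilinear \<Gamma> \<and> (\<forall>x y. \<Gamma> x y = \<Gamma> y x) \<and>
     (\<forall>x y z. dir_deriv c (\<lambda>q. metric N c q y z) p x
        = metric N c p (\<Gamma> x y) z + metric N c p y (\<Gamma> x z)))"

text \<open>\<open>nabla2 N T c p x y z = (\<nabla>\<^sub>x T) (y, z)\<close> and \<open>nabla3 N T c p x y z w = (\<nabla>\<^sub>x T) (y, z, w)\<close>.\<close>

definition nabla2 :: "('a, 'n::finite, 'z) riem_scheme \<Rightarrow> (('a, 'n) chart \<Rightarrow> 'a \<Rightarrow> 'n form2)
    \<Rightarrow> ('a, 'n) chart \<Rightarrow> 'a \<Rightarrow> 'n form3" where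
  "nabla2 N T c p x y z = (let \<Gamma> = levi_civita N c p in
     dir_deriv c (\<lambda>q. T c q y z) p x - T c p (\<Gamma> x y) z - T c p y (\<Gamma> x z))"

definition nabla3 :: "('a, 'n::finite, 'z) riem_scheme \<Rightarrow> (('a, 'n) chart \<Rightarrow> 'a \<Rightarrow> 'n form3)
    \<Rightarrow> ('a, 'n) chart \<Rightarrow> 'a \<Rightarrow> 'n form4" where
  "nabla3 N T c p x y z w = (let \<Gamma> = levi_civita N c p in
     dir_deriv c (\<lambda>q. T c q y z w) p x
       - T c p (\<Gamma> x y) z w - T c p y (\<Gamma> x z) w - T c p y z (\<Gamma> x w))"


section \<open>\<open>G\<^sub>2\<close>-structures\<close>

definition g2_structure :: "('a::topological_space, 7) riem \<Rightarrow> (('a, 7) chart \<Rightarrow> 'a \<Rightarrow> 7 form3) \<Rightarrow> bool" where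
  "g2_structure N \<phi> \<longleftrightarrow>
     (\<forall>c\<in>charts N. \<forall>p\<in>cdom c. \<exists>U (e :: 7 \<Rightarrow> 'a \<Rightarrow> real ^ 7).
        open U \<and> p \<in> U \<and> U \<subseteq> cdom c \<and> (\<forall>i. smooth_in c U (e i)) \<and>
        (\<forall>q\<in>U. orthonormal_basis (metric N c q) (\<lambda>i. e i q) \<and>
           \<phi> c q = g2_form (metric N c q) (\<lambda>i. e i q))) \<and>
     (\<forall>c\<in>charts N. \<forall>d\<in>charts N. \<forall>p\<in>cdom c \<inter> cdom d. \<forall>x y z.
        \<phi> c p x y z = \<phi> d p (dir_deriv c (cmap d) p x) (dir_deriv c (cmap d) p y) (dir_deriv c (cmap d) p z))"

definition star_phi :: "('a, 7) riem \<Rightarrow> (('a, 7) chart \<Rightarrow> 'a \<Rightarrow> 7 form3) \<Rightarrow> ('a, 7) chart \<Rightarrow> 'a \<Rightarrow> 7 form4" where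
  "star_phi N \<phi> c p = g2_star (metric N c p) (\<phi> c p)"

definition r_bar :: "('a, 7) riem \<Rightarrow> (('a, 7) chart \<Rightarrow> 'a \<Rightarrow> 7 form3) \<Rightarrow> ('a, 7) chart \<Rightarrow> 'a \<Rightarrow> 7 form2" where
  "r_bar N \<phi> c p x y = inner_form3 (metric N c p) (nabla3 N \<phi> c p x) (star_phi N \<phi> c p y) / 4"

definition g2_type_X3 :: "('a, 7) riem \<Rightarrow> (('a, 7) chart \<Rightarrow> 'a \<Rightarrow> 7 form3) \<Rightarrow> bool" where
  "g2_type_X3 N \<phi> \<longleftrightarrow> (\<forall>c\<in>charts N. \<forall>p\<in>cdom c.
     (\<forall>x y. r_bar N \<phi> c p x y = r_bar N \<phi> c p y x) \<and> trace_form (metric N c p) (r_bar N \<phi> c p) = 0)"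


section \<open>Types of \<open>SU(3)\<close>-structures\<close>

record 'b su3 = "('b, 6) riem" +
  acs :: "('b, 6) chart \<Rightarrow> 'b \<Rightarrow> real ^ 6 \<Rightarrow> real ^ 6"
  psi_plus :: "('b, 6) chart \<Rightarrow> 'b \<Rightarrow> 6 form3"
  psi_minus :: "('b, 6) chart \<Rightarrow> 'b \<Rightarrow> 6 form3"

definition kaehler_form :: "'b su3 \<Rightarrow> ('b, 6) chart \<Rightarrow> 'b \<Rightarrow> 6 form2" where
  "kaehler_form S c p x y = metric S c p x (acs S c p y)"

datatype torsion_class = W1p | W1m | W2p | W2m | W3 | W4 | W5

context
  fixes b :: "6 form2" and I :: "real ^ 6 \<Rightarrow> real ^ 6" and \<psi> :: "6 form3"
begin

definition gh_space :: "6 form3 set" where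
  "gh_space = {\<alpha>. trilinear \<alpha> \<and>
     (\<forall>x y z. \<alpha> x y z = - \<alpha> x z y \<and> \<alpha> x y z = - \<alpha> x (I y) (I z))}"

definition gh_W1 :: "6 form3 set" where
  "gh_W1 = {\<alpha> \<in> gh_space. \<forall>x y z. \<alpha> x y z = - \<alpha> y x z \<and> \<alpha> x y z = - \<alpha> x z y}"

definition gh_W2 :: "6 form3 set" where
  "gh_W2 = {\<alpha> \<in> gh_space. \<forall>x y z. \<alpha> x y z + \<alpha> y z x + \<alpha> z x y = 0}"

definition gh_W3 :: "6 form3 set" where
  "gh_W3 = {\<alpha> \<in> gh_space. (\<forall>x y z. \<alpha> (I x) (I y) z = \<alpha> x y z) \<and>
     (\<forall>z. trace_form b (\<lambda>x y. \<alpha> x y z) = 0)}"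

definition gh_W4 :: "6 form3 set" where
  "gh_W4 = {\<alpha> \<in> gh_space. \<exists>\<tau>. linear \<tau> \<and> (\<forall>x y z. \<alpha> x y z =
     b x y * \<tau> z - b x z * \<tau> y - b x (I y) * \<tau> (I z) + b x (I z) * \<tau> (I y))}"

definition r_map :: "6 form3 \<Rightarrow> 6 form2" where
  "r_map \<alpha> x y = inner_form2 b (\<alpha> x) (\<psi> y) / 2"

text \<open>The class \<open>W5\<close> does not contribute to \<open>\<nabla>\<omega>\<close>.\<close>

primrec torsion_space :: "torsion_class \<Rightarrow> 6 form3 set" where
  "torsion_space W1p = {\<alpha> \<in> gh_W1. \<forall>x y. r_map \<alpha> x y = r_map \<alpha> y x}"
| "torsion_space W1m = {\<alpha> \<in> gh_W1. \<forall>x y. r_map \<alpha> x y = - r_map \<alpha> y x}"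
| "torsion_space W2p = {\<alpha> \<in> gh_W2. \<forall>x y. r_map \<alpha> x y = r_map \<alpha> y x}"
| "torsion_space W2m = {\<alpha> \<in> gh_W2. \<forall>x y. r_map \<alpha> x y = - r_map \<alpha> y x}"
| "torsion_space W3 = gh_W3"
| "torsion_space W4 = gh_W4"
| "torsion_space W5 = {\<lambda>x y z. 0}"

end

text \<open>The one-form \<open>\<eta>\<close> is determined by \<open>(I\<eta>) (x) = - \<langle>\<nabla>\<^sub>x \<psi>\<^sub>+, \<psi>\<^sub>-\<rangle> / 12\<close>, where \<open>(I\<eta>) (x) = - \<eta> (I x)\<close>;
  as \<open>I\<^sup>2 = -1\<close>, this means \<open>\<eta> (x) = (I\<eta>) (I x)\<close>.\<close>

definition W5_form :: "'b su3 \<Rightarrow> ('b, 6) chart \<Rightarrow> 'b \<Rightarrow> 6 form1" where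
  "W5_form S c p x = - inner_form3 (metric S c p)
      (nabla3 S (psi_plus S) c p (acs S c p x)) (psi_minus S c p) / 12"

text \<open>The family \<open>\<alpha>\<close> below consists of the components of \<open>\<nabla>\<omega>\<close> at a point; the spaces of the classes
  \<open>W1p, \<dots>, W4\<close> form a direct sum, so it is unique if it exists.\<close>

definition su3_of_type :: "'b su3 \<Rightarrow> torsion_class set \<Rightarrow> bool" where
  "su3_of_type S \<U> \<longleftrightarrow> (\<forall>c\<in>charts S. \<forall>p\<in>cdom c.
     (\<exists>\<alpha> :: torsion_class \<Rightarrow> 6 form3.
        (\<forall>k. \<alpha> k \<in> torsion_space (metric S c p) (acs S c p) (psi_plus S c p) k) \<and>
        (\<forall>x y z. nabla2 S (kaehler_form S) c p x y z
           = (\<Sum>k\<in>{W1p, W1m, W2p, W2m, W3, W4, W5}. \<alpha> k x y z)) \<and>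
        (\<forall>k. k \<notin> \<U> \<longrightarrow> (\<forall>x y z. \<alpha> k x y z = 0))) \<and>
     (W5 \<notin> \<U> \<longrightarrow> (\<forall>x. W5_form S c p x = 0)))"


section \<open>Hypersurfaces of \<open>G\<^sub>2\<close>-manifolds\<close>

definition hypersurface :: "('a::topological_space, 7) riem \<Rightarrow> ('b::topological_space, 6) chart set
    \<Rightarrow> ('b \<Rightarrow> 'a) \<Rightarrow> bool" where
  "hypersurface N A \<iota> \<longleftrightarrow> smooth_atlas A \<and>
     \<iota> ` carrier_of A \<subseteq> carrier_of (charts N) \<and> continuous_on (carrier_of A) \<iota> \<and>
     (\<forall>d\<in>A. \<forall>c\<in>charts N. smooth_in d (cdom d \<inter> \<iota> -` cdom c) (cmap c \<circ> \<iota>)) \<and>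
     (\<forall>d\<in>A. \<forall>c\<in>charts N. \<forall>p\<in>cdom d \<inter> \<iota> -` cdom c. inj (dir_deriv d (cmap c \<circ> \<iota>) p))"

text \<open>A vector field along \<open>\<iota>\<close> is given by its components \<open>n c p\<close> at \<open>p\<close> in charts \<open>c\<close> around \<open>\<iota> p\<close>.\<close>

definition unit_normal_field :: "('a, 7) riem \<Rightarrow> ('b, 6) chart set \<Rightarrow> ('b \<Rightarrow> 'a)
    \<Rightarrow> (('a, 7) chart \<Rightarrow> 'b \<Rightarrow> real ^ 7) \<Rightarrow> bool" where
  "unit_normal_field N A \<iota> n \<longleftrightarrow>
     (\<forall>c\<in>charts N. \<forall>c'\<in>charts N. \<forall>p\<in>carrier_of A \<inter> \<iota> -` (cdom c \<inter> cdom c').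
        n c' p = dir_deriv c (cmap c') (\<iota> p) (n c p)) \<and>
     (\<forall>d\<in>A. \<forall>c\<in>charts N. smooth_in d (cdom d \<inter> \<iota> -` cdom c) (n c)) \<and>
     (\<forall>d\<in>A. \<forall>c\<in>charts N. \<forall>p\<in>cdom d \<inter> \<iota> -` cdom c.
        metric N c (\<iota> p) (n c p) (n c p) = 1 \<and>
        (\<forall>x. metric N c (\<iota> p) (dir_deriv d (cmap c \<circ> \<iota>) p x) (n c p) = 0))"

text \<open>From here on, \<open>amb N \<iota> p\<close> is a selected chart of the ambient manifold around \<open>\<iota> p\<close>, and
  ambient tangent vectors and tensors at \<open>\<iota> p\<close> are written in that chart. The resulting real numbers
  do not depend on the selection.\<close>

definition amb :: "('a, 7) riem \<Rightarrow> ('b \<Rightarrow> 'a) \<Rightarrow> 'b \<Rightarrow> ('a, 7) chart" where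
  "amb N \<iota> p = chart_at (charts N) (\<iota> p)"

definition push :: "('a, 7) riem \<Rightarrow> ('b \<Rightarrow> 'a) \<Rightarrow> ('b, 6) chart \<Rightarrow> 'b \<Rightarrow> real ^ 6 \<Rightarrow> real ^ 7" where
  "push N \<iota> d p x = dir_deriv d (cmap (amb N \<iota> p) \<circ> \<iota>) p x"

definition induced_metric :: "('a, 7) riem \<Rightarrow> ('b \<Rightarrow> 'a) \<Rightarrow> ('b, 6) chart \<Rightarrow> 'b \<Rightarrow> 6 form2" where
  "induced_metric N \<iota> d p x y = metric N (amb N \<iota> p) (\<iota> p) (push N \<iota> d p x) (push N \<iota> d p y)"

definition induced_acs :: "('a, 7) riem \<Rightarrow> (('a, 7) chart \<Rightarrow> 'a \<Rightarrow> 7 form3) \<Rightarrow> ('b \<Rightarrow> 'a)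
    \<Rightarrow> (('a, 7) chart \<Rightarrow> 'b \<Rightarrow> real ^ 7) \<Rightarrow> ('b, 6) chart \<Rightarrow> 'b \<Rightarrow> real ^ 6 \<Rightarrow> real ^ 6" where
  "induced_acs N \<phi> \<iota> n d p x = (let c = amb N \<iota> p in
     THE y. push N \<iota> d p y = cross_product (metric N c (\<iota> p)) (\<phi> c (\<iota> p)) (n c p) (push N \<iota> d p x))"

text \<open>\<open>\<iota>\<^sup>*\<phi>\<close> and \<open>\<iota>\<^sup>*\<close> of the interior product of \<open>n\<close> with \<open>*\<phi>\<close>.\<close>

definition pull_phi :: "('a, 7) riem \<Rightarrow> (('a, 7) chart \<Rightarrow> 'a \<Rightarrow> 7 form3) \<Rightarrow> ('b \<Rightarrow> 'a)
    \<Rightarrow> ('b, 6) chart \<Rightarrow> 'b \<Rightarrow> 6 form3" where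
  "pull_phi N \<phi> \<iota> d p x y z =
     \<phi> (amb N \<iota> p) (\<iota> p) (push N \<iota> d p x) (push N \<iota> d p y) (push N \<iota> d p z)"

definition pull_n_star_phi :: "('a, 7) riem \<Rightarrow> (('a, 7) chart \<Rightarrow> 'a \<Rightarrow> 7 form3) \<Rightarrow> ('b \<Rightarrow> 'a)
    \<Rightarrow> (('a, 7) chart \<Rightarrow> 'b \<Rightarrow> real ^ 7) \<Rightarrow> ('b, 6) chart \<Rightarrow> 'b \<Rightarrow> 6 form3" where
  "pull_n_star_phi N \<phi> \<iota> n d p x y z =
     star_phi N \<phi> (amb N \<iota> p) (\<iota> p) (n (amb N \<iota> p) p) (push N \<iota> d p x) (push N \<iota> d p y) (push N \<iota> d p z)"

definition induced_su3 :: "('a, 7) riem \<Rightarrow> (('a, 7) chart \<Rightarrow> 'a \<Rightarrow> 7 form3) \<Rightarrow> ('b, 6) chart set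
    \<Rightarrow> ('b \<Rightarrow> 'a) \<Rightarrow> (('a, 7) chart \<Rightarrow> 'b \<Rightarrow> real ^ 7) \<Rightarrow> real \<Rightarrow> 'b su3" where
  "induced_su3 N \<phi> A \<iota> n \<theta> =
     \<lparr> charts = A,
       metric = induced_metric N \<iota>,
       acs = induced_acs N \<phi> \<iota> n,
       psi_plus = (\<lambda>d p x y z. cos \<theta> * pull_phi N \<phi> \<iota> d p x y z - sin \<theta> * pull_n_star_phi N \<phi> \<iota> n d p x y z),
       psi_minus = (\<lambda>d p x y z. sin \<theta> * pull_phi N \<phi> \<iota> d p x y z + cos \<theta> * pull_n_star_phi N \<phi> \<iota> n d p x y z) \<rparr>"

text \<open>\<open>B x y\<close> is the scalar product with \<open>n\<close> of the ambient covariant derivative, in the direction of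
  \<open>\<iota>\<^sub>* x\<close>, of \<open>\<iota>\<^sub>* Y\<close>, where \<open>Y\<close> is the extension of \<open>y\<close> with constant components.\<close>

definition second_ff :: "('a, 7) riem \<Rightarrow> ('b \<Rightarrow> 'a) \<Rightarrow> (('a, 7) chart \<Rightarrow> 'b \<Rightarrow> real ^ 7)
    \<Rightarrow> ('b, 6) chart \<Rightarrow> 'b \<Rightarrow> 6 form2" where
  "second_ff N \<iota> n d p x y = (let c = amb N \<iota> p in
     metric N c (\<iota> p)
       (dir_deriv d (\<lambda>q. dir_deriv d (cmap c \<circ> \<iota>) q y) p x
         + levi_civita N c (\<iota> p) (push N \<iota> d p x) (push N \<iota> d p y))
       (n c p))"

definition mean_curv :: "('a, 7) riem \<Rightarrow> ('b \<Rightarrow> 'a) \<Rightarrow> (('a, 7) chart \<Rightarrow> 'b \<Rightarrow> real ^ 7)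
    \<Rightarrow> ('b, 6) chart \<Rightarrow> 'b \<Rightarrow> real" where
  "mean_curv N \<iota> n d p = trace_form (induced_metric N \<iota> d p) (second_ff N \<iota> n d p) / 6"

definition minimal_variety :: "('a, 7) riem \<Rightarrow> ('b, 6) chart set \<Rightarrow> ('b \<Rightarrow> 'a)
    \<Rightarrow> (('a, 7) chart \<Rightarrow> 'b \<Rightarrow> real ^ 7) \<Rightarrow> bool" where
  "minimal_variety N A \<iota> n \<longleftrightarrow> (\<forall>d\<in>A. \<forall>p\<in>cdom d. mean_curv N \<iota> n d p = 0)"

text \<open>The tangential, mixed and normal parts of \<open>r_bar\<close> along the hypersurface.\<close>

definition r_tt :: "('a, 7) riem \<Rightarrow> (('a, 7) chart \<Rightarrow> 'a \<Rightarrow> 7 form3) \<Rightarrow> ('b \<Rightarrow> 'a)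
    \<Rightarrow> ('b, 6) chart \<Rightarrow> 'b \<Rightarrow> 6 form2" where
  "r_tt N \<phi> \<iota> d p x y = r_bar N \<phi> (amb N \<iota> p) (\<iota> p) (push N \<iota> d p x) (push N \<iota> d p y)"

definition r_tn :: "('a, 7) riem \<Rightarrow> (('a, 7) chart \<Rightarrow> 'a \<Rightarrow> 7 form3) \<Rightarrow> ('b \<Rightarrow> 'a)
    \<Rightarrow> (('a, 7) chart \<Rightarrow> 'b \<Rightarrow> real ^ 7) \<Rightarrow> ('b, 6) chart \<Rightarrow> 'b \<Rightarrow> 6 form1" where
  "r_tn N \<phi> \<iota> n d p x = r_bar N \<phi> (amb N \<iota> p) (\<iota> p) (push N \<iota> d p x) (n (amb N \<iota> p) p)"

definition r_nn :: "('a, 7) riem \<Rightarrow> (('a, 7) chart \<Rightarrow> 'a \<Rightarrow> 7 form3) \<Rightarrow> ('b \<Rightarrow> 'a)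
    \<Rightarrow> (('a, 7) chart \<Rightarrow> 'b \<Rightarrow> real ^ 7) \<Rightarrow> 'b \<Rightarrow> real" where
  "r_nn N \<phi> \<iota> n p = r_bar N \<phi> (amb N \<iota> p) (\<iota> p) (n (amb N \<iota> p) p) (n (amb N \<iota> p) p)"

text \<open>The actions \<open>I\<^sub>(\<^sub>1\<^sub>)\<close>, \<open>I\<^sub>(\<^sub>2\<^sub>)\<close> and \<open>I\<close> of an almost complex structure on bilinear forms.\<close>

definition I1 :: "('v \<Rightarrow> 'v) \<Rightarrow> ('v \<Rightarrow> 'v \<Rightarrow> real) \<Rightarrow> 'v \<Rightarrow> 'v \<Rightarrow> real" where
  "I1 I T x y = - T (I x) y"

definition I2 :: "('v \<Rightarrow> 'v) \<Rightarrow> ('v \<Rightarrow> 'v \<Rightarrow> real) \<Rightarrow> 'v \<Rightarrow> 'v \<Rightarrow> real" where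
  "I2 I T x y = - T x (I y)"

definition I12 :: "('v \<Rightarrow> 'v) \<Rightarrow> ('v \<Rightarrow> 'v \<Rightarrow> real) \<Rightarrow> 'v \<Rightarrow> 'v \<Rightarrow> real" where
  "I12 I T x y = T (I x) (I y)"

text \<open>The two equations exchanged between \<open>\<theta> = 0\<close> and \<open>\<theta> = \<pi>/2\<close>:
  \<open>3 (1 + I) \<iota>\<^sup>*r = - r (n, n) \<langle>\<cdot>,\<cdot>\<rangle>\<close> and \<open>(1 + I) B = 2 h \<langle>\<cdot>,\<cdot>\<rangle>\<close>.\<close>

definition r_equation :: "('a, 7) riem \<Rightarrow> (('a, 7) chart \<Rightarrow> 'a \<Rightarrow> 7 form3) \<Rightarrow> ('b, 6) chart set
    \<Rightarrow> ('b \<Rightarrow> 'a) \<Rightarrow> (('a, 7) chart \<Rightarrow> 'b \<Rightarrow> real ^ 7) \<Rightarrow> bool" where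
  "r_equation N \<phi> A \<iota> n \<longleftrightarrow> (\<forall>d\<in>A. \<forall>p\<in>cdom d. \<forall>x y.
     3 * (r_tt N \<phi> \<iota> d p x y + I12 (induced_acs N \<phi> \<iota> n d p) (r_tt N \<phi> \<iota> d p) x y)
       = - r_nn N \<phi> \<iota> n p * induced_metric N \<iota> d p x y)"

definition B_equation :: "('a, 7) riem \<Rightarrow> (('a, 7) chart \<Rightarrow> 'a \<Rightarrow> 7 form3) \<Rightarrow> ('b, 6) chart set
    \<Rightarrow> ('b \<Rightarrow> 'a) \<Rightarrow> (('a, 7) chart \<Rightarrow> 'b \<Rightarrow> real ^ 7) \<Rightarrow> bool" where
  "B_equation N \<phi> A \<iota> n \<longleftrightarrow> (\<forall>d\<in>A. \<forall>p\<in>cdom d. \<forall>x y.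
     second_ff N \<iota> n d p x y + I12 (induced_acs N \<phi> \<iota> n d p) (second_ff N \<iota> n d p) x y
       = 2 * mean_curv N \<iota> n d p * induced_metric N \<iota> d p x y)"

end

(*
  In a local G2-frame with connection matrix W, the derivative of phi is W acting on the model form, which
  equals the contraction of the model *phi with a vector rho(W); hence r_bar(x, y) = <rho(W_x), y>.
  Along the hypersurface choose the frame with e_0 = n at the given point (G2 is transitive on the
  six-sphere). Differentiating omega = n _| phi, psi_+ and psi_- restricted to M in this frame gives
      (nabla_x omega)(y, z) = phi(L x, y, z),   <L x, y> = B(x, y) + r(x, I y),
      <nabla_x psi_+, psi_-> = 4 r(x, n).
  The tensor phi(L ., ., .) lies in W_1 iff L is a complex multiple of the identity, in W_2 iff L is complex linear
  with vanishing complex trace, and in W_3 (resp. W_4) iff L is complex antilinear and symmetric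
  (resp. skew); the signs in W_1 and W_2 separate the symmetric and skew parts of L. As B and r are
  symmetric, there is no W_4-part, and each condition is the vanishing of one component of L.
*)
theory Submission
  imports Defs
begin

section \<open>The model \<open>G\<^sub>2\<close>-form on \<open>\<real>\<^sup>7\<close>\<close>

text \<open>The objects of the statement are picked by description: bases by \<open>SOME\<close>,
  the connection and the complex structure by \<open>THE\<close>, the ambient chart by
  \<open>amb\<close>, and that chart may change abruptly from one point to the next. Each is
  therefore characterised by a property blind to the choice, and every derivative at a point is
  taken in the single chart selected there. The map rho exists because so(7) is the sum of g2 and a
  copy of R^7: the g2 part of W does not move phi. The torsion algebra is set up for an abstract
  real part of a complex volume form. Its hypotheses survive multiplication of that form by i, so
  one computation serves both values of theta. That a given type forces a component of L to vanish
  requires the sum of the classes to be direct. This is read off the bilinear form of L: symmetry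
  separates plus from minus, complex linearity separates W_1 + W_2 from W_3, and the two traces
  separate W_1 from W_2.\<close>

lemma UNIV_6: "(UNIV::6 set) = {0,1,2,3,4,5}"
  by (rule card_subset_eq[symmetric]) simp_all

lemma UNIV_7: "(UNIV::7 set) = {0,1,2,3,4,5,6}"
  by (rule card_subset_eq[symmetric]) simp_all

lemma sum_6: "sum f (UNIV::6 set) = f 0 + f 1 + f 2 + f 3 + f 4 + f 5"
  unfolding UNIV_6 by (simp add: add.assoc)

lemma sum_7: "sum f (UNIV::7 set) = f 0 + f 1 + f 2 + f 3 + f 4 + f 5 + f 6"
  unfolding UNIV_7 by (simp add: add.assoc)

lemma forall_6: "(\<forall>i::6. P i) \<longleftrightarrow> P 0 \<and> P 1 \<and> P 2 \<and> P 3 \<and> P 4 \<and> P 5"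
  by (metis (no_types, lifting) UNIV_6 UNIV_I insert_iff empty_iff)

lemma forall_7: "(\<forall>i::7. P i) \<longleftrightarrow> P 0 \<and> P 1 \<and> P 2 \<and> P 3 \<and> P 4 \<and> P 5 \<and> P 6"
  by (metis (no_types, lifting) UNIV_7 UNIV_I insert_iff empty_iff)

section \<open>The three-form, its dual and the cross product in coordinates\<close>

definition phi0 :: "7 form3" where
  "phi0 x y z = (\<Sum>i\<in>UNIV. wedge3 (\<lambda>v. v $ i) (\<lambda>v. v $ (i + 1)) (\<lambda>v. v $ (i + 3)) x y z)"

definition star0 :: "7 form4" where
  "star0 x y z w = - (\<Sum>i\<in>UNIV. wedge4 (\<lambda>v. v $ (i + 2)) (\<lambda>v. v $ (i + 4)) (\<lambda>v. v $ (i + 5)) (\<lambda>v. v $ (i + 6)) x y z w)"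

definition cross0 :: "real ^ 7 \<Rightarrow> real ^ 7 \<Rightarrow> real ^ 7" where
  "cross0 x y = (\<chi> k. phi0 x y (axis k 1))"

lemma mod7: "(7::7) = 0" "(8::7) = 1" "(9::7) = 2" "(10::7) = 3" "(11::7) = 4" "(12::7) = 5"
  by simp_all

text \<open>Pluecker coordinates of \<open>a \<and> b\<close>: expanding in these rather than in the components keeps the polynomial
  identities below small.\<close>

definition pl :: "real ^ 7 \<Rightarrow> real ^ 7 \<Rightarrow> 7 \<Rightarrow> 7 \<Rightarrow> real" where
  "pl a b i j = a $ i * b $ j - a $ j * b $ i"

lemma pl_swap:
  "pl x y 1 0 = - pl x y 0 1" "pl x y 2 0 = - pl x y 0 2" "pl x y 3 0 = - pl x y 0 3"
  "pl x y 4 0 = - pl x y 0 4" "pl x y 5 0 = - pl x y 0 5" "pl x y 6 0 = - pl x y 0 6"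
  "pl x y 2 1 = - pl x y 1 2" "pl x y 3 1 = - pl x y 1 3" "pl x y 4 1 = - pl x y 1 4"
  "pl x y 5 1 = - pl x y 1 5" "pl x y 6 1 = - pl x y 1 6" "pl x y 3 2 = - pl x y 2 3"
  "pl x y 4 2 = - pl x y 2 4" "pl x y 5 2 = - pl x y 2 5" "pl x y 6 2 = - pl x y 2 6"
  "pl x y 4 3 = - pl x y 3 4" "pl x y 5 3 = - pl x y 3 5" "pl x y 6 3 = - pl x y 3 6"
  "pl x y 5 4 = - pl x y 4 5" "pl x y 6 4 = - pl x y 4 6" "pl x y 6 5 = - pl x y 5 6"
  by (simp_all add: pl_def)

lemma phi0_explicit: "phi0 x y z =
  z $ 0 * (pl x y 1 3 + pl x y 4 5 + pl x y 2 6) + z $ 1 * (pl x y 2 4 + pl x y 5 6 - pl x y 0 3)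
  + z $ 2 * (pl x y 3 5 - pl x y 1 4 - pl x y 0 6) + z $ 3 * (pl x y 0 1 - pl x y 2 5 + pl x y 4 6)
  + z $ 4 * (pl x y 1 2 - pl x y 3 6 - pl x y 0 5) + z $ 5 * (pl x y 2 3 + pl x y 0 4 - pl x y 1 6)
  + z $ 6 * (pl x y 3 4 + pl x y 1 5 + pl x y 0 2)"
  unfolding phi0_def sum_7 pl_def wedge3_def wedge2_def by (simp add: mod7 algebra_simps)

lemma phi0_linear:
  "linear (\<lambda>x. phi0 x y z)" "linear (\<lambda>y. phi0 x y z)" "linear (\<lambda>z. phi0 x y z)"
  by (rule linearI; simp add: phi0_explicit pl_def algebra_simps)+

lemma cross0_nth [simp]:
  "cross0 x y $ 0 = pl x y 1 3 + pl x y 4 5 + pl x y 2 6"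
  "cross0 x y $ 1 = pl x y 2 4 + pl x y 5 6 - pl x y 0 3"
  "cross0 x y $ 2 = pl x y 3 5 - pl x y 1 4 - pl x y 0 6"
  "cross0 x y $ 3 = pl x y 0 1 - pl x y 2 5 + pl x y 4 6"
  "cross0 x y $ 4 = pl x y 1 2 - pl x y 3 6 - pl x y 0 5"
  "cross0 x y $ 5 = pl x y 2 3 + pl x y 0 4 - pl x y 1 6"
  "cross0 x y $ 6 = pl x y 3 4 + pl x y 1 5 + pl x y 0 2"
  by (simp_all add: cross0_def phi0_explicit axis_def)

lemma inner_cross0: "cross0 x y \<bullet> z = phi0 x y z"
  unfolding inner_vec_def sum_7 phi0_explicit by (simp add: mult.commute)

text \<open>Laplace expansion of the determinant along the arguments \<open>a\<close>,
  \<open>b\<close>: each of the six index pairs contributes a minor in \<open>a\<close>,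
  \<open>b\<close> times the complementary minor in \<open>c\<close>, \<open>d\<close>.\<close>

lemma wedge4_pl: "wedge4 (\<lambda>v. v $ i) (\<lambda>v. v $ j) (\<lambda>v. v $ k) (\<lambda>v. v $ l) a b c d =
   pl a b i j * pl c d k l - pl a b i k * pl c d j l + pl a b i l * pl c d j k
   + pl a b j k * pl c d i l - pl a b j l * pl c d i k + pl a b k l * pl c d i j"
  unfolding pl_def wedge4_def wedge3_def wedge2_def by (simp add: algebra_simps)

text \<open>Cauchy-Binet for 2 by 2 minors. With it every term of \<open>star0_cross\<close> is
  bilinear in the Pluecker coordinates of the pairs \<open>a\<close>, \<open>b\<close> and
  \<open>c\<close>, \<open>d\<close>, so that identity can be compared coefficient by
  coefficient.\<close>

lemma gram: "(a \<bullet> c) * (b \<bullet> d) - (a \<bullet> d) * (b \<bullet> c) =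
  pl a b 0 1 * pl c d 0 1 + pl a b 0 2 * pl c d 0 2 + pl a b 0 3 * pl c d 0 3 + pl a b 0 4 * pl c d 0 4 + pl a b 0 5 * pl c d 0 5 + pl a b 0 6 * pl c d 0 6
 + pl a b 1 2 * pl c d 1 2 + pl a b 1 3 * pl c d 1 3 + pl a b 1 4 * pl c d 1 4 + pl a b 1 5 * pl c d 1 5 + pl a b 1 6 * pl c d 1 6
 + pl a b 2 3 * pl c d 2 3 + pl a b 2 4 * pl c d 2 4 + pl a b 2 5 * pl c d 2 5 + pl a b 2 6 * pl c d 2 6
 + pl a b 3 4 * pl c d 3 4 + pl a b 3 5 * pl c d 3 5 + pl a b 3 6 * pl c d 3 6
 + pl a b 4 5 * pl c d 4 5 + pl a b 4 6 * pl c d 4 6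
 + pl a b 5 6 * pl c d 5 6"
  unfolding inner_vec_def sum_7 pl_def inner_real_def by (simp only: algebra_simps)
lemma star0_cross:
  "star0 a b c d = - (cross0 a b \<bullet> cross0 c d) + (a \<bullet> c) * (b \<bullet> d) - (a \<bullet> d) * (b \<bullet> c)"
  unfolding star0_def wedge4_pl add_diff_eq[symmetric] gram
  unfolding inner_vec_def sum_7
  by (simp add: mod7 pl_swap algebra_simps)

text \<open>The projection of \<open>so(7)\<close> onto the complement of the Lie algebra of \<open>G\<^sub>2\<close>, identified with \<open>\<real>\<^sup>7\<close>.\<close>

definition rho0 :: "(real ^ 7 \<Rightarrow> real ^ 7) \<Rightarrow> real ^ 7" where
  "rho0 W = (1 / 2) *\<^sub>R (\<Sum>j\<in>UNIV. cross0 (W (axis j 1)) (axis j 1))"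

definition skew_map :: "(real ^ 'n \<Rightarrow> real ^ 'n) \<Rightarrow> bool" where
  "skew_map W \<longleftrightarrow> linear W \<and> (\<forall>x y. W x \<bullet> y = - (x \<bullet> W y))"

lemma skew_map_nth:
  fixes W :: "real ^ 'n \<Rightarrow> real ^ 'n"
  assumes "skew_map W"
  shows "W x $ i = (\<Sum>j\<in>UNIV. x $ j * W (axis j 1) $ i)" "W (axis i 1) $ j = - W (axis j 1) $ i" "W (axis i 1) $ i = 0"
proof -
  have lin: "linear W" and sk: "\<And>x y. W x \<bullet> y = - (x \<bullet> W y)"
    using assms by (auto simp: skew_map_def)
  have "x = (\<Sum>j\<in>UNIV. x $ j *\<^sub>R axis j 1)"
    using basis_expansion[of x] by (simp add: scalar_mult_eq_scaleR)
  then have "W x = (\<Sum>j\<in>UNIV. x $ j *\<^sub>R W (axis j 1))"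
    using lin by (metis (no_types, lifting) linear_cmul linear_sum sum.cong)
  then show "W x $ i = (\<Sum>j\<in>UNIV. x $ j * W (axis j 1) $ i)" by simp
  show *: "W (axis i 1) $ j = - W (axis j 1) $ i" for i j
    using sk[of "axis i 1" "axis j 1"] by (simp add: inner_axis inner_axis')
  show "W (axis i 1) $ i = 0" using *[of i i] by simp
qed

lemma skew_map_swap:
  assumes "skew_map (W :: real ^ 7 \<Rightarrow> real ^ 7)"
  shows
  "W (axis 0 1) $ 1 = - W (axis 1 1) $ 0" "W (axis 0 1) $ 2 = - W (axis 2 1) $ 0" "W (axis 0 1) $ 3 = - W (axis 3 1) $ 0" "W (axis 0 1) $ 4 = - W (axis 4 1) $ 0" "W (axis 0 1) $ 5 = - W (axis 5 1) $ 0" "W (axis 0 1) $ 6 = - W (axis 6 1) $ 0"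
  "W (axis 1 1) $ 2 = - W (axis 2 1) $ 1" "W (axis 1 1) $ 3 = - W (axis 3 1) $ 1" "W (axis 1 1) $ 4 = - W (axis 4 1) $ 1" "W (axis 1 1) $ 5 = - W (axis 5 1) $ 1" "W (axis 1 1) $ 6 = - W (axis 6 1) $ 1"
  "W (axis 2 1) $ 3 = - W (axis 3 1) $ 2" "W (axis 2 1) $ 4 = - W (axis 4 1) $ 2" "W (axis 2 1) $ 5 = - W (axis 5 1) $ 2" "W (axis 2 1) $ 6 = - W (axis 6 1) $ 2"
  "W (axis 3 1) $ 4 = - W (axis 4 1) $ 3" "W (axis 3 1) $ 5 = - W (axis 5 1) $ 3" "W (axis 3 1) $ 6 = - W (axis 6 1) $ 3"
  "W (axis 4 1) $ 5 = - W (axis 5 1) $ 4" "W (axis 4 1) $ 6 = - W (axis 6 1) $ 4"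
  "W (axis 5 1) $ 6 = - W (axis 6 1) $ 5"
  "W (axis i 1) $ i = 0"
  using skew_map_nth(2,3)[OF assms] by blast+

lemma axis_1_nth: "axis i (1::real) $ j = (if j = i then 1 else 0)"
  by (simp add: axis_def)

text \<open>By skewness each pair of basis vectors contributes twice to the defining sum, which the
  factor 1/2 absorbs.\<close>

lemma rho0_nth:
  assumes "skew_map W"
  shows "rho0 W $ 0 = W (axis 3 1) $ 1 + W (axis 5 1) $ 4 + W (axis 6 1) $ 2"
  "rho0 W $ 1 = W (axis 4 1) $ 2 + W (axis 6 1) $ 5 - W (axis 3 1) $ 0"
  "rho0 W $ 2 = W (axis 5 1) $ 3 - W (axis 4 1) $ 1 - W (axis 6 1) $ 0"
  "rho0 W $ 3 = W (axis 1 1) $ 0 - W (axis 5 1) $ 2 + W (axis 6 1) $ 4"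
  "rho0 W $ 4 = W (axis 2 1) $ 1 - W (axis 6 1) $ 3 - W (axis 5 1) $ 0"
  "rho0 W $ 5 = W (axis 3 1) $ 2 + W (axis 4 1) $ 0 - W (axis 6 1) $ 1"
  "rho0 W $ 6 = W (axis 4 1) $ 3 + W (axis 5 1) $ 1 + W (axis 2 1) $ 0"
  by (simp_all add: rho0_def sum_7 pl_def axis_1_nth skew_map_swap[OF assms])

text \<open>The stabiliser g2 of \<open>phi0\<close> in so(7) has codimension seven, so the
  derivative of \<open>phi0\<close> along \<open>W\<close> can depend on seven numbers only; that
  these enter through \<open>star0\<close> is checked in coordinates. A basis vector in the last
  slot keeps the polynomials small, and linearity removes this restriction afterwards.\<close>

lemma skew_map_phi0_axis:
  assumes "skew_map W"
  shows "phi0 (W a) b (axis k 1) + phi0 a (W b) (axis k 1) + phi0 a b (W (axis k 1)) = star0 (rho0 W) a b (axis k 1)"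
proof -
  note W = skew_map_nth(1)[OF assms, unfolded sum_7]
  have "\<forall>k. phi0 (W a) b (axis k 1) + phi0 a (W b) (axis k 1) + phi0 a b (W (axis k 1)) = star0 (rho0 W) a b (axis k 1)"
    unfolding forall_7 star0_def wedge4_pl phi0_explicit sum_7
    by (intro conjI; simp add: mod7 pl_def[of _ "axis _ 1"] axis_1_nth; simp add: rho0_nth[OF assms] pl_def W[of a] W[of b] skew_map_swap[OF assms] algebra_simps)
  then show ?thesis ..
qed

lemma star0_linear:
  "linear (\<lambda>x. star0 x y z w)" "linear (\<lambda>y. star0 x y z w)" "linear (\<lambda>z. star0 x y z w)" "linear (\<lambda>w. star0 x y z w)"
  by (rule linearI; simp add: star0_def wedge4_def wedge3_def wedge2_def
     algebra_simps sum.distrib sum_distrib_left sum_subtractf)+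

lemma linear_eq_axis:
  fixes f g :: "real ^ 'n \<Rightarrow> 'b::real_vector"
  assumes "linear f" "linear g" "\<And>k. f (axis k 1) = g (axis k 1)"
  shows "f x = g x"
  by (rule linear_eq_stdbasis[OF assms(1,2), THEN fun_cong])
    (use assms(3) in \<open>auto simp: Basis_vec_def\<close>)

lemma skew_map_phi0:
  assumes "skew_map W"
  shows "phi0 (W a) b c + phi0 a (W b) c + phi0 a b (W c) = star0 (rho0 W) a b c"
proof -
  have W: "linear W" using assms by (simp add: skew_map_def)
  have "linear (\<lambda>c. phi0 (W a) b c + phi0 a (W b) c + phi0 a b (W c))"
    by (intro linear_compose_add phi0_linear linear_compose[OF W phi0_linear(3), unfolded o_def])
  from linear_eq_axis[OF this star0_linear(4)] show ?thesis
    using skew_map_phi0_axis[OF assms] by blast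
qed

text \<open>Up to sign convention the triple cross product of G2 geometry: the vector dual to the
  last slot of \<open>star0\<close>. It turns a sum over that slot into an inner product.\<close>

definition triple0 :: "real ^ 7 \<Rightarrow> real ^ 7 \<Rightarrow> real ^ 7 \<Rightarrow> real ^ 7" where
  "triple0 a b c = (a \<bullet> c) *\<^sub>R b - (b \<bullet> c) *\<^sub>R a - cross0 (cross0 a b) c"

lemma inner_triple0: "triple0 a b c \<bullet> d = star0 a b c d"
proof -
  have "phi0 (cross0 a b) c d = cross0 a b \<bullet> cross0 c d"
    unfolding inner_vec_def sum_7 phi0_explicit pl_def by (simp add: pl_def algebra_simps)
  then show ?thesis
    unfolding triple0_def inner_diff_left inner_scaleR_left inner_cross0 star0_cross by (simp add: inner_commute)
qed

lemma star0_contraction: "(\<Sum>i\<in>UNIV. \<Sum>j\<in>UNIV. \<Sum>k\<in>UNIV. star0 u (axis i 1) (axis j 1) (axis k 1)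
   * star0 v (axis i 1) (axis j 1) (axis k 1)) = 24 * (u \<bullet> v)"
proof -
  have "(\<Sum>k\<in>UNIV. star0 u a b (axis k 1) * star0 v a b (axis k 1)) = triple0 u a b \<bullet> triple0 v a b" for a b
    by (simp add: inner_triple0[symmetric] inner_axis) (simp add: inner_vec_def)
  \<comment> \<open>For a fixed second vector e_i, the contractions over the last two slots give
    four times the inner product of the projections of \<open>u\<close> and \<open>v\<close>
    orthogonal to e_i. Summing over the seven i yields 4 * (7 - 1) = 24.\<close>
  moreover have "\<forall>i. (\<Sum>j\<in>UNIV. triple0 u (axis i 1) (axis j 1) \<bullet> triple0 v (axis i 1) (axis j 1)) = 4 * (u \<bullet> v - u $ i * v $ i)"
    unfolding forall_7
    by (intro conjI; unfold sum_7 inner_vec_def; simp add: triple0_def inner_axis pl_def axis_1_nth;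
      simp add: algebra_simps)
  ultimately show ?thesis by (simp add: sum_subtractf sum_distrib_left[symmetric] inner_vec_def[of u v])
qed

section \<open>Contractions over the hyperplane orthogonal to e_0\<close>

definition tan_ax :: "6 \<Rightarrow> real ^ 7" where
  "tan_ax j = axis (if j = 0 then 1 else if j = 1 then 2 else if j = 2 then 3
     else if j = 3 then 4 else if j = 4 then 5 else 6) 1"

lemma tan_ax_nth: "tan_ax 0 $ i = (if i = 1 then 1 else 0)" "tan_ax 1 $ i = (if i = 2 then 1 else 0)"
 "tan_ax 2 $ i = (if i = 3 then 1 else 0)" "tan_ax 3 $ i = (if i = 4 then 1 else 0)"
 "tan_ax 4 $ i = (if i = 5 then 1 else 0)" "tan_ax 5 $ i = (if i = 6 then 1 else 0)"
  by (simp_all add: tan_ax_def axis_1_nth)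

abbreviation "e0 \<equiv> axis (0::7) (1::real)"

lemma sum_axis_tan: "(\<Sum>i\<in>UNIV. f (axis i (1::real))) = f e0 + (\<Sum>j\<in>UNIV. f (tan_ax j))"
  by (simp add: sum_6 sum_7 tan_ax_def add.assoc)

text \<open>\<open>star0 e0\<close> alternates, so triples containing e_0 contribute nothing and the
  tangential sum equals the full contraction.\<close>

lemma star0_tan_contraction: "(\<Sum>i\<in>UNIV. \<Sum>j\<in>UNIV. \<Sum>k\<in>UNIV. star0 u (tan_ax i) (tan_ax j) (tan_ax k)
   * star0 e0 (tan_ax i) (tan_ax j) (tan_ax k)) = 24 * u $ 0"
proof -
  have "star0 e0 e0 b c = 0" "star0 e0 b e0 c = 0" "star0 e0 b c e0 = 0" for b c
    unfolding star0_def wedge4_pl pl_def by (simp_all add: algebra_simps)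
  then show ?thesis
    using star0_contraction[of u e0]
      sum_axis_tan[of "\<lambda>x. \<Sum>j\<in>UNIV. \<Sum>k\<in>UNIV. star0 u x (axis j 1) (axis k 1) * star0 e0 x (axis j 1) (axis k 1)"]
      sum_axis_tan[of "\<lambda>y. \<Sum>k\<in>UNIV. star0 u x y (axis k 1) * star0 e0 x y (axis k 1)" for x]
      sum_axis_tan[of "\<lambda>z. star0 u x y z * star0 e0 x y z" for x y]
    by (simp add: inner_axis)
qed

lemma phi0_tan:
  "phi0 (tan_ax 0) (tan_ax 0) z = 0" "phi0 (tan_ax 0) (tan_ax 1) z = z $ 4" "phi0 (tan_ax 0) (tan_ax 2) z = z $ 0"
  "phi0 (tan_ax 0) (tan_ax 3) z = - z $ 2" "phi0 (tan_ax 0) (tan_ax 4) z = z $ 6" "phi0 (tan_ax 0) (tan_ax 5) z = - z $ 5"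
  "phi0 (tan_ax 1) (tan_ax 0) z = - z $ 4" "phi0 (tan_ax 1) (tan_ax 1) z = 0" "phi0 (tan_ax 1) (tan_ax 2) z = z $ 5"
  "phi0 (tan_ax 1) (tan_ax 3) z = z $ 1" "phi0 (tan_ax 1) (tan_ax 4) z = - z $ 3" "phi0 (tan_ax 1) (tan_ax 5) z = z $ 0"
  "phi0 (tan_ax 2) (tan_ax 0) z = - z $ 0" "phi0 (tan_ax 2) (tan_ax 1) z = - z $ 5" "phi0 (tan_ax 2) (tan_ax 2) z = 0"
  "phi0 (tan_ax 2) (tan_ax 3) z = z $ 6" "phi0 (tan_ax 2) (tan_ax 4) z = z $ 2" "phi0 (tan_ax 2) (tan_ax 5) z = - z $ 4"
  "phi0 (tan_ax 3) (tan_ax 0) z = z $ 2" "phi0 (tan_ax 3) (tan_ax 1) z = - z $ 1" "phi0 (tan_ax 3) (tan_ax 2) z = - z $ 6"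
  "phi0 (tan_ax 3) (tan_ax 3) z = 0" "phi0 (tan_ax 3) (tan_ax 4) z = z $ 0" "phi0 (tan_ax 3) (tan_ax 5) z = z $ 3"
  "phi0 (tan_ax 4) (tan_ax 0) z = - z $ 6" "phi0 (tan_ax 4) (tan_ax 1) z = z $ 3" "phi0 (tan_ax 4) (tan_ax 2) z = - z $ 2"
  "phi0 (tan_ax 4) (tan_ax 3) z = - z $ 0" "phi0 (tan_ax 4) (tan_ax 4) z = 0" "phi0 (tan_ax 4) (tan_ax 5) z = z $ 1"
  "phi0 (tan_ax 5) (tan_ax 0) z = z $ 5" "phi0 (tan_ax 5) (tan_ax 1) z = - z $ 0" "phi0 (tan_ax 5) (tan_ax 2) z = z $ 4"
  "phi0 (tan_ax 5) (tan_ax 3) z = - z $ 3" "phi0 (tan_ax 5) (tan_ax 4) z = - z $ 1" "phi0 (tan_ax 5) (tan_ax 5) z = 0"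
  unfolding phi0_explicit pl_def by (simp_all add: tan_ax_nth)

lemma star0_tan:
  "star0 e0 (tan_ax 0) (tan_ax 0) z = 0" "star0 e0 (tan_ax 0) (tan_ax 1) z = z $ 5" "star0 e0 (tan_ax 0) (tan_ax 2) z = 0"
  "star0 e0 (tan_ax 0) (tan_ax 3) z = - z $ 6" "star0 e0 (tan_ax 0) (tan_ax 4) z = - z $ 2" "star0 e0 (tan_ax 0) (tan_ax 5) z = z $ 4"
  "star0 e0 (tan_ax 1) (tan_ax 0) z = - z $ 5" "star0 e0 (tan_ax 1) (tan_ax 1) z = 0" "star0 e0 (tan_ax 1) (tan_ax 2) z = - z $ 4"
  "star0 e0 (tan_ax 1) (tan_ax 3) z = z $ 3" "star0 e0 (tan_ax 1) (tan_ax 4) z = z $ 1" "star0 e0 (tan_ax 1) (tan_ax 5) z = 0"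
  "star0 e0 (tan_ax 2) (tan_ax 0) z = 0" "star0 e0 (tan_ax 2) (tan_ax 1) z = z $ 4" "star0 e0 (tan_ax 2) (tan_ax 2) z = 0"
  "star0 e0 (tan_ax 2) (tan_ax 3) z = - z $ 2" "star0 e0 (tan_ax 2) (tan_ax 4) z = z $ 6" "star0 e0 (tan_ax 2) (tan_ax 5) z = - z $ 5"
  "star0 e0 (tan_ax 3) (tan_ax 0) z = z $ 6" "star0 e0 (tan_ax 3) (tan_ax 1) z = - z $ 3" "star0 e0 (tan_ax 3) (tan_ax 2) z = z $ 2"
  "star0 e0 (tan_ax 3) (tan_ax 3) z = 0" "star0 e0 (tan_ax 3) (tan_ax 4) z = 0" "star0 e0 (tan_ax 3) (tan_ax 5) z = - z $ 1"
  "star0 e0 (tan_ax 4) (tan_ax 0) z = z $ 2" "star0 e0 (tan_ax 4) (tan_ax 1) z = - z $ 1" "star0 e0 (tan_ax 4) (tan_ax 2) z = - z $ 6"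
  "star0 e0 (tan_ax 4) (tan_ax 3) z = 0" "star0 e0 (tan_ax 4) (tan_ax 4) z = 0" "star0 e0 (tan_ax 4) (tan_ax 5) z = z $ 3"
  "star0 e0 (tan_ax 5) (tan_ax 0) z = - z $ 4" "star0 e0 (tan_ax 5) (tan_ax 1) z = 0" "star0 e0 (tan_ax 5) (tan_ax 2) z = z $ 5"
  "star0 e0 (tan_ax 5) (tan_ax 3) z = z $ 1" "star0 e0 (tan_ax 5) (tan_ax 4) z = - z $ 3" "star0 e0 (tan_ax 5) (tan_ax 5) z = 0"
  unfolding inner_triple0[symmetric] triple0_def inner_diff_left inner_cross0 inner_scaleR_left inner_axis' phi0_explicit pl_def
  by (simp_all add: tan_ax_nth pl_def axis_1_nth) (simp_all add: inner_vec_def sum_7 tan_ax_nth)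

text \<open>On the hyperplane \<open>phi0\<close> restricts to e_124 + e_235 + e_346 + e_561, the
  model of psi_+; with indices lowered by one these are the four groups of six signed
  permutations.\<close>

lemma tan_contraction_phi0: "(\<Sum>i\<in>UNIV. \<Sum>j\<in>UNIV. \<Sum>k\<in>UNIV. T i j k * phi0 (tan_ax i) (tan_ax j) (tan_ax k)) =
  T 0 1 3 + T 1 3 0 + T 3 0 1 - T 1 0 3 - T 0 3 1 - T 3 1 0
  + T 1 2 4 + T 2 4 1 + T 4 1 2 - T 2 1 4 - T 1 4 2 - T 4 2 1
  + T 2 3 5 + T 3 5 2 + T 5 2 3 - T 3 2 5 - T 2 5 3 - T 5 3 2
  + T 4 5 0 + T 5 0 4 + T 0 4 5 - T 5 4 0 - T 4 0 5 - T 0 5 4"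
  unfolding sum_6 by (simp add: phi0_tan tan_ax_nth)

text \<open>The model of psi_- is e_356 - e_146 + e_125 - e_234.\<close>

lemma tan_contraction_star0: "(\<Sum>i\<in>UNIV. \<Sum>j\<in>UNIV. \<Sum>k\<in>UNIV. T i j k * star0 e0 (tan_ax i) (tan_ax j) (tan_ax k)) =
  T 2 4 5 + T 4 5 2 + T 5 2 4 - T 4 2 5 - T 2 5 4 - T 5 4 2
  - (T 0 3 5 + T 3 5 0 + T 5 0 3 - T 3 0 5 - T 0 5 3 - T 5 3 0)
  + T 0 1 4 + T 1 4 0 + T 4 0 1 - T 1 0 4 - T 0 4 1 - T 4 1 0
  - (T 1 2 3 + T 2 3 1 + T 3 1 2 - T 2 1 3 - T 1 3 2 - T 3 2 1)"
  unfolding sum_6 by (simp add: star0_tan tan_ax_nth)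

lemma star0_phi0: "star0 s a b c = (s \<bullet> b) * (a \<bullet> c) - (s \<bullet> c) * (a \<bullet> b) - phi0 b c (cross0 s a)"
  by (simp add: star0_cross inner_cross0[symmetric] inner_commute)

lemma inner_tan_ax: "v \<bullet> tan_ax 0 = v $ 1" "v \<bullet> tan_ax 1 = v $ 2" "v \<bullet> tan_ax 2 = v $ 3"
  "v \<bullet> tan_ax 3 = v $ 4" "v \<bullet> tan_ax 4 = v $ 5" "v \<bullet> tan_ax 5 = v $ 6"
  by (simp_all add: tan_ax_def inner_axis)

text \<open>Restricted to the hyperplane, \<open>star0 s\<close> is a multiple of psi_- for normal
  \<open>s\<close> and a one-form wedge omega for tangential \<open>s\<close>. The first is
  orthogonal to psi_+; so is the second, being of type (2,1) + (1,2) while psi_+ is of type (3,0) +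
  (0,3).\<close>

lemma tan_contraction_star_phi: "(\<Sum>i\<in>UNIV. \<Sum>j\<in>UNIV. \<Sum>k\<in>UNIV. star0 s (tan_ax i) (tan_ax j) (tan_ax k) * phi0 (tan_ax i) (tan_ax j) (tan_ax k)) = 0"
  unfolding tan_contraction_phi0 star0_phi0
  by (simp add: phi0_tan inner_tan_ax tan_ax_nth pl_def)

text \<open>Up to sign the first factor is \<open>b\<close> wedge omega, of type (2,1) + (1,2),
  hence orthogonal to psi_-. This removes the second fundamental form from the derivative of
  psi_+.\<close>

lemma tan_contraction_omega: "(\<Sum>i\<in>UNIV. \<Sum>j\<in>UNIV. \<Sum>k\<in>UNIV. (b i * phi0 e0 (tan_ax j) (tan_ax k)
   + b j * phi0 (tan_ax i) e0 (tan_ax k) + b k * phi0 (tan_ax i) (tan_ax j) e0) * star0 e0 (tan_ax i) (tan_ax j) (tan_ax k)) = 0"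
proof -
  have *: "phi0 e0 a b = phi0 a b e0" "phi0 a e0 b = - phi0 a b e0" for a b
    unfolding phi0_explicit pl_def by (simp_all add: axis_1_nth)
  show ?thesis
    unfolding tan_contraction_star0 *
    by (simp add: phi0_tan axis_1_nth)
qed

lemma star0_alternating: "star0 b a c d = - star0 a b c d" "star0 a c b d = - star0 a b c d" "star0 a b d c = - star0 a b c d"
  by (simp_all add: star0_def wedge4_def wedge3_def wedge2_def algebra_simps sum.distrib sum_subtractf flip: sum_negf)

lemma skew_map_tan_ax:
  assumes "skew_map W"
  shows "W (tan_ax 0) = W (axis 1 1)" "W (tan_ax 1) = W (axis 2 1)" "W (tan_ax 2) = W (axis 3 1)"
  "W (tan_ax 3) = W (axis 4 1)" "W (tan_ax 4) = W (axis 5 1)" "W (tan_ax 5) = W (axis 6 1)"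
  by (simp_all add: tan_ax_def)

text \<open>\<open>W\<close> acts on the four-form as minus the wedge of \<open>rho0 W\<close> with
  \<open>phi0\<close>. Inserting e_0 and restricting leaves \<open>- rho0 W $ 0\<close> times psi_+
  and a one-form wedge omega. The latter is orthogonal to psi_+, and psi_+ contracted with itself
  gives 4 * 6 = 24.\<close>

lemma tan_contraction_skew:
  assumes "skew_map W"
  shows "(\<Sum>i\<in>UNIV. \<Sum>j\<in>UNIV. \<Sum>k\<in>UNIV. (star0 (W e0) (tan_ax i) (tan_ax j) (tan_ax k)
    + star0 e0 (W (tan_ax i)) (tan_ax j) (tan_ax k) + star0 e0 (tan_ax i) (W (tan_ax j)) (tan_ax k)
    + star0 e0 (tan_ax i) (tan_ax j) (W (tan_ax k))) * phi0 (tan_ax i) (tan_ax j) (tan_ax k)) = - 24 * rho0 W $ 0"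
proof -
  \<comment> \<open>Alternation moves \<open>W\<close> into the last slot, where the table
    \<open>star0_tan\<close> merely reads off components.\<close>
  have 1: "star0 e0 (W (tan_ax i)) (tan_ax j) (tan_ax k) = star0 e0 (tan_ax j) (tan_ax k) (W (tan_ax i))"
    "star0 e0 (tan_ax i) (W (tan_ax j)) (tan_ax k) = - star0 e0 (tan_ax i) (tan_ax k) (W (tan_ax j))" for i j k
    using star0_alternating by metis+
  show ?thesis
    unfolding distrib_right sum.distrib tan_contraction_star_phi 1 mult_minus_left sum_negf
    unfolding tan_contraction_phi0 skew_map_tan_ax[OF assms]
    by (simp add: star0_tan skew_map_tan_ax[OF assms] rho0_nth[OF assms] skew_map_swap[OF assms])
qed

section \<open>Transitivity of G2 on the unit sphere\<close>

definition g2_map :: "(real ^ 7 \<Rightarrow> real ^ 7) \<Rightarrow> bool" where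
  "g2_map T \<longleftrightarrow> linear T \<and> (\<forall>x y. T x \<bullet> T y = x \<bullet> y) \<and>
     (\<forall>x y z. phi0 (T x) (T y) (T z) = phi0 x y z)"

lemma g2_map_compose: "g2_map S \<Longrightarrow> g2_map T \<Longrightarrow> g2_map (S \<circ> T)"
  by (simp add: g2_map_def linear_compose)

definition rotation :: "7 \<Rightarrow> 7 \<Rightarrow> 7 \<Rightarrow> 7 \<Rightarrow> real \<Rightarrow> real \<Rightarrow> real ^ 7 \<Rightarrow> real ^ 7" where
  "rotation a b k l c s x = (\<chi> i. if i = a then c * x $ a + s * x $ b else if i = b then c * x $ b - s * x $ a
     else if i = k then c * x $ k - s * x $ l else if i = l then c * x $ l + s * x $ k else x $ i)"

text \<open>The admissible index tuples: \<open>(a, b)\<close> and \<open>(k, l)\<close> are two complex lines for the complex structure defined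
  by the cross product with a fixed basis vector, and opposite rotations in them have complex determinant 1.\<close>

lemma g2_map_rotation:
  assumes cs: "c * c + s * s = 1"
    and q: "(a, b, k, l) \<in> {(1, 3, 4, 5), (4, 5, 2, 6), (1, 4, 5, 3), (2, 6, 4, 5), (1, 2, 6, 3), (0, 1, 4, 6)}"
  shows "g2_map (rotation a b k l c s)"
proof -
  \<comment> \<open>Used as rewrite rules, these eliminate squares of \<open>c\<close>, so that the
    polynomial identities modulo the circle relation hold by normalisation.\<close>
  have c: "c * c = 1 - s * s" "c * (c * z) = z - s * (s * z)" for z
    using cs by (auto simp: algebra_simps) (metis add_diff_cancel_right' distrib_right mult.assoc mult_1)
  let ?R = "rotation a b k l c s"
  have lin: "linear ?R"
    by (rule linearI) (simp_all add: rotation_def vec_eq_iff algebra_simps)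
  have "?R x \<bullet> ?R y = x \<bullet> y" for x y
    using q unfolding inner_vec_def sum_7 rotation_def
    by (elim insertE; simp add: algebra_simps c)
  moreover have "\<forall>i. cross0 (?R x) (?R y) $ i = ?R (cross0 x y) $ i" for x y
    using q unfolding forall_7
    by (elim insertE; simp add: rotation_def pl_def algebra_simps c)
  then have "cross0 (?R x) (?R y) = ?R (cross0 x y)" for x y
    by (simp add: vec_eq_iff)
  ultimately show ?thesis
    using lin by (simp add: g2_map_def inner_cross0[symmetric])
qed

lemma rotation_kill:
  fixes x y :: real
  obtains c s where "c * c + s * s = 1" "c * y - s * x = 0" "c * x + s * y \<ge> 0"
proof (cases "x = 0 \<and> y = 0")
  case True then show ?thesis using that[of 1 0] by simp
next
  case False
  let ?r = "sqrt (x * x + y * y)"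
  have p: "x * x + y * y > 0" using False by (simp add: sum_squares_gt_zero_iff)
  then have r: "?r > 0" "?r * ?r = x * x + y * y" by simp_all
  show ?thesis
  proof (rule that[of "x / ?r" "y / ?r"])
    show "x / ?r * (x / ?r) + y / ?r * (y / ?r) = 1"
      using r p False by (simp add: add_divide_distrib[symmetric])
    show "x / ?r * x + y / ?r * y \<ge> 0"
      using p r(1) by (simp add: add_divide_distrib[symmetric] less_imp_le)
  qed simp
qed

lemma g2_kill:
  assumes "(a, b, k, l) \<in> {(1, 3, 4, 5), (4, 5, 2, 6), (1, 4, 5, 3), (2, 6, 4, 5), (1, 2, 6, 3), (0, 1, 4, 6)}"
  shows "\<exists>T. g2_map T \<and> T x $ b = 0 \<and> T x $ a \<ge> 0 \<and> (\<forall>i. i \<notin> {a, b, k, l} \<longrightarrow> T x $ i = x $ i)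
    \<and> (x $ k = 0 \<longrightarrow> x $ l = 0 \<longrightarrow> T x $ k = 0 \<and> T x $ l = 0)"
proof -
  obtain c s where cs: "c * c + s * s = 1" "c * x $ b - s * x $ a = 0" "c * x $ a + s * x $ b \<ge> 0"
    by (rule rotation_kill)
  have "b \<noteq> a" using assms by auto
  then have "rotation a b k l c s x $ b = 0" "rotation a b k l c s x $ a \<ge> 0"
    using cs by (simp_all add: rotation_def)
  then show ?thesis
    using g2_map_rotation[OF cs(1) assms] assms by (intro exI[of _ "rotation a b k l c s"]) (auto simp: rotation_def)
qed

text \<open>The coordinates are annihilated in the order 3, 5, 4, 6, 2, 1. Earlier zeros survive
  because the first plane of each rotation contains none of them and the second plane contains
  either none or two. The last rotation also makes the surviving coordinate nonnegative, so that it
  is 1 and not -1.\<close>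

lemma g2_transitive:
  fixes x :: "real ^ 7"
  assumes "x \<bullet> x = 1"
  obtains T where "g2_map T" "T x = e0"
proof -
  obtain T1 where T1: "g2_map T1" "T1 x $ 3 = 0"
    using g2_kill[of 1 3 4 5 x] by auto
  define x1 where "x1 = T1 x"
  obtain T2 where T2: "g2_map T2" "T2 x1 $ 5 = 0" "T2 x1 $ 3 = 0"
    using g2_kill[of 4 5 2 6 x1] T1(2) by (auto simp: x1_def)
  define x2 where "x2 = T2 x1"
  obtain T3 where T3: "g2_map T3" "T3 x2 $ 4 = 0" "T3 x2 $ 3 = 0" "T3 x2 $ 5 = 0"
    using g2_kill[of 1 4 5 3 x2] T2(2,3) by (auto simp: x2_def)
  define x3 where "x3 = T3 x2"
  obtain T4 where T4: "g2_map T4" "T4 x3 $ 6 = 0" "T4 x3 $ 3 = 0" "T4 x3 $ 4 = 0" "T4 x3 $ 5 = 0"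
    using g2_kill[of 2 6 4 5 x3] T3(2-) by (auto simp: x3_def)
  define x4 where "x4 = T4 x3"
  obtain T5 where T5: "g2_map T5" "T5 x4 $ 2 = 0" "T5 x4 $ 3 = 0" "T5 x4 $ 4 = 0" "T5 x4 $ 5 = 0" "T5 x4 $ 6 = 0"
    using g2_kill[of 1 2 6 3 x4] T4(2-) by (auto simp: x4_def)
  define x5 where "x5 = T5 x4"
  obtain T6 where T6: "g2_map T6" "T6 x5 $ 0 \<ge> 0" "T6 x5 $ 1 = 0" "T6 x5 $ 2 = 0" "T6 x5 $ 3 = 0"
     "T6 x5 $ 4 = 0" "T6 x5 $ 5 = 0" "T6 x5 $ 6 = 0"
    using g2_kill[of 0 1 4 6 x5] T5(2-) by (auto simp: x5_def)
  let ?T = "T6 \<circ> (T5 \<circ> (T4 \<circ> (T3 \<circ> (T2 \<circ> T1))))"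
  have T: "g2_map ?T"
    using T1(1) T2(1) T3(1) T4(1) T5(1) T6(1) by (intro g2_map_compose)
  have eq: "?T x = T6 x5" by (simp add: x5_def x4_def x3_def x2_def x1_def)
  have "?T x \<bullet> ?T x = 1" using T assms by (simp add: g2_map_def)
  then have "T6 x5 $ 0 * T6 x5 $ 0 = 1"
    unfolding eq using T6 by (simp add: inner_vec_def sum_7)
  then have "T6 x5 $ 0 = 1" using T6(2) by (metis abs_of_nonneg abs_square_eq_1 power2_eq_square)
  then have "?T x = e0"
    unfolding eq vec_eq_iff forall_7 using T6 by (simp add: axis_1_nth)
  with T that show ?thesis by blast
qed

section \<open>Orthonormal bases and metric connections\<close>

definition metric_form :: "('n::finite) form2 \<Rightarrow> bool" where
  "metric_form b \<longleftrightarrow> bilinear b \<and> (\<forall>x y. b x y = b y x) \<and> (\<forall>x. x \<noteq> 0 \<longrightarrow> b x x > 0)"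

lemma metric_formD:
  assumes "metric_form b"
  shows "bilinear b" "b x y = b y x" "x \<noteq> 0 \<Longrightarrow> b x x > 0"
  using assms by (auto simp: metric_form_def)

lemma metric_form_eqI:
  assumes "metric_form b" "\<And>z. b x z = b y z"
  shows "x = y"
proof -
  have "b (x - y) (x - y) = 0"
    using assms(2) by (simp add: bilinear_lsub[OF metric_formD(1)[OF assms(1)]])
  then show ?thesis using metric_formD(3)[OF assms(1), of "x - y"] by fastforce
qed

definition frame_coords :: "'n::finite form2 \<Rightarrow> ('n \<Rightarrow> real ^ 'n) \<Rightarrow> real ^ 'n \<Rightarrow> real ^ 'n" where
  "frame_coords b e x = (\<chi> i. b (e i) x)"

lemma linear_frame_coords: "bilinear b \<Longrightarrow> linear (frame_coords b e)"
  by (rule linearI) (simp_all add: frame_coords_def vec_eq_iff bilinear_radd bilinear_rmul)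

lemma onb_expand:
  assumes b: "bilinear b" and e: "orthonormal_basis b e"
  shows "x = (\<Sum>i\<in>UNIV. b (e i) x *\<^sub>R e i)"
proof -
  let ?S = "\<lambda>y. \<Sum>i\<in>UNIV. y $ i *\<^sub>R e i"
  have S: "linear ?S" by (rule linearI) (simp_all add: scaleR_left_distrib sum.distrib scaleR_sum_right)
  have r: "b u (\<Sum>i\<in>UNIV. f i *\<^sub>R e i) = (\<Sum>i\<in>UNIV. f i * b u (e i))" for u f
    using b by (simp add: bilinear_def linear_sum linear_cmul)
  have ee: "b (e i) (e j) = (if i = j then 1 else 0)" for i j
    using e by (simp add: orthonormal_basis_def)
  have "frame_coords b e \<circ> ?S = id"
    by (simp add: fun_eq_iff vec_eq_iff frame_coords_def r ee if_distrib cong: if_cong)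
  then have "?S \<circ> frame_coords b e = id"
    using linear_inverse_left[OF linear_frame_coords[OF b] S] by blast
  then show ?thesis by (simp add: fun_eq_iff frame_coords_def)
qed

lemma frame_coords_isometry:
  assumes b: "bilinear b" and e: "orthonormal_basis b e"
  shows "frame_coords b e x \<bullet> frame_coords b e y = b x y"
proof -
  have "b x y = b (\<Sum>i\<in>UNIV. b (e i) x *\<^sub>R e i) y"
    using onb_expand[OF b e, of x] by simp
  also have "\<dots> = (\<Sum>i\<in>UNIV. b (e i) x * b (e i) y)"
    using b by (simp add: bilinear_def linear_sum[of "\<lambda>x. b x y"] linear_cmul[of "\<lambda>x. b x y"])
  finally show ?thesis by (simp add: frame_coords_def inner_vec_def)
qed

text \<open>The change of basis matrix is orthogonal. As traces and inner products are defined
  through \<open>some_onb\<close>, this is what permits computing them in a frame adapted to the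
  G2-structure.\<close>

lemma onb_trace_eq:
  fixes T :: "'n::finite form2"
  assumes g: "metric_form b" and e: "orthonormal_basis b e" and e': "orthonormal_basis b e'" and T: "bilinear T"
  shows "(\<Sum>i\<in>UNIV. T (e i) (e i)) = (\<Sum>i\<in>UNIV. T (e' i) (e' i))"
proof -
  note b = metric_formD(1)[OF g]
  have l: "T (\<Sum>i\<in>UNIV. f i *\<^sub>R e i) v = (\<Sum>i\<in>UNIV. f i * T (e i) v)" for f v
    using T by (simp add: bilinear_def linear_sum[of "\<lambda>x. T x v"] linear_cmul[of "\<lambda>x. T x v"])
  have r: "T v (\<Sum>i\<in>UNIV. f i *\<^sub>R e i) = (\<Sum>i\<in>UNIV. f i * T v (e i))" for f v
    using T by (simp add: bilinear_def linear_sum linear_cmul)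
  have "T (e' i) (e' i) = (\<Sum>j\<in>UNIV. \<Sum>k\<in>UNIV. b (e' i) (e j) * b (e' i) (e k) * T (e j) (e k))" for i
  proof -
    have "T (e' i) (e' i) = T (\<Sum>j\<in>UNIV. b (e j) (e' i) *\<^sub>R e j) (\<Sum>k\<in>UNIV. b (e k) (e' i) *\<^sub>R e k)"
      using onb_expand[OF b e, of "e' i"] by simp
    also have "\<dots> = (\<Sum>j\<in>UNIV. \<Sum>k\<in>UNIV. b (e' i) (e j) * b (e' i) (e k) * T (e j) (e k))"
      by (subst l, subst r) (simp add: sum_distrib_left mult.assoc metric_formD(2)[OF g, of _ "e' i"])
    finally show ?thesis .
  qed
  then have "(\<Sum>i\<in>UNIV. T (e' i) (e' i)) = (\<Sum>i\<in>UNIV. \<Sum>j\<in>UNIV. \<Sum>k\<in>UNIV. b (e' i) (e j) * b (e' i) (e k) * T (e j) (e k))"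
    by simp
  also have "\<dots> = (\<Sum>j\<in>UNIV. \<Sum>k\<in>UNIV. \<Sum>i\<in>UNIV. b (e' i) (e j) * b (e' i) (e k) * T (e j) (e k))"
    by (subst sum.swap) (intro sum.cong refl sum.swap)
  also have "\<dots> = (\<Sum>j\<in>UNIV. \<Sum>k\<in>UNIV. b (e j) (e k) * T (e j) (e k))"
    using frame_coords_isometry[OF b e']
    by (simp add: sum_distrib_right[symmetric] frame_coords_def inner_vec_def)
  also have "\<dots> = (\<Sum>j\<in>UNIV. \<Sum>k\<in>UNIV. if j = k then T (e j) (e k) else 0)"
    using e by (intro sum.cong refl) (auto simp: orthonormal_basis_def)
  also have "\<dots> = (\<Sum>j\<in>UNIV. T (e j) (e j))" by simp
  finally show ?thesis by simp
qed

lemma some_onb: "orthonormal_basis b e \<Longrightarrow> orthonormal_basis b (some_onb b)"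
  unfolding some_onb_def by (rule someI[of "orthonormal_basis b"])

lemma trace_form_onb:
  assumes "metric_form b" "orthonormal_basis b e" "bilinear T"
  shows "trace_form b T = (\<Sum>i\<in>UNIV. T (e i) (e i))"
  unfolding trace_form_def using onb_trace_eq[OF assms(1) some_onb[OF assms(2)] assms(2,3)] .

lemma bilinear_product: "linear f \<Longrightarrow> linear g \<Longrightarrow> bilinear (\<lambda>x y. f x * g y :: real)"
  unfolding bilinear_def by (auto intro!: linearI simp: linear_add linear_cmul algebra_simps)

lemma inner_form2_onb:
  assumes g: "metric_form b" and e: "orthonormal_basis b e" and "bilinear \<alpha>" "bilinear \<beta>"
  shows "inner_form2 b \<alpha> \<beta> = (\<Sum>i\<in>UNIV. \<Sum>j\<in>UNIV. \<alpha> (e i) (e j) * \<beta> (e i) (e j)) / 2"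
proof -
  let ?e = "some_onb b"
  note tr = onb_trace_eq[OF g some_onb[OF e] e]
  have lin: "linear (\<alpha> x)" "linear (\<beta> x)" "linear (\<lambda>x. \<alpha> x y)" "linear (\<lambda>x. \<beta> x y)" for x y
    using assms(3,4) by (auto simp: bilinear_def)
  have "(\<Sum>i\<in>UNIV. \<Sum>j\<in>UNIV. \<alpha> (?e i) (?e j) * \<beta> (?e i) (?e j)) = (\<Sum>i\<in>UNIV. \<Sum>j\<in>UNIV. \<alpha> (?e i) (e j) * \<beta> (?e i) (e j))"
    by (intro sum.cong refl tr bilinear_product lin)
  also have "\<dots> = (\<Sum>j\<in>UNIV. \<Sum>i\<in>UNIV. \<alpha> (?e i) (e j) * \<beta> (?e i) (e j))"
    by (rule sum.swap)
  also have "\<dots> = (\<Sum>j\<in>UNIV. \<Sum>i\<in>UNIV. \<alpha> (e i) (e j) * \<beta> (e i) (e j))"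
    by (intro sum.cong refl tr[of "\<lambda>x y. \<alpha> x (e _) * \<beta> y (e _)"] bilinear_product lin)
  also have "\<dots> = (\<Sum>i\<in>UNIV. \<Sum>j\<in>UNIV. \<alpha> (e i) (e j) * \<beta> (e i) (e j))"
    by (rule sum.swap)
  finally show ?thesis by (simp add: inner_form2_def Let_def)
qed

text \<open>The basis is exchanged slot by slot: with the other arguments fixed, the sum over one
  slot is a trace. Two slots are covered by the case of two-forms.\<close>

lemma inner_form3_onb:
  assumes g: "metric_form b" and e: "orthonormal_basis b e" and "trilinear \<alpha>" "trilinear \<beta>"
  shows "inner_form3 b \<alpha> \<beta> = (\<Sum>i\<in>UNIV. \<Sum>j\<in>UNIV. \<Sum>k\<in>UNIV. \<alpha> (e i) (e j) (e k) * \<beta> (e i) (e j) (e k)) / 6"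
proof -
  let ?e = "some_onb b"
  note tr = onb_trace_eq[OF g some_onb[OF e] e]
  have lin: "linear (\<lambda>z. \<alpha> x y z)" "linear (\<lambda>y. \<alpha> x y z)" "linear (\<lambda>x. \<alpha> x y z)"
     "linear (\<lambda>z. \<beta> x y z)" "linear (\<lambda>y. \<beta> x y z)" "linear (\<lambda>x. \<beta> x y z)" for x y z
    using assms(3,4) by (auto simp: trilinear_def)
  have bil: "bilinear (\<alpha> x)" "bilinear (\<beta> x)" for x using lin by (auto simp: bilinear_def)
  have 2: "(\<Sum>j\<in>UNIV. \<Sum>k\<in>UNIV. \<alpha> x (?e j) (?e k) * \<beta> x (?e j) (?e k)) = (\<Sum>j\<in>UNIV. \<Sum>k\<in>UNIV. \<alpha> x (e j) (e k) * \<beta> x (e j) (e k))" for x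
    using inner_form2_onb[OF g e bil(1)[of x] bil(2)[of x]] inner_form2_onb[OF g some_onb[OF e] bil(1)[of x] bil(2)[of x]] by simp
  have "(\<Sum>i\<in>UNIV. \<Sum>j\<in>UNIV. \<Sum>k\<in>UNIV. \<alpha> (?e i) (e j) (e k) * \<beta> (?e i) (e j) (e k))
     = (\<Sum>j\<in>UNIV. \<Sum>k\<in>UNIV. \<Sum>i\<in>UNIV. \<alpha> (?e i) (e j) (e k) * \<beta> (?e i) (e j) (e k))"
    by (subst sum.swap) (intro sum.cong refl sum.swap)
  also have "\<dots> = (\<Sum>j\<in>UNIV. \<Sum>k\<in>UNIV. \<Sum>i\<in>UNIV. \<alpha> (e i) (e j) (e k) * \<beta> (e i) (e j) (e k))"
    by (intro sum.cong refl tr[of "\<lambda>x y. \<alpha> x (e _) (e _) * \<beta> y (e _) (e _)"] bilinear_product lin)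
  also have "\<dots> = (\<Sum>i\<in>UNIV. \<Sum>j\<in>UNIV. \<Sum>k\<in>UNIV. \<alpha> (e i) (e j) (e k) * \<beta> (e i) (e j) (e k))"
    by (subst (2) sum.swap) (intro sum.cong refl sum.swap)
  finally show ?thesis by (simp add: inner_form3_def Let_def 2)
qed

section \<open>Metric connections and the Koszul formula\<close>

definition connection_form :: "'n::finite form2 \<Rightarrow> 'n form3 \<Rightarrow> (real ^ 'n \<Rightarrow> real ^ 'n \<Rightarrow> real ^ 'n) \<Rightarrow> bool" where
  "connection_form b D \<Gamma> \<longleftrightarrow> bilinear \<Gamma> \<and> (\<forall>x y. \<Gamma> x y = \<Gamma> y x) \<and>
     (\<forall>x y z. D x y z = b (\<Gamma> x y) z + b y (\<Gamma> x z))"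

lemma koszul:
  assumes g: "metric_form b" and "connection_form b D \<Gamma>"
  shows "b (\<Gamma> x y) z = (D x y z + D y x z - D z x y) / 2"
proof -
  have \<Gamma>: "\<Gamma> x y = \<Gamma> y x" "D x y z = b (\<Gamma> x y) z + b y (\<Gamma> x z)" for x y z
    using assms(2) unfolding connection_form_def by blast+
  show ?thesis
    unfolding \<Gamma>(2) using \<Gamma>(1)[of y x] \<Gamma>(1)[of z x] \<Gamma>(1)[of z y] metric_formD(2)[OF g] by simp
qed

lemma connection_form_unique:
  assumes "metric_form b" "connection_form b D \<Gamma>" "connection_form b D \<Gamma>'"
  shows "\<Gamma> = \<Gamma>'"
  by (intro ext metric_form_eqI[OF assms(1)]) (simp add: koszul[OF assms(1,2)] koszul[OF assms(1,3)])

text \<open>The Koszul formula, read as a definition of the connection; \<open>D\<close> stands for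
  the derivative of the metric. Uniqueness alone would leave the \<open>THE\<close> in
  \<open>levi_civita\<close> unspecified.\<close>

lemma connection_form_exists:
  assumes g: "metric_form b" and e: "orthonormal_basis b e" and D: "trilinear D" "\<And>x y z. D x y z = D x z y"
  shows "\<exists>\<Gamma>. connection_form b D \<Gamma>"
proof -
  note b = metric_formD(1)[OF g]
  define K where "K x y z = (D x y z + D y x z - D z x y) / 2" for x y z
  define \<Gamma> where "\<Gamma> x y = (\<Sum>i\<in>UNIV. K x y (e i) *\<^sub>R e i)" for x y
  have lin: "linear (\<lambda>x. D x y z)" "linear (\<lambda>y. D x y z)" "linear (\<lambda>z. D x y z)" for x y z
    using D(1) by (auto simp: trilinear_def)
  have K: "linear (\<lambda>x. K x y z)" "linear (\<lambda>y. K x y z)" "linear (K x y)" for x y z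
    unfolding K_def by (rule linearI; simp add: linear_add[OF lin(1)] linear_add[OF lin(2)] linear_add[OF lin(3)]
      linear_cmul[OF lin(1)] linear_cmul[OF lin(2)] linear_cmul[OF lin(3)] algebra_simps add_divide_distrib diff_divide_distrib)+
  have bG: "b (\<Gamma> x y) z = K x y z" for x y z
  proof -
    have "b (\<Gamma> x y) z = (\<Sum>i\<in>UNIV. K x y (e i) * b (e i) z)"
      unfolding \<Gamma>_def using b by (simp add: bilinear_def linear_sum[of "\<lambda>x. b x z"] linear_cmul[of "\<lambda>x. b x z"])
    also have "\<dots> = K x y (\<Sum>i\<in>UNIV. b (e i) z *\<^sub>R e i)"
      using K(3)[of x y] by (simp add: linear_sum linear_cmul mult.commute)
    also have "\<dots> = K x y z" using onb_expand[OF b e, of z] by simp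
    finally show ?thesis .
  qed
  have "bilinear \<Gamma>"
    unfolding bilinear_def \<Gamma>_def
    by (intro conjI allI linearI)
      (simp_all add: linear_add[OF K(1)] linear_add[OF K(2)] linear_cmul[OF K(1)] linear_cmul[OF K(2)]
        scaleR_left_distrib sum.distrib scaleR_sum_right)
  moreover have "\<Gamma> x y = \<Gamma> y x" for x y
    unfolding \<Gamma>_def K_def by (simp add: add.commute D(2)[of _ x y])
  moreover have "D x y z = b (\<Gamma> x y) z + b y (\<Gamma> x z)" for x y z
    using D(2) by (simp add: metric_formD(2)[OF g, of y "\<Gamma> _ _"] bG K_def field_simps)
  ultimately show ?thesis unfolding connection_form_def by blast
qed

lemma levi_civita_eq:
  assumes "metric_form (metric N c p)"
    and "connection_form (metric N c p) (\<lambda>x y z. dir_deriv c (\<lambda>q. metric N c q y z) p x) \<Gamma>"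
  shows "levi_civita N c p = \<Gamma>"
  unfolding levi_civita_def
proof (rule the_equality)
  show "bilinear \<Gamma> \<and> (\<forall>x y. \<Gamma> x y = \<Gamma> y x) \<and>
     (\<forall>x y z. dir_deriv c (\<lambda>q. metric N c q y z) p x = metric N c p (\<Gamma> x y) z + metric N c p y (\<Gamma> x z))"
    using assms(2) by (simp add: connection_form_def)
next
  fix \<Gamma>' assume "bilinear \<Gamma>' \<and> (\<forall>x y. \<Gamma>' x y = \<Gamma>' y x) \<and>
     (\<forall>x y z. dir_deriv c (\<lambda>q. metric N c q y z) p x = metric N c p (\<Gamma>' x y) z + metric N c p y (\<Gamma>' x z))"
  then have "connection_form (metric N c p) (\<lambda>x y z. dir_deriv c (\<lambda>q. metric N c q y z) p x) \<Gamma>'"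
    unfolding connection_form_def .
  then show "\<Gamma>' = \<Gamma>" by (rule connection_form_unique[OF assms(1) _ assms(2)])
qed

section \<open>Intrinsic torsion of \<open>SU(3)\<close>-structures\<close>

text \<open>\<open>\<psi>\<close> is the real part of a complex volume form: \<open>psi_cyclic\<close> is the derivative of the determinant, and
  \<open>psi_surj\<close> says that all real two-forms of type \<open>(2,0) + (0,2)\<close> are contractions of \<open>\<psi>\<close>.\<close>

locale su3_algebra =
  fixes g :: "6 form2" and I :: "real ^ 6 \<Rightarrow> real ^ 6" and \<psi> :: "6 form3" and e :: "6 \<Rightarrow> real ^ 6"
  assumes g: "metric_form g" and onb: "orthonormal_basis g e"
    and linear_I: "linear I" and II: "I (I x) = - x" and g_II: "g (I x) (I y) = g x y"
    and trilinear_psi: "trilinear \<psi>" and psi_swap: "\<psi> y x z = - \<psi> x y z" "\<psi> x z y = - \<psi> x y z"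
    and psi_I: "\<psi> (I x) y z = \<psi> x (I y) z"
    and psi_inner: "inner_form2 g (\<psi> x) (\<psi> y) = 2 * g x y"
    and psi_cyclic: "linear L \<Longrightarrow> (\<And>x. L (I x) = I (L x)) \<Longrightarrow>
      \<psi> (L x) y z + \<psi> x (L y) z + \<psi> x y (L z) =
      (\<Sum>i\<in>UNIV. g (L (e i)) (e i)) / 2 * \<psi> x y z - (\<Sum>i\<in>UNIV. g (L (I (e i))) (e i)) / 2 * \<psi> (I x) y z"
    and psi_surj: "bilinear \<beta> \<Longrightarrow> (\<And>y z. \<beta> z y = - \<beta> y z) \<Longrightarrow> (\<And>y z. \<beta> (I y) (I z) = - \<beta> y z) \<Longrightarrow> \<exists>u. \<beta> = \<psi> u"
begin

lemma bil_g: "bilinear g" and g_sym: "g x y = g y x"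
  using g by (auto simp: metric_form_def)

lemmas g_simps = bilinear_ladd[OF bil_g] bilinear_radd[OF bil_g] bilinear_lmul[OF bil_g] bilinear_rmul[OF bil_g]
  bilinear_lsub[OF bil_g] bilinear_rsub[OF bil_g] bilinear_lneg[OF bil_g] bilinear_rneg[OF bil_g]

lemma lin_psi: "linear (\<lambda>x. \<psi> x y z)" "linear (\<lambda>y. \<psi> x y z)" "linear (\<psi> x y)"
  using trilinear_psi by (auto simp: trilinear_def)

lemmas psi_simps = linear_add[OF lin_psi(1)] linear_cmul[OF lin_psi(1)] linear_neg[OF lin_psi(1)] linear_diff[OF lin_psi(1)]
  linear_add[OF lin_psi(2)] linear_cmul[OF lin_psi(2)] linear_neg[OF lin_psi(2)] linear_diff[OF lin_psi(2)]
  linear_add[OF lin_psi(3)] linear_cmul[OF lin_psi(3)] linear_neg[OF lin_psi(3)] linear_diff[OF lin_psi(3)]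

lemmas I_simps = linear_add[OF linear_I] linear_cmul[OF linear_I] linear_neg[OF linear_I] linear_diff[OF linear_I]

lemma psi_rotate: "\<psi> x y z = \<psi> y z x" "\<psi> x y z = \<psi> z x y"
  using psi_swap(2)[of y x z] psi_swap(1)[of x y z] psi_swap(1)[of x z y] psi_swap(2)[of x y z] by simp_all

lemma psi_II: "\<psi> x (I y) (I z) = - \<psi> x y z"
proof -
  have "\<psi> x (I y) (I z) = \<psi> (I x) y (I z)" by (simp add: psi_I)
  also have "\<dots> = - \<psi> (I (I x)) z y" using psi_swap(2)[of "I x" "I z" y] by (simp add: psi_I[of "I x"])
  also have "\<dots> = - \<psi> x y z" using psi_swap(2)[of x z y] by (simp add: II psi_simps)
  finally show ?thesis .
qed

lemma psi_I2: "\<psi> x (I y) z = \<psi> x y (I z)"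
  using psi_II[of x y "I z"] by (simp add: II psi_simps)

lemma g_I: "g (I x) y = - g x (I y)"
  using g_II[of x "I y"] by (simp add: II g_simps)

lemma g_I_self: "g (I x) x = 0"
  using g_I[of x x] g_sym[of x "I x"] by simp

lemma psi_eqD: "(\<And>y z. \<psi> u y z = \<psi> v y z) \<Longrightarrow> u = v"
proof -
  assume "\<And>y z. \<psi> u y z = \<psi> v y z"
  then have "\<psi> u = \<psi> v" by blast
  then have "g u w = g v w" for w using psi_inner[of u w] psi_inner[of v w] by simp
  then show "u = v" by (rule metric_form_eqI[OF g])
qed

text \<open>Every Gray-Hervella tensor is \<open>tors L\<close> for a unique endomorphism \<open>L\<close>, and its image under \<open>r_map\<close> is the
  bilinear form of \<open>L\<close>.\<close>

definition tors :: "(real ^ 6 \<Rightarrow> real ^ 6) \<Rightarrow> 6 form3" where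
  "tors L = (\<lambda>x. \<psi> (L x))"

lemma r_map_tors: "r_map g \<psi> (tors L) x y = g (L x) y"
  by (simp add: r_map_def tors_def psi_inner)

lemma tors_eqD: "tors L = tors K \<Longrightarrow> L = K"
  unfolding tors_def fun_eq_iff using psi_eqD by blast

lemma tors_gh: "linear L \<Longrightarrow> tors L \<in> gh_space I"
  unfolding gh_space_def tors_def trilinear_def mem_Collect_eq
  by (intro conjI allI psi_swap(2) linear_compose[OF _ lin_psi(1), unfolded o_def] lin_psi) (simp_all add: psi_II)

text \<open>\<open>psi_surj\<close> yields \<open>L x\<close> separately for each \<open>x\<close>;
  linearity follows because the contraction with \<open>\<psi>\<close> is injective.\<close>

lemma gh_tors:
  assumes "\<alpha> \<in> gh_space I"
  obtains L where "linear L" "\<alpha> = tors L"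
proof -
  have tri: "trilinear \<alpha>" and a: "\<And>x y z. \<alpha> x y z = - \<alpha> x z y" "\<And>x y z. \<alpha> x y z = - \<alpha> x (I y) (I z)"
    using assms unfolding gh_space_def by blast+
  have "\<exists>u. \<alpha> x = \<psi> u" for x
  proof (rule psi_surj)
    show "bilinear (\<alpha> x)" using tri by (simp add: trilinear_def bilinear_def)
    show "\<alpha> x z y = - \<alpha> x y z" for y z by (rule a(1))
    show "\<alpha> x (I y) (I z) = - \<alpha> x y z" for y z using a(2)[of x y z] by simp
  qed
  then obtain L where L: "\<And>x. \<alpha> x = \<psi> (L x)" by metis
  have la: "linear (\<lambda>x. \<alpha> x y z)" for y z using tri by (simp add: trilinear_def)
  have "linear L"
  proof (rule linearI)
    show "L (x + y) = L x + L y" for x y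
      by (rule psi_eqD) (use linear_add[OF la] in \<open>simp add: psi_simps L[symmetric]\<close>)
    show "L (c *\<^sub>R x) = c *\<^sub>R L x" for c x
      by (rule psi_eqD) (use linear_cmul[OF la] in \<open>simp add: psi_simps L[symmetric]\<close>)
  qed
  then show ?thesis using that L by (auto simp: tors_def fun_eq_iff)
qed

section \<open>Endomorphisms belonging to W1, W2 and W3\<close>

abbreviation "tr H \<equiv> \<Sum>i\<in>UNIV. H (e i) (e i)"

lemma nontrivial: obtains x :: "real ^ 6" where "g x x \<noteq> 0"
proof -
  have "g (e 0) (e 0) = 1" using onb unfolding orthonormal_basis_def by simp
  then show ?thesis using that[of "e 0"] by simp
qed

text \<open>Total skewness lets \<open>I\<close> and \<open>L\<close> be moved between the slots.
  Hence \<open>L\<close> is complex linear and the three terms of \<open>psi_cyclic\<close>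
  coincide, so \<open>L\<close> acts as one third of its complex trace; the halves there turn the
  third into 1/6 of the real traces.\<close>

lemma tors_W1D:
  assumes L: "linear L" and "tors L \<in> gh_W1 I"
  obtains s t where "\<And>x. L x = s *\<^sub>R x + t *\<^sub>R I x"
proof -
  have a: "\<psi> (L x) y z = - \<psi> (L y) x z" "\<psi> (L x) y z = - \<psi> (L x) z y" for x y z
    using assms(2) unfolding gh_W1_def tors_def by blast+
  have LI: "L (I x) = I (L x)" for x
  proof (rule psi_eqD)
    fix y z
    have "\<psi> (L (I x)) y z = - \<psi> (L y) (I x) z" by (rule a)
    also have "\<dots> = \<psi> (L x) y (I z)" using a(1)[of x y "I z"] by (simp add: psi_I2)
    finally show "\<psi> (L (I x)) y z = \<psi> (I (L x)) y z" by (simp add: psi_I psi_I2)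
  qed
  define s t where "s = (\<Sum>i\<in>UNIV. g (L (e i)) (e i)) / 6" and "t = - (\<Sum>i\<in>UNIV. g (L (I (e i))) (e i)) / 6"
  have "L x = s *\<^sub>R x + t *\<^sub>R I x" for x
  proof (rule psi_eqD)
    fix y z
    have "\<psi> x (L y) z = \<psi> (L x) y z" using a(1)[of x y z] psi_swap(1)[of x "L y" z] by simp
    moreover have "\<psi> x y (L z) = \<psi> (L x) y z"
      using a(1)[of x z y] a(2)[of x y z] psi_swap(1)[of x "L z" y] psi_swap(2)[of x y "L z"] by simp
    ultimately have "3 * \<psi> (L x) y z = 3 * (s * \<psi> x y z + t * \<psi> (I x) y z)"
      using psi_cyclic[OF L LI, of x y z] by (simp add: s_def t_def field_simps)
    then show "\<psi> (L x) y z = \<psi> (s *\<^sub>R x + t *\<^sub>R I x) y z" by (simp add: psi_simps)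
  qed
  then show ?thesis using that by blast
qed

lemma tors_W1I: "tors (\<lambda>x. s *\<^sub>R x + t *\<^sub>R I x) \<in> gh_W1 I"
proof -
  have "linear (\<lambda>x. s *\<^sub>R x + t *\<^sub>R I x)"
    by (rule linearI) (simp_all add: I_simps algebra_simps)
  then have "tors (\<lambda>x. s *\<^sub>R x + t *\<^sub>R I x) \<in> gh_space I" by (rule tors_gh)
  moreover have "\<psi> (s *\<^sub>R x + t *\<^sub>R I x) y z = - \<psi> (s *\<^sub>R y + t *\<^sub>R I y) x z" for x y z
    using psi_swap(1)[of x "I y" z] psi_swap(1)[of x y z] by (simp add: psi_simps psi_I)
  ultimately show ?thesis
    unfolding gh_W1_def mem_Collect_eq tors_def using psi_swap(2) by blast
qed

lemma tors_W2D:
  assumes L: "linear L" and "tors L \<in> gh_W2 I"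
  shows "L (I x) = I (L x)" "(\<Sum>i\<in>UNIV. g (L (e i)) (e i)) = 0" "(\<Sum>i\<in>UNIV. g (L (I (e i))) (e i)) = 0"
proof -
  have c0: "\<psi> (L x) y z + \<psi> (L y) z x + \<psi> (L z) x y = 0" for x y z
    using assms(2) unfolding gh_W2_def tors_def by blast
  note rot = psi_rotate
  have c: "\<psi> (L x) y z + \<psi> x (L y) z + \<psi> x y (L z) = 0" for x y z
    using c0[of x y z] rot(1)[of x "L y" z] rot(2)[of x y "L z"] by simp
  \<comment> \<open>Twice the antilinear part of \<open>L\<close>. The cyclic identity lets it pass
    from one slot to the next at the cost of a sign, so after a full round of three slots it equals
    its own negative.\<close>
  define K where "K x = L x + I (L (I x))" for x
  have K1: "\<psi> (K x) y z = - \<psi> x (K y) z" for x y z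
  proof -
    have "\<psi> (L (I x)) (I y) z + \<psi> (I x) (L (I y)) z + \<psi> (I x) (I y) (L z) = 0" by (rule c)
    moreover have "\<psi> (I x) (I y) (L z) = - \<psi> x y (L z)" by (simp add: psi_I II psi_simps)
    moreover have "\<psi> (L (I x)) (I y) z = \<psi> (I (L (I x))) y z" by (simp add: psi_I)
    moreover have "\<psi> (I x) (L (I y)) z = \<psi> x (I (L (I y))) z" by (simp add: psi_I)
    ultimately show ?thesis using c[of x y z] by (simp add: K_def psi_simps)
  qed
  have "\<psi> (K x) y z = \<psi> 0 y z" for x y z
  proof -
    have "\<psi> x (K y) z = - \<psi> x y (K z)"
      using K1[of y z x] rot(1)[of x "K y" z] rot(1)[of x y "K z"] by simp
    moreover have "\<psi> x y (K z) = - \<psi> (K x) y z"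
      using K1[of z x y] rot(2)[of x y "K z"] rot(2)[of "K x" y z] by simp
    ultimately show ?thesis using K1[of x y z] by (simp add: linear_0[OF lin_psi(1)])
  qed
  then have K0: "K x = 0" for x by (intro psi_eqD) blast
  show LI: "L (I x) = I (L x)" for x
    using arg_cong[OF K0[of x], of I] by (simp add: K_def I_simps II linear_0[OF linear_I])
  define s t where "s = (\<Sum>i\<in>UNIV. g (L (e i)) (e i)) / 2" and "t = (\<Sum>i\<in>UNIV. g (L (I (e i))) (e i)) / 2"
  have st: "s *\<^sub>R x - t *\<^sub>R I x = 0" for x
  proof (rule psi_eqD)
    show "\<psi> (s *\<^sub>R x - t *\<^sub>R I x) y z = \<psi> 0 y z" for y z
      using psi_cyclic[OF L LI, of x y z] c[of x y z] by (simp add: psi_simps s_def t_def linear_0[OF lin_psi(1)])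
  qed
  obtain x where x: "g x x \<noteq> 0" by (rule nontrivial)
  \<comment> \<open>As \<open>x\<close> and \<open>I x\<close> are orthogonal, pairing with each of
    them isolates one coefficient.\<close>
  have "s * g x x = 0" "t * g x x = 0"
    using arg_cong[OF st[of x], of "\<lambda>v. g v x"] arg_cong[OF st[of x], of "\<lambda>v. g v (I x)"] g_II[of x x] g_I_self[of x] g_sym[of x "I x"]
    by (simp_all add: g_simps bilinear_lzero[OF bil_g])
  then show "(\<Sum>i\<in>UNIV. g (L (e i)) (e i)) = 0" "(\<Sum>i\<in>UNIV. g (L (I (e i))) (e i)) = 0"
    using x by (simp_all add: s_def t_def)
qed

lemma tors_W2I:
  assumes L: "linear L" and LI: "\<And>x. L (I x) = I (L x)" and "(\<Sum>i\<in>UNIV. g (L (e i)) (e i)) = 0" "(\<Sum>i\<in>UNIV. g (L (I (e i))) (e i)) = 0"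
  shows "tors L \<in> gh_W2 I"
proof -
  note rot = psi_rotate
  have "\<psi> (L x) y z + \<psi> (L y) z x + \<psi> (L z) x y = 0" for x y z
    using psi_cyclic[OF L LI, of x y z] assms(3,4) rot(1)[of x "L y" z] rot(2)[of x y "L z"] by simp
  then show ?thesis unfolding gh_W2_def using tors_gh[OF L] by (simp add: tors_def)
qed

lemma tors_W3D:
  assumes "tors L \<in> gh_W3 g I"
  shows "L (I x) = - I (L x)"
proof -
  have a: "\<psi> (L (I x)) (I y) z = \<psi> (L x) y z" for x y z
    using assms unfolding gh_W3_def tors_def by blast
  have "I (L (I x)) = L x"
    by (rule psi_eqD) (simp add: psi_I a)
  from arg_cong[OF this, of I] show ?thesis by (simp add: II minus_equation_iff)
qed

text \<open>The trace vanishes because it contracts the symmetric form of \<open>L\<close> with two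
  skew slots of \<open>\<psi>\<close>; complex antilinearity gives the other condition.\<close>

lemma tors_W3I:
  assumes L: "linear L" and LI: "\<And>x. L (I x) = - I (L x)" and sym: "\<And>x y. g (L x) y = g x (L y)"
  shows "tors L \<in> gh_W3 g I"
proof -
  have "tr (\<lambda>x y. \<psi> (L x) y z) = 0" for z
  proof -
    have 1: "\<psi> (L x) x z = (\<Sum>i\<in>UNIV. g (L x) (e i) * \<psi> (e i) x z)" for x
    proof -
      have "\<psi> (L x) x z = \<psi> (\<Sum>i\<in>UNIV. g (e i) (L x) *\<^sub>R e i) x z"
        using onb_expand[OF bil_g onb, of "L x"] by simp
      then show ?thesis by (simp add: linear_sum[OF lin_psi(1)] psi_simps g_sym)
    qed
    let ?S = "\<Sum>j\<in>UNIV. \<Sum>i\<in>UNIV. g (L (e j)) (e i) * \<psi> (e i) (e j) z"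
    have "?S = (\<Sum>i\<in>UNIV. \<Sum>j\<in>UNIV. g (L (e j)) (e i) * \<psi> (e i) (e j) z)" by (rule sum.swap)
    also have "\<dots> = (\<Sum>i\<in>UNIV. \<Sum>j\<in>UNIV. - (g (L (e i)) (e j) * \<psi> (e j) (e i) z))"
    proof (intro sum.cong refl)
      fix i j
      have "g (L (e j)) (e i) = g (L (e i)) (e j)" by (metis sym g_sym)
      then show "g (L (e j)) (e i) * \<psi> (e i) (e j) z = - (g (L (e i)) (e j) * \<psi> (e j) (e i) z)"
        using psi_swap(1)[of "e i" "e j" z] by simp
    qed
    also have "\<dots> = - ?S" by (simp add: sum_negf)
    finally show ?thesis by (simp add: 1)
  qed
  moreover have "bilinear (\<lambda>x y. \<psi> (L x) y z)" for z
    unfolding bilinear_def using lin_psi by (auto intro!: linear_compose[OF L lin_psi(1), unfolded o_def])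
  ultimately have "trace_form g (\<lambda>x y. \<psi> (L x) y z) = 0" for z
    using trace_form_onb[OF g onb] by simp
  moreover have "\<psi> (L (I x)) (I y) z = \<psi> (L x) y z" for x y z
    by (simp add: LI psi_simps psi_I[symmetric] I_simps II)
  ultimately show ?thesis
    unfolding gh_W3_def using tors_gh[OF L] by (simp add: tors_def)
qed

end

section \<open>Splitting the bilinear form of L into torsion components\<close>

definition torsion_of_type :: "6 form2 \<Rightarrow> (real ^ 6 \<Rightarrow> real ^ 6) \<Rightarrow> 6 form3 \<Rightarrow> 6 form3 \<Rightarrow> torsion_class set \<Rightarrow> bool" where
  "torsion_of_type g I \<psi> \<alpha> U \<longleftrightarrow> (\<exists>\<beta> :: torsion_class \<Rightarrow> 6 form3.
        (\<forall>k. \<beta> k \<in> torsion_space g I \<psi> k) \<and>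
        (\<forall>x y z. \<alpha> x y z = (\<Sum>k\<in>{W1p, W1m, W2p, W2m, W3, W4, W5}. \<beta> k x y z)) \<and>
        (\<forall>k. k \<notin> U \<longrightarrow> (\<forall>x y z. \<beta> k x y z = 0)))"

context su3_algebra
begin

definition riesz :: "6 form2 \<Rightarrow> real ^ 6 \<Rightarrow> real ^ 6" where
  "riesz h x = (\<Sum>i\<in>UNIV. h x (e i) *\<^sub>R e i)"

lemma linear_riesz: "bilinear h \<Longrightarrow> linear (riesz h)"
  unfolding riesz_def
  by (rule linearI) (simp_all add: bilinear_ladd bilinear_lmul scaleR_left_distrib sum.distrib scaleR_sum_right)

lemma g_riesz: assumes "bilinear h" shows "g (riesz h x) y = h x y"
proof -
  have "g (riesz h x) y = (\<Sum>i\<in>UNIV. h x (e i) * g (e i) y)"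
    unfolding riesz_def using bil_g by (simp add: bilinear_def linear_sum[of "\<lambda>x. g x y"] linear_cmul[of "\<lambda>x. g x y"])
  also have "\<dots> = h x (\<Sum>i\<in>UNIV. g (e i) y *\<^sub>R e i)"
    using assms by (simp add: bilinear_def linear_sum linear_cmul mult.commute)
  also have "\<dots> = h x y" using onb_expand[OF bil_g onb, of y] by simp
  finally show ?thesis .
qed

lemma bilinear_g_linear: "linear L \<Longrightarrow> bilinear (\<lambda>x y. g (L x) y)"
  unfolding bilinear_def by (auto intro!: linearI simp: linear_add linear_cmul g_simps)

lemma orthonormal_basis_I: "orthonormal_basis g (\<lambda>i. I (e i))"
  using onb by (simp add: orthonormal_basis_def g_II)

lemma tr_I: "bilinear (h :: 6 form2) \<Longrightarrow> (\<Sum>i\<in>UNIV. h (I (e i)) (I (e i))) = tr h"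
  using onb_trace_eq[OF g orthonormal_basis_I onb, of h] .

definition inv_part :: "6 form2 \<Rightarrow> 6 form2" where
  "inv_part h x y = (h x y + h (I x) (I y)) / 2"

definition scal :: "6 form2 \<Rightarrow> real" where "scal h = tr h / 6"
text \<open>Sign and factor are chosen such that the form \<open>g (I x) y\<close> has value
  1.\<close>

definition scal_I :: "6 form2 \<Rightarrow> real" where "scal_I h = - tr (\<lambda>x y. h (I x) y) / 6"

text \<open>The SU(3)-decomposition of bilinear forms. \<open>W3\<close> receives the whole
  anti-invariant part, which is correct once that part is symmetric; a skew share would belong to
  \<open>W4\<close>.\<close>

primrec component :: "6 form2 \<Rightarrow> torsion_class \<Rightarrow> 6 form2" where
  "component h W1p = (\<lambda>x y. scal h * g x y)"
| "component h W1m = (\<lambda>x y. scal_I h * g (I x) y)"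
| "component h W2p = (\<lambda>x y. (inv_part h x y + inv_part h y x) / 2 - scal h * g x y)"
| "component h W2m = (\<lambda>x y. (inv_part h x y - inv_part h y x) / 2 - scal_I h * g (I x) y)"
| "component h W3 = (\<lambda>x y. h x y - inv_part h x y)"
| "component h W4 = (\<lambda>x y. 0)"
| "component h W5 = (\<lambda>x y. 0)"

lemma bilinear_component:
  assumes "bilinear h" shows "bilinear (component h k)"
proof -
  note h = bilinear_ladd[OF assms] bilinear_radd[OF assms] bilinear_lmul[OF assms] bilinear_rmul[OF assms]
  show ?thesis
    by (cases k; simp add: bilinear_def; intro conjI allI linearI;
      simp add: h g_simps I_simps inv_part_def field_simps)
qed

lemma sum_component: "(\<Sum>k\<in>{W1p, W1m, W2p, W2m, W3, W4, W5}. component h k x y) = h x y"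
  by (simp add: field_simps)

lemma inv_part_I:
  assumes "bilinear h"
  shows "inv_part h (I x) y = - inv_part h x (I y)" "inv_part h (I x) (I y) = inv_part h x y"
  by (simp_all add: inv_part_def II bilinear_lneg[OF assms] bilinear_rneg[OF assms] field_simps)

lemma riesz_commutes:
  assumes h: "bilinear h" and "\<And>x y. h (I x) y = - h x (I y)"
  shows "riesz h (I x) = I (riesz h x)"
  by (rule metric_form_eqI[OF g]) (simp add: g_riesz[OF h] g_I assms(2))

lemma tr_inv_part:
  assumes h: "bilinear h" shows "tr (inv_part h) = tr h"
  using tr_I[OF h] by (simp add: inv_part_def sum.distrib sum_divide_distrib[symmetric])

lemma tr_swap_I:
  fixes h :: "6 form2"
  assumes h: "bilinear h"
  shows "(\<Sum>i\<in>UNIV. h (e i) (I (e i))) = - (\<Sum>i\<in>UNIV. h (I (e i)) (e i))"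
proof -
  have "bilinear (\<lambda>x y. h (I x) y)"
    using h by (auto simp: bilinear_def intro!: linear_compose[OF linear_I, unfolded o_def])
  from tr_I[OF this] show ?thesis
    by (simp add: II bilinear_lneg[OF h] sum_negf)
qed

lemma g_I_skew: "g (I x) y = - g (I y) x"
  using g_I[of x y] g_sym[of x "I y"] by simp

lemma tr_g: "tr g = 6"
  using onb by (simp add: orthonormal_basis_def)

lemma component_W2p:
  assumes h: "bilinear h"
  shows "tors (riesz (component h W2p)) \<in> gh_W2 I"
proof (rule tors_W2I)
  let ?c = "component h W2p"
  note b = bilinear_component[OF h, of W2p]
  show "linear (riesz ?c)" by (rule linear_riesz[OF b])
  have sk: "?c (I x) y = - ?c x (I y)" for x y
    using inv_part_I[OF h] by (simp add: g_I field_simps)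
  show "riesz ?c (I x) = I (riesz ?c x)" for x
    using riesz_commutes[OF b sk] .
  have "tr ?c = tr (inv_part h) - scal h * tr g"
    by (simp add: sum_subtractf sum_distrib_left)
  then have "tr ?c = 0"
    unfolding tr_inv_part[OF h] tr_g scal_def by simp
  then show "(\<Sum>i\<in>UNIV. g (riesz ?c (e i)) (e i)) = 0" by (simp add: g_riesz[OF b] del: component.simps)
  have symc: "?c x y = ?c y x" for x y
    using g_sym[of x y] by simp
  have "?c (I x) x = 0" for x
    using sk[of x x] symc[of x "I x"] by linarith
  then show "(\<Sum>i\<in>UNIV. g (riesz ?c (I (e i))) (e i)) = 0" by (simp add: g_riesz[OF b] del: component.simps)
qed

lemma tr_I_inv_part:
  assumes h: "bilinear h"
  shows "(\<Sum>i\<in>UNIV. inv_part h (I (e i)) (e i)) = - 6 * scal_I h"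
  using tr_swap_I[OF h]
  by (simp add: inv_part_def II bilinear_lneg[OF h] sum_divide_distrib[symmetric] scal_I_def sum_subtractf)

lemma component_W2m:
  assumes h: "bilinear h"
  shows "tors (riesz (component h W2m)) \<in> gh_W2 I"
proof (rule tors_W2I)
  let ?c = "component h W2m"
  note b = bilinear_component[OF h, of W2m]
  show "linear (riesz ?c)" by (rule linear_riesz[OF b])
  have sk: "?c (I x) y = - ?c x (I y)" for x y
    using inv_part_I[OF h] by (simp add: g_I II g_simps field_simps)
  show "riesz ?c (I x) = I (riesz ?c x)" for x
    using riesz_commutes[OF b sk] .
  have "?c x x = 0" for x by (simp add: g_I_self)
  then show "(\<Sum>i\<in>UNIV. g (riesz ?c (e i)) (e i)) = 0" by (simp add: g_riesz[OF b] del: component.simps)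
  have "?c (I x) x = inv_part h (I x) x + scal_I h * g x x" for x
    using inv_part_I(1)[OF h, of x x] by (simp add: II g_simps)
  moreover note tr_I_inv_part[OF h]
  moreover have "(\<Sum>i\<in>UNIV. inv_part h (I (e i)) (e i) + scal_I h * g (e i) (e i)) = (\<Sum>i\<in>UNIV. inv_part h (I (e i)) (e i)) + scal_I h * tr g"
    by (simp add: sum.distrib sum_distrib_left)
  ultimately have "(\<Sum>i\<in>UNIV. ?c (I (e i)) (e i)) = 0"
    using tr_g by (simp del: component.simps)
  then show "(\<Sum>i\<in>UNIV. g (riesz ?c (I (e i))) (e i)) = 0" by (simp add: g_riesz[OF b] del: component.simps)
qed

lemma component_mem:
  assumes h: "bilinear h" and sym: "\<And>x y. h x y - inv_part h x y = h y x - inv_part h y x"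
  shows "tors (riesz (component h k)) \<in> torsion_space g I \<psi> k"
proof -
  have r: "r_map g \<psi> (tors (riesz (component h k))) x y = component h k x y" for k x y
    by (simp add: r_map_tors g_riesz[OF bilinear_component[OF h]] del: component.simps)
  have zero: "tors (riesz (\<lambda>x y. 0)) = (\<lambda>x y z. 0)"
    by (simp add: tors_def riesz_def fun_eq_iff linear_0[OF lin_psi(1)])
  note b = bilinear_component[OF h]
  show ?thesis
  proof (cases k)
    case W1p
    have "riesz (component h W1p) = (\<lambda>x. scal h *\<^sub>R x + 0 *\<^sub>R I x)"
      by (rule ext, rule metric_form_eqI[OF g]) (simp only: g_riesz[OF b], simp add: g_simps)
    then have "tors (riesz (component h W1p)) \<in> gh_W1 I" by (simp only: tors_W1I)
    moreover have "component h W1p x y = component h W1p y x" for x y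
      using g_sym[of x y] by simp
    ultimately show ?thesis unfolding W1p torsion_space.simps mem_Collect_eq r by blast
  next
    case W1m
    have "riesz (component h W1m) = (\<lambda>x. 0 *\<^sub>R x + scal_I h *\<^sub>R I x)"
      by (rule ext, rule metric_form_eqI[OF g]) (simp only: g_riesz[OF b], simp add: g_simps)
    then have "tors (riesz (component h W1m)) \<in> gh_W1 I" by (simp only: tors_W1I)
    moreover have "component h W1m x y = - component h W1m y x" for x y
      using g_I_skew[of x y] by simp
    ultimately show ?thesis unfolding W1m torsion_space.simps mem_Collect_eq r by blast
  next
    case W2p
    have "component h W2p x y = component h W2p y x" for x y
      using g_sym[of x y] by simp
    then show ?thesis unfolding W2p torsion_space.simps mem_Collect_eq r using component_W2p[OF h] by blast
  next
    case W2m
    have "component h W2m x y = - component h W2m y x" for x y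
      using g_I_skew[of x y] by (simp add: field_simps)
    then show ?thesis unfolding W2m torsion_space.simps mem_Collect_eq r using component_W2m[OF h] by blast
  next
    case W3
    have "tors (riesz (component h W3)) \<in> gh_W3 g I"
    proof (rule tors_W3I)
      show "linear (riesz (component h W3))" by (rule linear_riesz[OF b])
      show "riesz (component h W3) (I x) = - I (riesz (component h W3) x)" for x
        by (rule metric_form_eqI[OF g]) (simp only: g_riesz[OF b] g_simps g_I, simp add: inv_part_def II bilinear_lneg[OF h] bilinear_rneg[OF h] field_simps)
      show "g (riesz (component h W3) x) y = g x (riesz (component h W3) y)" for x y
        by (subst g_sym[of x]) (simp only: g_riesz[OF b], simp add: sym)
    qed
    then show ?thesis using W3 by simp
  next
    case W4
    have "(\<lambda>x y z. 0) \<in> gh_W4 g I"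
      unfolding gh_W4_def gh_space_def trilinear_def
      by (auto intro!: exI[of _ "\<lambda>_. 0"] simp: module_hom_zero)
    then show ?thesis using W4 zero by simp
  next
    case W5
    then show ?thesis using zero by simp
  qed
qed

text \<open>From right to left the explicit components are a witness. From left to right an
  arbitrary decomposition is turned into endomorphisms \<open>K k\<close>, and the symmetries of
  their forms \<open>a k\<close> force \<open>a k = component h k\<close>. Since \<open>W4\<close>
  is excluded, the anti-invariant part of \<open>h\<close> comes from \<open>W3\<close>
  alone.\<close>

lemma torsion_of_type_iff:
  assumes L: "linear L" and h: "h = (\<lambda>x y. g (L x) y)"
    and sym: "\<And>x y. h x y - inv_part h x y = h y x - inv_part h y x" and U: "W4 \<notin> U"
  shows "torsion_of_type g I \<psi> (tors L) U \<longleftrightarrow> (\<forall>k. k \<notin> U \<longrightarrow> (\<forall>x y. component h k x y = 0))"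
proof
  have b: "bilinear h" unfolding h by (rule bilinear_g_linear[OF L])
  note bc = bilinear_component[OF b]
  let ?T = "{W1p, W1m, W2p, W2m, W3, W4, W5}"
  {
    assume zero: "\<forall>k. k \<notin> U \<longrightarrow> (\<forall>x y. component h k x y = 0)"
    have "L x = (\<Sum>k\<in>?T. riesz (component h k) x)" for x
    proof (rule metric_form_eqI[OF g])
      fix z
      have "g (\<Sum>k\<in>?T. riesz (component h k) x) z = (\<Sum>k\<in>?T. component h k x z)"
        using bil_g by (simp add: g_riesz[OF bc] g_simps del: component.simps)
      then show "g (L x) z = g (\<Sum>k\<in>?T. riesz (component h k) x) z"
        unfolding sum_component by (simp add: h)
    qed
    then have "tors L x y z = (\<Sum>k\<in>?T. tors (riesz (component h k)) x y z)" for x y z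
      unfolding tors_def by (simp add: psi_simps del: component.simps)
    moreover have "tors (riesz (component h k)) x y z = 0" if "k \<notin> U" for k x y z
      using zero that by (simp add: tors_def riesz_def linear_0[OF lin_psi(1)])
    ultimately show "torsion_of_type g I \<psi> (tors L) U"
      unfolding torsion_of_type_def using component_mem[OF b sym]
      by (intro exI[of _ "\<lambda>k. tors (riesz (component h k))"] conjI allI impI) blast+
  }
  assume "torsion_of_type g I \<psi> (tors L) U"
  then obtain \<beta> where mem: "\<And>k. \<beta> k \<in> torsion_space g I \<psi> k"
    and sum: "\<And>x y z. tors L x y z = (\<Sum>k\<in>?T. \<beta> k x y z)"
    and zero: "\<And>k x y z. k \<notin> U \<Longrightarrow> \<beta> k x y z = 0"
    unfolding torsion_of_type_def by blast
  have "\<exists>K. linear K \<and> \<beta> k = tors K" for k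
  proof (cases "k = W5")
    case True
    have "tors (\<lambda>x. 0) = \<beta> k"
      using mem[of k] True by (simp add: tors_def fun_eq_iff linear_0[OF lin_psi(1)])
    then show ?thesis by (intro exI[of _ "\<lambda>x. 0"]) (simp add: module_hom_zero linear_zero)
  next
    case False
    have "torsion_space g I \<psi> k \<subseteq> gh_space I"
      using False by (cases k) (auto simp: gh_W1_def gh_W2_def gh_W3_def gh_W4_def)
    then show ?thesis using gh_tors mem by (metis subsetD)
  qed
  then obtain K where K: "\<And>k. linear (K k)" "\<And>k. \<beta> k = tors (K k)" by metis
  define a where "a k x y = g (K k x) y" for k x y
  have r: "r_map g \<psi> (\<beta> k) = a k" for k
    by (intro ext) (simp add: K r_map_tors a_def)
  have ba: "bilinear (a k)" for k
    unfolding a_def[abs_def] by (rule bilinear_g_linear[OF K(1)])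
  have a0: "a k x y = 0" if "k \<notin> U" for k x y
  proof -
    have "K k = (\<lambda>x. 0)"
      by (rule tors_eqD) (use zero[OF that] in \<open>simp add: K fun_eq_iff tors_def linear_0[OF lin_psi(1)]\<close>)
    then show ?thesis by (simp add: a_def bilinear_lzero[OF bil_g])
  qed
  have "L x = (\<Sum>k\<in>?T. K k x)" for x
  proof (rule psi_eqD)
    show "\<psi> (L x) y z = \<psi> (\<Sum>k\<in>?T. K k x) y z" for y z
      using sum[of x y z] by (simp add: K tors_def psi_simps)
  qed
  then have ha: "h x y = (\<Sum>k\<in>?T. a k x y)" for x y
    by (simp add: h a_def g_simps)
  have aW: "a W4 x y = 0" "a W5 x y = 0" for x y
  proof -
    show "a W4 x y = 0" using a0 U by blast
    have "K W5 = (\<lambda>x. 0)"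
      by (rule tors_eqD) (use mem[of W5] in \<open>simp add: K fun_eq_iff tors_def linear_0[OF lin_psi(1)]\<close>)
    then show "a W5 x y = 0" by (simp add: a_def bilinear_lzero[OF bil_g])
  qed
  obtain x0 where x0: "g x0 x0 \<noteq> 0" by (rule nontrivial)
  have "tors (K W1p) \<in> gh_W1 I" "tors (K W1m) \<in> gh_W1 I"
    using mem[of W1p] mem[of W1m] unfolding torsion_space.simps mem_Collect_eq K(2)[symmetric] by blast+
  then obtain s t s' t' where "\<And>x. K W1p x = s *\<^sub>R x + t' *\<^sub>R I x" "\<And>x. K W1m x = s' *\<^sub>R x + t *\<^sub>R I x"
    using tors_W1D[OF K(1)] by metis
  then have a1: "a W1p x y = s * g x y + t' * g (I x) y" "a W1m x y = s' * g x y + t * g (I x) y" for x y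
    by (simp_all add: a_def g_simps)
  have "a W1p x y = a W1p y x" "a W1m x y = - a W1m y x" for x y
    using mem[of W1p] mem[of W1m] unfolding torsion_space.simps mem_Collect_eq r by blast+
  \<comment> \<open>A W1 form combines the symmetric \<open>g x y\<close> with the skew
    \<open>g (I x) y\<close>; testing at one nonzero vector removes the skew term from
    \<open>W1p\<close> and the symmetric term from \<open>W1m\<close>.\<close>
  from this(1)[of x0 "I x0"] this(2)[of x0 x0] have "t' = 0" "s' = 0"
    using x0 g_I_self[of x0] g_I_skew[of "I x0" x0] g_sym[of x0 "I x0"] by (simp_all add: a1 g_II II)
  note a1 = a1[unfolded this, simplified]
  have a2: "tors (K W2p) \<in> gh_W2 I" "tors (K W2m) \<in> gh_W2 I" "a W2p x y = a W2p y x" "a W2m x y = - a W2m y x" for x y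
    using mem[of W2p] mem[of W2m] unfolding torsion_space.simps mem_Collect_eq r K(2)[symmetric] by blast+
  have a2I: "a k (I x) (I y) = a k x y" "tr (a k) = 0" "(\<Sum>i\<in>UNIV. a k (I (e i)) (e i)) = 0" if "k = W2p \<or> k = W2m" for k x y
  proof -
    have *: "tors (K k) \<in> gh_W2 I" using a2 that by auto
    show "a k (I x) (I y) = a k x y" "tr (a k) = 0" "(\<Sum>i\<in>UNIV. a k (I (e i)) (e i)) = 0"
      using tors_W2D[OF K(1) *] by (simp_all add: a_def g_II)
  qed
  have a3: "a W3 (I x) (I y) = - a W3 x y" for x y
    using tors_W3D[of "K W3"] mem[of W3] by (simp add: K(2) a_def g_II g_simps)
  \<comment> \<open>\<open>inv_part\<close> annihilates the \<open>W3\<close> form, and both traces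
    of the W2 forms vanish, so the traces of \<open>h\<close> recover \<open>s\<close> and
    \<open>t\<close>.\<close>
  have hc: "inv_part h x y = s * g x y + t * g (I x) y + a W2p x y + a W2m x y" for x y
    by (simp add: inv_part_def ha a1 a3 aW a2I g_II)
  have "tr h = s * tr g + t * (\<Sum>i\<in>UNIV. g (I (e i)) (e i)) + tr (a W2p) + tr (a W2m)"
    unfolding tr_inv_part[OF b, symmetric] hc by (simp only: sum.distrib sum_distrib_left)
  then have s: "scal h = s" by (simp add: a2I tr_g g_I_self scal_def)
  have "- 6 * scal_I h = s * (\<Sum>i\<in>UNIV. g (I (e i)) (e i)) + t * (\<Sum>i\<in>UNIV. g (I (I (e i))) (e i))
      + (\<Sum>i\<in>UNIV. a W2p (I (e i)) (e i)) + (\<Sum>i\<in>UNIV. a W2m (I (e i)) (e i))"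
    unfolding tr_I_inv_part[OF b, symmetric] hc by (simp only: sum.distrib sum_distrib_left)
  also have "(\<Sum>i\<in>UNIV. g (I (I (e i))) (e i)) = - tr g" by (simp add: II g_simps sum_negf)
  finally have t: "scal_I h = t" by (simp add: a2I tr_g g_I_self)
  have "component h k x y = a k x y" for k x y
    using a2(3)[of x y] a2(4)[of x y] g_sym[of x y] g_I_skew[of x y]
    by (cases k) (simp_all add: s t a1 aW hc ha add_divide_distrib diff_divide_distrib)
  then show "\<forall>k. k \<notin> U \<longrightarrow> (\<forall>x y. component h k x y = 0)" using a0 by simp
qed

end

section \<open>The model \<open>SU(3)\<close>-structure\<close>

text \<open>Moving \<open>I\<close> into a slot of \<open>\<psi>\<close> multiplies the complex
  volume form by i, and the axioms are insensitive to its phase.\<close>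

lemma (in su3_algebra) su3_algebra_rotated: "su3_algebra g I (\<lambda>x. \<psi> (I x)) e"
proof
  show "trilinear (\<lambda>x. \<psi> (I x))"
    unfolding trilinear_def using lin_psi by (auto intro!: linear_compose[OF linear_I lin_psi(1), unfolded o_def])
  show "\<psi> (I y) x z = - \<psi> (I x) y z" for x y z
    using psi_swap(1)[of y "I x" z] by (simp add: psi_I)
  show "inner_form2 g (\<psi> (I x)) (\<psi> (I y)) = 2 * g x y" for x y by (simp add: psi_inner g_II)
  show "\<psi> (I (L x)) y z + \<psi> (I x) (L y) z + \<psi> (I x) y (L z) =
      (\<Sum>i\<in>UNIV. g (L (e i)) (e i)) / 2 * \<psi> (I x) y z - (\<Sum>i\<in>UNIV. g (L (I (e i))) (e i)) / 2 * \<psi> (I (I x)) y z"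
    if "linear L" "\<And>x. L (I x) = I (L x)" for L x y z
    using psi_cyclic[OF that, of "I x" y z] that(2) by simp
  show "\<exists>u. \<beta> = \<psi> (I u)" if \<beta>: "bilinear \<beta>" "\<And>y z. \<beta> z y = - \<beta> y z" "\<And>y z. \<beta> (I y) (I z) = - \<beta> y z" for \<beta>
  proof -
    obtain u where "\<beta> = \<psi> u" using psi_surj[OF \<beta>] by blast
    then have "\<beta> = \<psi> (I (- I u))" by (simp add: I_simps II)
    then show ?thesis by blast
  qed
  show "\<psi> (I x) z y = - \<psi> (I x) y z" for x y z by (rule psi_swap(2))
qed (rule g onb II g_II psi_I linear_add[OF linear_I] linear_cmul[OF linear_I])+

lemma bilinear_eq_onb:
  fixes T T' :: "'n::finite form2"
  assumes b: "bilinear b" and e: "orthonormal_basis b e" and T: "bilinear T" "bilinear T'"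
    and eq: "\<And>i j. T (e i) (e j) = T' (e i) (e j)"
  shows "T x y = T' x y"
proof -
  have *: "S x y = (\<Sum>i\<in>UNIV. \<Sum>j\<in>UNIV. b (e i) x * (b (e j) y * S (e i) (e j)))" if "bilinear S" for S :: "'n form2"
  proof -
    have l: "S (\<Sum>i\<in>UNIV. f i *\<^sub>R e i) v = (\<Sum>i\<in>UNIV. f i * S (e i) v)" for f v
      using that by (simp add: bilinear_def linear_sum[of "\<lambda>x. S x v"] linear_cmul[of "\<lambda>x. S x v"])
    have r: "S v (\<Sum>i\<in>UNIV. f i *\<^sub>R e i) = (\<Sum>i\<in>UNIV. f i * S v (e i))" for f v
      using that by (simp add: bilinear_def linear_sum linear_cmul)
    have "S x y = S (\<Sum>i\<in>UNIV. b (e i) x *\<^sub>R e i) (\<Sum>j\<in>UNIV. b (e j) y *\<^sub>R e j)"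
      using onb_expand[OF b e] by metis
    also have "\<dots> = (\<Sum>i\<in>UNIV. \<Sum>j\<in>UNIV. b (e i) x * (b (e j) y * S (e i) (e j)))"
      by (subst l, subst r) (simp add: sum_distrib_left)
    finally show ?thesis .
  qed
  show ?thesis unfolding *[OF T(1)] *[OF T(2)] eq ..
qed

lemma phi0_alternating: "phi0 b a c = - phi0 a b c" "phi0 a c b = - phi0 a b c"
  unfolding phi0_explicit pl_def by (simp_all add: algebra_simps)

lemma phi0_rotate: "phi0 a b c = phi0 b c a"
  unfolding phi0_explicit pl_def by (simp add: algebra_simps)

lemma cross0_e0_nth: "cross0 e0 a $ 0 = 0" "cross0 e0 a $ 1 = - a $ 3" "cross0 e0 a $ 2 = - a $ 6" "cross0 e0 a $ 3 = a $ 1"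
   "cross0 e0 a $ 4 = - a $ 5" "cross0 e0 a $ 5 = a $ 4" "cross0 e0 a $ 6 = a $ 2"
  by (simp_all add: pl_def axis_1_nth)

lemma phi0_cross0_e0:
  assumes "a $ 0 = 0" "b $ 0 = 0" "c $ 0 = 0"
  shows "phi0 (cross0 e0 a) b c = phi0 a (cross0 e0 b) c"
  unfolding phi0_explicit pl_def cross0_e0_nth by (simp add: assms algebra_simps)

text \<open>The cross product with e_0 sends e_1, e_2, e_4 to e_3, e_6, e_5. Multiplying
  \<open>u\<close> by one complex coordinate is thus a complex linear map of rank one with complex
  trace u_i + i u_k, and the identity is the derivative of the complex determinant along it. Three
  such columns make up a general complex linear map.\<close>

lemma phi0_complex_cyclic_columns:
  assumes "a $ 0 = 0" "b $ 0 = 0" "c $ 0 = 0" "u $ 0 = 0"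
    and "(i, k) \<in> {(1, 3), (2, 6), (4, 5)}"
  shows "phi0 (a $ i *\<^sub>R u + a $ k *\<^sub>R cross0 e0 u) b c + phi0 a (b $ i *\<^sub>R u + b $ k *\<^sub>R cross0 e0 u) c
    + phi0 a b (c $ i *\<^sub>R u + c $ k *\<^sub>R cross0 e0 u) = u $ i * phi0 a b c + u $ k * phi0 (cross0 e0 a) b c"
  using assms(5)
  by (elim insertE; simp add: phi0_explicit pl_def cross0_e0_nth assms(1-4) algebra_simps del: cross0_nth)

lemma phi0_complex_cyclic:
  assumes abc: "a $ 0 = 0" "b $ 0 = 0" "c $ 0 = 0" and u: "u $ 0 = 0" and v: "v $ 0 = 0" and w: "w $ 0 = 0"
    and A: "\<And>x. A x = x $ 1 *\<^sub>R u + x $ 3 *\<^sub>R cross0 e0 u + (x $ 2 *\<^sub>R v + x $ 6 *\<^sub>R cross0 e0 v) + (x $ 4 *\<^sub>R w + x $ 5 *\<^sub>R cross0 e0 w)"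
  shows "phi0 (A a) b c + phi0 a (A b) c + phi0 a b (A c) = (u $ 1 + v $ 2 + w $ 4) * phi0 a b c + (u $ 3 + v $ 6 + w $ 5) * phi0 (cross0 e0 a) b c"
  using phi0_complex_cyclic_columns[OF abc u, of 1 3] phi0_complex_cyclic_columns[OF abc v, of 2 6]
    phi0_complex_cyclic_columns[OF abc w, of 4 5]
  unfolding A linear_add[OF phi0_linear(1)] linear_add[OF phi0_linear(2)] linear_add[OF phi0_linear(3)] distrib_right
  by (simp del: cross0_nth)

lemma hyperplane_surj:
  fixes F :: "real ^ 6 \<Rightarrow> real ^ 7"
  assumes F: "linear F" "inj F" and n: "n \<noteq> 0" "\<And>x. n \<bullet> F x = 0" and v: "n \<bullet> v = 0"
  shows "\<exists>x. F x = v"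
proof -
  let ?V = "{v. n \<bullet> v = 0}"
  have "dim (range F) = 6"
    using dim_image_eq[OF F(1), of UNIV] F(2) by (simp add: dim_UNIV)
  moreover have "dim ?V = 6" using dim_hyperplane[OF n(1)] by simp
  moreover have "range F \<subseteq> ?V" using n(2) by auto
  ultimately have "range F = ?V"
    using subspace_dim_equal[of "range F" ?V] linear_subspace_image[OF F(1) subspace_UNIV] subspace_hyperplane[of n] by simp
  then show ?thesis using v by (metis (mono_tags, lifting) imageE mem_Collect_eq)
qed

text \<open>\<open>F\<close> will be the differential of the immersion, written in a G2-frame whose
  zeroth vector is the normal.\<close>

locale su3_frame =
  fixes F :: "real ^ 6 \<Rightarrow> real ^ 7" and I :: "real ^ 6 \<Rightarrow> real ^ 6"
  assumes linear_F: "linear F" and inj_F: "inj F" and F_0: "F x $ 0 = 0" and F_I: "F (I x) = cross0 e0 (F x)"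
begin

lemma F_surj:
  assumes "v $ 0 = 0"
  obtains x where "F x = v"
  using hyperplane_surj[OF linear_F inj_F, of e0 v] F_0 assms by (auto simp: inner_axis')

definition g :: "6 form2" where "g x y = F x \<bullet> F y"
definition \<psi> :: "6 form3" where "\<psi> x y z = phi0 (F x) (F y) (F z)"
definition e :: "6 \<Rightarrow> real ^ 6" where "e j = (SOME x. F x = tan_ax j)"

lemma F_e: "F (e j) = tan_ax j"
proof -
  have "\<forall>j. tan_ax j $ 0 = 0" by (simp add: forall_6 tan_ax_nth)
  then show ?thesis unfolding e_def by (metis (mono_tags) F_surj someI_ex)
qed

lemma bilinear_g: "bilinear g"
  unfolding bilinear_def g_def
  by (auto intro!: linearI simp: linear_add[OF linear_F] linear_cmul[OF linear_F] inner_add_left inner_add_right)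

lemma F_eqD: "F x = F y \<Longrightarrow> x = y"
  using inj_F by (auto dest: injD)

lemma metric_g: "metric_form g"
  unfolding metric_form_def
proof (intro conjI allI impI bilinear_g)
  show "g x y = g y x" for x y by (simp add: g_def inner_commute)
  fix x :: "real ^ 6" assume "x \<noteq> 0"
  then have "F x \<noteq> 0" using F_eqD[of x 0] by (auto simp: linear_0[OF linear_F])
  then show "g x x > 0" by (simp add: g_def)
qed

lemma onb_e: "orthonormal_basis g e"
  unfolding orthonormal_basis_def g_def F_e
  by (simp add: forall_6 inner_tan_ax tan_ax_nth)

lemma linear_I: "linear I"
  by (rule linearI; rule F_eqD)
    (simp_all add: F_I linear_add[OF linear_F] linear_cmul[OF linear_F] vec_eq_iff forall_7 cross0_e0_nth del: cross0_nth)

lemma I_e: "I (e 0) = e 2" "I (e 2) = - e 0" "I (e 1) = e 5" "I (e 5) = - e 1" "I (e 3) = e 4" "I (e 4) = - e 3"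
  by (rule F_eqD; simp add: F_I F_e linear_neg[OF linear_F] vec_eq_iff forall_7 cross0_e0_nth tan_ax_nth del: cross0_nth)+

lemma bilinear_psi: "bilinear (\<psi> x)"
  unfolding bilinear_def \<psi>_def
  by (intro conjI allI linear_compose[OF linear_F phi0_linear(2), unfolded o_def] linear_compose[OF linear_F phi0_linear(3), unfolded o_def])

lemma F_expand: "F x = F x $ 1 *\<^sub>R F (e 0) + F x $ 3 *\<^sub>R F (e 2) + (F x $ 2 *\<^sub>R F (e 1) + F x $ 6 *\<^sub>R F (e 5)) + (F x $ 4 *\<^sub>R F (e 3) + F x $ 5 *\<^sub>R F (e 4))"
  by (simp add: vec_eq_iff forall_7 F_e F_0 tan_ax_nth)

lemma psi_inner: "inner_form2 g (\<psi> x) (\<psi> y) = 2 * g x y"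
  unfolding inner_form2_onb[OF metric_g onb_e bilinear_psi bilinear_psi] \<psi>_def F_e
   phi0_rotate[of "F _"] sum_6 phi0_tan
  by (simp add: F_0 g_def inner_vec_def sum_7)

lemma psi_cyclic:
  assumes L: "linear L" and LI: "\<And>x. L (I x) = I (L x)"
  shows "\<psi> (L x) y z + \<psi> x (L y) z + \<psi> x y (L z) =
      (\<Sum>i\<in>UNIV. g (L (e i)) (e i)) / 2 * \<psi> x y z - (\<Sum>i\<in>UNIV. g (L (I (e i))) (e i)) / 2 * \<psi> (I x) y z"
proof -
  define u v w where "u = F (L (e 0))" and "v = F (L (e 1))" and "w = F (L (e 3))"
  define A where "A a = a $ 1 *\<^sub>R u + a $ 3 *\<^sub>R cross0 e0 u + (a $ 2 *\<^sub>R v + a $ 6 *\<^sub>R cross0 e0 v) + (a $ 4 *\<^sub>R w + a $ 5 *\<^sub>R cross0 e0 w)" for a :: "real ^ 7"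
  have Le: "F (L (e 2)) = cross0 e0 u" "F (L (e 5)) = cross0 e0 v" "F (L (e 4)) = cross0 e0 w"
    using LI[of "e 0"] LI[of "e 1"] LI[of "e 3"] by (simp_all add: I_e F_I u_def v_def w_def)
  have FL: "F (L x) = A (F x)" for x
  proof -
    have "x = F x $ 1 *\<^sub>R e 0 + F x $ 3 *\<^sub>R e 2 + (F x $ 2 *\<^sub>R e 1 + F x $ 6 *\<^sub>R e 5) + (F x $ 4 *\<^sub>R e 3 + F x $ 5 *\<^sub>R e 4)" (is "x = ?r")
      by (rule F_eqD, subst F_expand) (simp only: linear_add[OF linear_F] linear_cmul[OF linear_F])
    then have "F (L x) = F (L ?r)" by simp
    also have "\<dots> = A (F x)"
      by (simp only: linear_add[OF L] linear_cmul[OF L] linear_add[OF linear_F] linear_cmul[OF linear_F] A_def Le u_def v_def w_def)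
    finally show ?thesis .
  qed
  have z: "u $ 0 = 0" "v $ 0 = 0" "w $ 0 = 0" by (simp_all add: u_def v_def w_def F_0)
  \<comment> \<open>The real trace is twice the real part of the complex trace. Composing with
    \<open>I\<close> multiplies the complex trace by i, whence minus the imaginary part in the
    second sum.\<close>
  have "(\<Sum>i\<in>UNIV. g (L (e i)) (e i)) / 2 = u $ 1 + v $ 2 + w $ 4"
    unfolding g_def sum_6 Le F_e inner_tan_ax by (simp add: cross0_e0_nth u_def v_def w_def del: cross0_nth)
  moreover have "(\<Sum>i\<in>UNIV. g (L (I (e i))) (e i)) / 2 = - (u $ 3 + v $ 6 + w $ 5)"
    unfolding g_def sum_6 I_e linear_neg[OF L] linear_neg[OF linear_F] Le F_e inner_tan_ax inner_minus_left
    by (simp add: cross0_e0_nth u_def v_def w_def del: cross0_nth)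
  ultimately show ?thesis
    using phi0_complex_cyclic[OF F_0 F_0 F_0 z A_def, of x y z]
    by (simp only: \<psi>_def FL F_I mult_minus_left diff_minus_eq_add)
qed

lemma psi_surj:
  assumes b: "bilinear \<beta>" and sk: "\<And>y z. \<beta> z y = - \<beta> y z" and bI: "\<And>y z. \<beta> (I y) (I z) = - \<beta> y z"
  shows "\<exists>u. \<beta> = \<psi> u"
proof -
  define B where "B i j = \<beta> (e i) (e j)" for i j
  \<comment> \<open>Of the fifteen entries of \<open>\<beta>\<close> three vanish and twelve agree
    in pairs up to sign. Each component of \<open>v\<close> is the entry at the place where the
    table \<open>phi0_tan\<close> shows it.\<close>
  define v :: "real ^ 7" where "v = (\<chi> k. if k = 1 then B 1 3 else if k = 2 then B 3 0 else if k = 3 then B 4 1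
     else if k = 4 then B 0 1 else if k = 5 then B 1 2 else if k = 6 then B 2 3 else 0)"
  have v: "v $ 0 = 0" "v $ 1 = B 1 3" "v $ 2 = B 3 0" "v $ 3 = B 4 1" "v $ 4 = B 0 1" "v $ 5 = B 1 2" "v $ 6 = B 2 3"
    by (simp_all add: v_def)
  obtain u where u: "F u = v" using F_surj[OF v(1)] by blast
  have sw: "B j i = - B i j" for i j by (simp add: B_def sk[of "e i" "e j"])
  have B0: "B i i = 0" for i using sw[of i i] by simp
  note neg = bilinear_lneg[OF b] bilinear_rneg[OF b]
  have rel: "B 2 5 = - B 0 1" "B 2 4 = - B 0 3" "B 5 4 = - B 1 3"
     "B 0 5 = B 2 1" "B 0 4 = B 2 3" "B 1 4 = B 5 3"
     "B 0 2 = 0" "B 1 5 = 0" "B 3 4 = 0"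
    using bI[of "e 0" "e 1"] bI[of "e 0" "e 3"] bI[of "e 1" "e 3"] bI[of "e 2" "e 1"] bI[of "e 2" "e 3"] bI[of "e 5" "e 3"]
      bI[of "e 0" "e 2"] bI[of "e 1" "e 5"] bI[of "e 3" "e 4"] sw[of 0 2] sw[of 1 5] sw[of 3 4]
    by (simp_all add: I_e neg B_def[symmetric])
  have "\<forall>i j. \<beta> (e i) (e j) = \<psi> u (e i) (e j)"
    unfolding forall_6 \<psi>_def F_e u phi0_rotate[of v] phi0_tan v B_def[symmetric]
    using rel sw[of 0 1] sw[of 0 2] sw[of 0 3] sw[of 0 4] sw[of 0 5] sw[of 1 2] sw[of 1 3] sw[of 1 4] sw[of 1 5]
      sw[of 2 3] sw[of 2 4] sw[of 2 5] sw[of 3 4] sw[of 3 5] sw[of 4 5] by (simp add: B0)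
  then have "\<beta> x y = \<psi> u x y" for x y
    using bilinear_eq_onb[OF bilinear_g onb_e b bilinear_psi] by blast
  then show ?thesis by blast
qed

lemma su3_algebra: "su3_algebra g I \<psi> e"
proof (rule su3_algebra.intro)
  show "I (I x) = - x" for x
    by (rule F_eqD) (simp add: F_I linear_neg[OF linear_F] vec_eq_iff forall_7 cross0_e0_nth F_0 del: cross0_nth)
  show "g (I x) (I y) = g x y" for x y
    by (simp add: g_def F_I inner_vec_def sum_7 cross0_e0_nth F_0 del: cross0_nth)
  show "trilinear \<psi>"
    using bilinear_psi linear_compose[OF linear_F phi0_linear(1), unfolded o_def]
    by (simp add: trilinear_def bilinear_def \<psi>_def)
  show "\<psi> y x z = - \<psi> x y z" "\<psi> x z y = - \<psi> x y z" for x y z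
    unfolding \<psi>_def by (rule phi0_alternating)+
  show "\<psi> (I x) y z = \<psi> x (I y) z" for x y z
    unfolding \<psi>_def F_I by (rule phi0_cross0_e0) (rule F_0)+
qed (rule metric_g onb_e linear_I psi_inner psi_cyclic psi_surj; assumption)+

end

section \<open>Torsion types in terms of \<open>B\<close> and \<open>r\<close>\<close>

context su3_algebra
begin

text \<open>The I-invariant part of \<open>B\<close> is symmetric and that of
  \<open>R x (I y)\<close> is skew, so \<open>B\<close> alone governs \<open>W1p\<close>,
  \<open>W2p\<close> and \<open>R\<close> alone governs \<open>W1m\<close>, \<open>W2m\<close>. The
  anti-invariant parts are both symmetric: they rule out \<open>W4\<close> and meet in
  \<open>W3\<close>.\<close>

lemma torsion_types:
  assumes L: "linear L" and LBR: "\<And>x y. g (L x) y = B x y + R x (I y)"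
    and B: "bilinear B" "\<And>x y. B x y = B y x" and R: "bilinear R" "\<And>x y. R x y = R y x"
  shows "torsion_of_type g I \<psi> (tors L) {W1p, W1m, W2p, W2m, W3, W5}" (is ?full)
    and "torsion_of_type g I \<psi> (tors L) {W1p, W1m, W2p, W2m, W3}" (is ?full')
    and "torsion_of_type g I \<psi> (tors L) {W1p, W1m, W2p, W2m, W5}
      \<longleftrightarrow> (\<forall>x y. I1 I R x y + I2 I R x y = B x y - I12 I B x y)" (is ?W3)
    and "torsion_of_type g I \<psi> (tors L) {W1p, W1m, W2p, W3, W5}
      \<longleftrightarrow> (\<forall>x y. R x y + I12 I R x y = tr R / 3 * g x y)" (is ?W2m)
    and "torsion_of_type g I \<psi> (tors L) {W1p, W1m, W2m, W3, W5}
      \<longleftrightarrow> (\<forall>x y. B x y + I12 I B x y = tr B / 3 * g x y)" (is ?W2p)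
    and "torsion_of_type g I \<psi> (tors L) {W1p, W2p, W2m, W3, W5} \<longleftrightarrow> tr R = 0" (is ?W1m)
    and "torsion_of_type g I \<psi> (tors L) {W1m, W2p, W2m, W3, W5} \<longleftrightarrow> tr B = 0" (is ?W1p)
proof -
  define h where "h = (\<lambda>x y. g (L x) y)"
  have h: "h x y = B x y + R x (I y)" for x y by (simp add: h_def LBR)
  have hb: "bilinear h" unfolding h_def by (rule bilinear_g_linear[OF L])
  note neg = bilinear_lneg[OF R(1)] bilinear_rneg[OF R(1)] bilinear_lneg[OF B(1)] bilinear_rneg[OF B(1)]
  have invh: "inv_part h x y = (B x y + B (I x) (I y)) / 2 + (R x (I y) - R (I x) y) / 2" for x y
    by (simp add: inv_part_def h II neg add_divide_distrib diff_divide_distrib)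
  have sym: "h x y - inv_part h x y = h y x - inv_part h y x" for x y
    unfolding invh h using B(2)[of x y] B(2)[of "I x" "I y"] R(2)[of x "I y"] R(2)[of "I x" y] by (simp add: field_simps)
  note iff = torsion_of_type_iff[OF L h_def sym]
  have skew0: "T (I x) x = 0" if "bilinear T" "\<And>x y. T x y = T y x" "\<And>x y. T (I x) (I y) = T x y" for T :: "6 form2" and x
    using that(3)[of "I x" x] that(2)[of "I x" x] by (simp add: II bilinear_lneg[OF that(1)])
  have tr0: "(\<Sum>i\<in>UNIV. T (I (e i)) (e i)) = 0" if "bilinear T" "\<And>x y. T x y = T y x" for T :: "6 form2"
    using tr_swap_I[OF that(1)] that(2)[of "e _" "I (e _)"] by simp
  have scal: "scal h = tr B / 6"
    using tr0[OF R] R(2)[of "e _" "I (e _)"] by (simp add: scal_def h sum.distrib)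
  have scal_I: "scal_I h = - tr R / 6"
    using tr0[OF B] tr_I[OF R(1)] by (simp add: scal_I_def h sum.distrib)
  obtain x0 where x0: "g x0 x0 \<noteq> 0" by (rule nontrivial)
  have k: "(\<forall>k. k \<notin> {W1p, W1m, W2p, W2m, W3, W5} \<longrightarrow> P k) \<longleftrightarrow> P W4"
    "(\<forall>k. k \<notin> {W1p, W1m, W2p, W2m, W3} \<longrightarrow> P k) \<longleftrightarrow> P W4 \<and> P W5"
    "(\<forall>k. k \<notin> {W1p, W1m, W2p, W2m, W5} \<longrightarrow> P k) \<longleftrightarrow> P W4 \<and> P W3"
    "(\<forall>k. k \<notin> {W1p, W1m, W2p, W3, W5} \<longrightarrow> P k) \<longleftrightarrow> P W4 \<and> P W2m"
    "(\<forall>k. k \<notin> {W1p, W1m, W2m, W3, W5} \<longrightarrow> P k) \<longleftrightarrow> P W4 \<and> P W2p"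
    "(\<forall>k. k \<notin> {W1p, W2p, W2m, W3, W5} \<longrightarrow> P k) \<longleftrightarrow> P W4 \<and> P W1m"
    "(\<forall>k. k \<notin> {W1m, W2p, W2m, W3, W5} \<longrightarrow> P k) \<longleftrightarrow> P W4 \<and> P W1p" for P
    by (metis (full_types) insert_iff empty_iff torsion_class.exhaust torsion_class.distinct)+
  show ?full ?full' unfolding iff[OF _ ] by (subst iff, simp, simp only: k component.simps, simp)+
  show ?W3
  proof (subst iff, simp, simp only: k component.simps simp_thms)
    show "(\<forall>x y. h x y - inv_part h x y = 0) \<longleftrightarrow> (\<forall>x y. I1 I R x y + I2 I R x y = B x y - I12 I B x y)"
      unfolding invh h I1_def I2_def I12_def by (intro all_cong1) (auto simp: field_simps)
  qed
  show ?W2m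
  proof (subst iff, simp, simp only: k component.simps simp_thms)
    have 1: "(inv_part h x y - inv_part h y x) / 2 - scal_I h * g (I x) y = (R x (I y) - R (I x) y) / 2 + tr R / 6 * g (I x) y" for x y
      unfolding invh scal_I using B(2)[of x y] B(2)[of "I x" "I y"] R(2)[of x "I y"] R(2)[of "I x" y] by (simp add: field_simps)
    have 2: "(R x (I (I y)) - R (I x) (I y)) / 2 + tr R / 6 * g (I x) (I y) = 0 \<longleftrightarrow> R x y + I12 I R x y = tr R / 3 * g x y" for x y
      by (simp add: II neg g_II I12_def field_simps) argo
    \<comment> \<open>Replacing \<open>y\<close> by \<open>I y\<close> turns the skew form of the
      condition into one on \<open>R\<close> and \<open>g\<close> themselves.\<close>
    have all_I: "(\<forall>y. P y) \<longleftrightarrow> (\<forall>y. P (I y))" for P by (metis II minus_minus I_simps(3))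
    have "(\<forall>x y. (inv_part h x y - inv_part h y x) / 2 - scal_I h * g (I x) y = 0) \<longleftrightarrow>
       (\<forall>x y. (R x (I (I y)) - R (I x) (I y)) / 2 + tr R / 6 * g (I x) (I y) = 0)"
      unfolding 1 by (rule arg_cong[where f = All], rule ext, rule all_I)
    then show "(\<forall>x y. (inv_part h x y - inv_part h y x) / 2 - scal_I h * g (I x) y = 0) \<longleftrightarrow> (\<forall>x y. R x y + I12 I R x y = tr R / 3 * g x y)"
      unfolding 2 .
  qed
  show ?W2p
  proof (subst iff, simp, simp only: k component.simps simp_thms)
    have 1: "(inv_part h x y + inv_part h y x) / 2 - scal h * g x y = (B x y + B (I x) (I y)) / 2 - tr B / 6 * g x y" for x y
      unfolding invh scal using B(2)[of x y] B(2)[of "I x" "I y"] R(2)[of x "I y"] R(2)[of "I x" y] by (simp add: field_simps)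
    show "(\<forall>x y. (inv_part h x y + inv_part h y x) / 2 - scal h * g x y = 0) \<longleftrightarrow> (\<forall>x y. B x y + I12 I B x y = tr B / 3 * g x y)"
      unfolding 1 I12_def by (intro arg_cong[where f = All] ext) auto
  qed
  show ?W1m
  proof (subst iff, simp, simp only: k component.simps simp_thms)
    show "(\<forall>x y. scal_I h * g (I x) y = 0) \<longleftrightarrow> tr R = 0"
      unfolding scal_I using x0 g_II[of x0 x0] by (metis (no_types, lifting) divide_eq_0_iff mult_eq_0_iff neg_equal_0_iff_equal zero_neq_numeral)
  qed
  show ?W1p
  proof (subst iff, simp, simp only: k component.simps simp_thms)
    show "(\<forall>x y. scal h * g x y = 0) \<longleftrightarrow> tr B = 0"
      unfolding scal using x0 by (metis (no_types, lifting) divide_eq_0_iff mult_eq_0_iff zero_neq_numeral)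
  qed
qed

text \<open>Passing to \<open>\<theta> = \<pi>/2\<close> replaces \<open>L\<close> by \<open>- I L\<close>, that is, \<open>(B, R)\<close> by \<open>(- R, B)\<close>.\<close>

lemma torsion_types_rotated:
  assumes L: "linear L" and LBR: "\<And>x y. g (L x) y = B x y + R x (I y)"
    and B: "bilinear B" "\<And>x y. B x y = B y x" and R: "bilinear R" "\<And>x y. R x y = R y x"
  shows "torsion_of_type g I (\<lambda>x. \<psi> (I x)) (tors L) {W1p, W1m, W2p, W2m, W3, W5}"
    and "torsion_of_type g I (\<lambda>x. \<psi> (I x)) (tors L) {W1p, W1m, W2p, W2m, W3}"
    and "torsion_of_type g I (\<lambda>x. \<psi> (I x)) (tors L) {W1p, W1m, W2p, W2m, W5}
      \<longleftrightarrow> (\<forall>x y. I1 I R x y + I2 I R x y = B x y - I12 I B x y)"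
    and "torsion_of_type g I (\<lambda>x. \<psi> (I x)) (tors L) {W1p, W1m, W2p, W3, W5}
      \<longleftrightarrow> (\<forall>x y. B x y + I12 I B x y = tr B / 3 * g x y)"
    and "torsion_of_type g I (\<lambda>x. \<psi> (I x)) (tors L) {W1p, W1m, W2m, W3, W5}
      \<longleftrightarrow> (\<forall>x y. R x y + I12 I R x y = tr R / 3 * g x y)"
    and "torsion_of_type g I (\<lambda>x. \<psi> (I x)) (tors L) {W1p, W2p, W2m, W3, W5} \<longleftrightarrow> tr B = 0"
    and "torsion_of_type g I (\<lambda>x. \<psi> (I x)) (tors L) {W1m, W2p, W2m, W3, W5} \<longleftrightarrow> tr R = 0"
proof -
  interpret rot: su3_algebra g I "\<lambda>x. \<psi> (I x)" e by (rule su3_algebra_rotated)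
  have tors: "rot.tors (\<lambda>x. - I (L x)) = tors L"
    by (simp add: rot.tors_def tors_def fun_eq_iff I_simps II)
  note negR = bilinear_lneg[OF R(1)] bilinear_rneg[OF R(1)]
  note negB = bilinear_lneg[OF B(1)] bilinear_rneg[OF B(1)]
  have L': "linear (\<lambda>x. - I (L x))"
    by (rule linearI) (simp_all add: I_simps linear_add[OF L] linear_cmul[OF L])
  have LBR': "g (- I (L x)) y = - R x y + B x (I y)" for x y
    using LBR[of x "I y"] by (simp add: g_simps g_I II negR)
  have R': "bilinear (\<lambda>x y. - R x y)" "- R x y = - R y x" for x y
    using R by (auto simp: bilinear_def intro: linear_compose_neg)
  note types = rot.torsion_types[OF L' LBR' R' B, unfolded tors]
  show "torsion_of_type g I (\<lambda>x. \<psi> (I x)) (tors L) {W1p, W1m, W2p, W2m, W3, W5}"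
    "torsion_of_type g I (\<lambda>x. \<psi> (I x)) (tors L) {W1p, W1m, W2p, W2m, W3}"
    by (rule types)+
  show "torsion_of_type g I (\<lambda>x. \<psi> (I x)) (tors L) {W1p, W1m, W2p, W3, W5}
      \<longleftrightarrow> (\<forall>x y. B x y + I12 I B x y = tr B / 3 * g x y)"
    by (rule types)
  show "torsion_of_type g I (\<lambda>x. \<psi> (I x)) (tors L) {W1p, W1m, W2m, W3, W5}
      \<longleftrightarrow> (\<forall>x y. R x y + I12 I R x y = tr R / 3 * g x y)"
    unfolding types I12_def sum_negf by (intro arg_cong[where f = All] ext) auto
  show "torsion_of_type g I (\<lambda>x. \<psi> (I x)) (tors L) {W1p, W2p, W2m, W3, W5} \<longleftrightarrow> tr B = 0"
    by (rule types)
  show "torsion_of_type g I (\<lambda>x. \<psi> (I x)) (tors L) {W1m, W2p, W2m, W3, W5} \<longleftrightarrow> tr R = 0"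
    unfolding types sum_negf by simp
  have all_I: "(\<forall>y. P y) \<longleftrightarrow> (\<forall>y. P (I y))" for P by (metis II minus_minus I_simps(3))
  \<comment> \<open>Passing from \<open>(B, R)\<close> to \<open>(- R, B)\<close> changes the
    \<open>W3\<close> equation into itself after the substitution of \<open>I y\<close> for
    \<open>y\<close>.\<close>
  have "(\<forall>x y. I1 I B x y + I2 I B x y = - R x y - I12 I (\<lambda>x y. - R x y) x y) \<longleftrightarrow>
    (\<forall>x y. I1 I B x (I y) + I2 I B x (I y) = - R x (I y) - I12 I (\<lambda>x y. - R x y) x (I y))"
    by (rule arg_cong[where f = All], rule ext, rule all_I)
  also have "\<dots> \<longleftrightarrow> (\<forall>x y. I1 I R x y + I2 I R x y = B x y - I12 I B x y)"
    unfolding I12_def I1_def I2_def II negR negB by (intro arg_cong[where f = All] ext) auto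
  finally show "torsion_of_type g I (\<lambda>x. \<psi> (I x)) (tors L) {W1p, W1m, W2p, W2m, W5}
      \<longleftrightarrow> (\<forall>x y. I1 I R x y + I2 I R x y = B x y - I12 I B x y)"
    unfolding types .
qed

end

section \<open>Symmetry of second derivatives\<close>

text \<open>The mean value theorem in the direction \<open>y\<close>; the second difference is symmetric in \<open>x\<close> and \<open>y\<close>.\<close>

lemma second_difference:
  fixes f :: "'a::real_normed_vector \<Rightarrow> real"
  assumes S: "open S" "u \<in> S" and f: "\<And>v. v \<in> S \<Longrightarrow> (f has_derivative D v) (at v)"
    and A: "((\<lambda>v. D v y) has_derivative A) (at u)" and eps: "\<epsilon> > 0"
  shows "\<exists>\<delta>>0. \<forall>t. 0 < t \<and> t < \<delta> \<longrightarrow>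
    \<bar>f (u + t *\<^sub>R x + t *\<^sub>R y) - f (u + t *\<^sub>R x) - f (u + t *\<^sub>R y) + f u - t * t * A x\<bar>
      \<le> \<epsilon> * (t * t) * (norm x + 2 * norm y)"
proof -
  obtain r where r: "r > 0" "\<And>v. norm (v - u) < r \<Longrightarrow> v \<in> S"
    using S by (metis open_dist dist_norm)
  obtain s where s: "s > 0" "\<And>v. norm (v - u) < s \<Longrightarrow> \<bar>D v y - D u y - A (v - u)\<bar> \<le> \<epsilon> * norm (v - u)"
    using A eps unfolding has_derivative_at_alt by (metis real_norm_def)
  have linA: "linear A" using A has_derivative_linear by blast
  define m where "m = norm x + norm y + 1"
  have m: "m > 0" by (simp add: m_def add_nonneg_pos)
  define \<delta> where "\<delta> = min r s / m"
  have "\<delta> > 0" using r s m by (simp add: \<delta>_def)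
  moreover have "\<bar>f (u + t *\<^sub>R x + t *\<^sub>R y) - f (u + t *\<^sub>R x) - f (u + t *\<^sub>R y) + f u - t * t * A x\<bar>
      \<le> \<epsilon> * (t * t) * (norm x + 2 * norm y)" if t: "0 < t" "t < \<delta>" for t
  proof -
    have small: "norm (a *\<^sub>R x + b *\<^sub>R y) < min r s" if "0 \<le> a" "a \<le> t" "0 \<le> b" "b \<le> t" for a b
    proof -
      have "norm (a *\<^sub>R x + b *\<^sub>R y) \<le> a * norm x + b * norm y"
        using that norm_triangle_ineq[of "a *\<^sub>R x" "b *\<^sub>R y"] by simp
      also have "\<dots> \<le> t * norm x + t * norm y" using that by (intro add_mono mult_right_mono) auto
      also have "\<dots> \<le> t * m" using t by (simp add: m_def algebra_simps)
      also have "\<dots> < min r s" using t m by (simp add: \<delta>_def pos_less_divide_eq)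
      finally show ?thesis .
    qed
    let ?\<phi> = "\<lambda>b. f (u + t *\<^sub>R x + b *\<^sub>R y) - f (u + b *\<^sub>R y)"
    have D: "((\<lambda>b. f (w + b *\<^sub>R y)) has_real_derivative D (w + b *\<^sub>R y) y) (at b)" if "w + b *\<^sub>R y \<in> S" for w b
    proof -
      have "((\<lambda>b. w + b *\<^sub>R y) has_derivative (\<lambda>h. h *\<^sub>R y)) (at b)"
        by (auto intro!: derivative_eq_intros)
      from has_derivative_compose[OF this f[OF that]] have "((\<lambda>b. f (w + b *\<^sub>R y)) has_derivative (\<lambda>h. D (w + b *\<^sub>R y) (h *\<^sub>R y))) (at b)" .
      moreover have "D (w + b *\<^sub>R y) (h *\<^sub>R y) = D (w + b *\<^sub>R y) y * h" for h
        using linear_cmul[OF has_derivative_linear[OF f[OF that]]] by simp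
      ultimately show ?thesis by (simp add: has_field_derivative_def)
    qed
    have inS: "u + t *\<^sub>R x + b *\<^sub>R y \<in> S" "u + b *\<^sub>R y \<in> S" if "0 \<le> b" "b \<le> t" for b
      using r(2)[of "u + t *\<^sub>R x + b *\<^sub>R y"] r(2)[of "u + b *\<^sub>R y"] small[of t b] small[of 0 b] that t by (simp_all add: add.assoc)
    \<comment> \<open>Applied to a first difference in the direction \<open>x\<close>, the theorem
      gives derivatives at two points with the same \<open>z\<close>; both are compared with the
      linearisation \<open>A\<close> at \<open>u\<close>.\<close>
    have "\<exists>z>0. z < t \<and> ?\<phi> t - ?\<phi> 0 = (t - 0) * (D (u + t *\<^sub>R x + z *\<^sub>R y) y - D (u + z *\<^sub>R y) y)"
      by (rule MVT2[OF t(1)]) (intro DERIV_diff D inS; simp)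
    then obtain z where z: "0 < z" "z < t" and \<phi>: "?\<phi> t - ?\<phi> 0 = t * (D (u + t *\<^sub>R x + z *\<^sub>R y) y - D (u + z *\<^sub>R y) y)"
      by auto
    let ?k = "t *\<^sub>R x + z *\<^sub>R y" and ?l = "z *\<^sub>R y"
    have b1: "\<bar>D (u + t *\<^sub>R x + z *\<^sub>R y) y - D u y - A ?k\<bar> \<le> \<epsilon> * norm ?k"
      using s(2)[of "u + t *\<^sub>R x + z *\<^sub>R y"] small[of t z] z t by (simp add: add.assoc)
    have b2: "\<bar>D (u + z *\<^sub>R y) y - D u y - A ?l\<bar> \<le> \<epsilon> * norm ?l"
      using s(2)[of "u + z *\<^sub>R y"] small[of 0 z] z t by simp
    have A: "A ?k - A ?l = t * A x"
      by (simp add: linear_add[OF linA] linear_cmul[OF linA])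
    have "norm ?k + norm ?l \<le> t * norm x + z * norm y + z * norm y"
      using norm_triangle_ineq[of "t *\<^sub>R x" "z *\<^sub>R y"] z t by simp
    also have "\<dots> \<le> t * norm x + t * norm y + t * norm y" using z by (intro add_mono mult_right_mono) auto
    finally have kl: "norm ?k + norm ?l \<le> t * (norm x + 2 * norm y)" by (simp add: algebra_simps)
    have "\<bar>(D (u + t *\<^sub>R x + z *\<^sub>R y) y - D (u + z *\<^sub>R y) y) - t * A x\<bar> \<le> \<epsilon> * (norm ?k + norm ?l)"
      using b1 b2 A by (simp add: distrib_left)
    also have "\<dots> \<le> \<epsilon> * (t * (norm x + 2 * norm y))"
      using kl eps by (simp add: mult_left_mono)
    finally have "t * \<bar>(D (u + t *\<^sub>R x + z *\<^sub>R y) y - D (u + z *\<^sub>R y) y) - t * A x\<bar> \<le> t * (\<epsilon> * (t * (norm x + 2 * norm y)))"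
      using t by (simp add: mult_left_mono)
    moreover have "f (u + t *\<^sub>R x + t *\<^sub>R y) - f (u + t *\<^sub>R x) - f (u + t *\<^sub>R y) + f u - t * t * A x
       = t * ((D (u + t *\<^sub>R x + z *\<^sub>R y) y - D (u + z *\<^sub>R y) y) - t * A x)"
      using \<phi> by (simp add: algebra_simps)
    ultimately show ?thesis using t by (simp add: abs_mult mult_ac)
  qed
  ultimately show ?thesis by blast
qed

lemma second_derivative_symmetric_real:
  fixes f :: "'a::real_normed_vector \<Rightarrow> real"
  assumes S: "open S" "u \<in> S" and f: "\<And>v. v \<in> S \<Longrightarrow> (f has_derivative D v) (at v)"
    and A: "((\<lambda>v. D v y) has_derivative A) (at u)" and A': "((\<lambda>v. D v x) has_derivative A') (at u)"
  shows "A x = A' y"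
proof (rule ccontr)
  assume ne: "A x \<noteq> A' y"
  \<comment> \<open>The sum of the two error constants, plus one to make the bound strict and
    \<open>K\<close> positive; the choice of \<open>\<epsilon>\<close> below then bounds the
    difference by half of itself.\<close>
  define K where "K = 3 * (norm x + norm y) + 1"
  have K: "K > 0" by (simp add: K_def add_nonneg_pos)
  define \<epsilon> where "\<epsilon> = \<bar>A x - A' y\<bar> / (2 * K)"
  have eps: "\<epsilon> > 0" using ne K by (simp add: \<epsilon>_def)
  obtain d1 where d1: "d1 > 0" "\<And>t. 0 < t \<Longrightarrow> t < d1 \<Longrightarrow>
    \<bar>f (u + t *\<^sub>R x + t *\<^sub>R y) - f (u + t *\<^sub>R x) - f (u + t *\<^sub>R y) + f u - t * t * A x\<bar> \<le> \<epsilon> * (t * t) * (norm x + 2 * norm y)"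
    using second_difference[OF S f A eps] by blast
  obtain d2 where d2: "d2 > 0" "\<And>t. 0 < t \<Longrightarrow> t < d2 \<Longrightarrow>
    \<bar>f (u + t *\<^sub>R y + t *\<^sub>R x) - f (u + t *\<^sub>R y) - f (u + t *\<^sub>R x) + f u - t * t * A' y\<bar> \<le> \<epsilon> * (t * t) * (norm y + 2 * norm x)"
    using second_difference[OF S f A' eps] by blast
  define t where "t = min d1 d2 / 2"
  have t: "0 < t" "t < d1" "t < d2" using d1 d2 by (auto simp: t_def)
  have comm: "u + t *\<^sub>R y + t *\<^sub>R x = u + t *\<^sub>R x + t *\<^sub>R y" by simp
  have "\<bar>t * t * A x - t * t * A' y\<bar> \<le> \<epsilon> * (t * t) * (norm x + 2 * norm y) + \<epsilon> * (t * t) * (norm y + 2 * norm x)"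
    using d1(2)[OF t(1,2)] d2(2)[OF t(1,3)] unfolding comm by linarith
  also have "\<dots> = \<epsilon> * (t * t) * (K - 1)" by (simp add: K_def algebra_simps)
  also have "\<dots> < \<epsilon> * (t * t) * K" using eps t by simp
  finally have "(t * t) * \<bar>A x - A' y\<bar> < (t * t) * (\<epsilon> * K)"
    by (simp add: abs_mult right_diff_distrib[symmetric] mult_ac)
  then have "\<bar>A x - A' y\<bar> < \<epsilon> * K" using t by simp
  then show False using K ne by (simp add: \<epsilon>_def)
qed

lemma second_derivative_symmetric:
  fixes f :: "'a::real_normed_vector \<Rightarrow> real ^ 'n"
  assumes S: "open S" "u \<in> S" and f: "\<And>v. v \<in> S \<Longrightarrow> (f has_derivative D v) (at v)"
    and A: "((\<lambda>v. D v y) has_derivative A) (at u)" and A': "((\<lambda>v. D v x) has_derivative A') (at u)"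
  shows "A x = A' y"
proof -
  note nth = bounded_linear.has_derivative[OF bounded_linear_vec_nth]
  have "A x $ k = A' y $ k" for k
    by (rule second_derivative_symmetric_real[OF S nth[OF f] nth[OF A] nth[OF A']])
  then show ?thesis by (simp add: vec_eq_iff)
qed

section \<open>Derivatives in charts\<close>

text \<open>\<open>dir_deriv\<close> is total and does not record differentiability; in relational
  form the rules of calculus carry it along.\<close>

definition has_dir_deriv :: "('a, 'n::finite) chart \<Rightarrow> ('a \<Rightarrow> 'f::real_normed_vector) \<Rightarrow> 'a \<Rightarrow> (real ^ 'n \<Rightarrow> 'f) \<Rightarrow> bool" where
  "has_dir_deriv c F p F' \<longleftrightarrow> (in_coords c F has_derivative F') (at (cmap c p))"

lemma has_dir_deriv_eq: "has_dir_deriv c F p F' \<Longrightarrow> dir_deriv c F p = F'"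
  unfolding has_dir_deriv_def dir_deriv_def fun_eq_iff by (metis frechet_derivative_at)

lemma has_dir_deriv_linear: "has_dir_deriv c F p F' \<Longrightarrow> linear F'"
  unfolding has_dir_deriv_def by (rule has_derivative_linear)

lemma differentiable_has_dir_deriv: "in_coords c F differentiable (at (cmap c p)) \<Longrightarrow> has_dir_deriv c F p (dir_deriv c F p)"
  unfolding has_dir_deriv_def dir_deriv_def[abs_def] by (metis eta_contract_eq frechet_derivative_works)

lemma smooth_in_has_dir_deriv:
  assumes "smooth_in c U F" "p \<in> U"
  shows "has_dir_deriv c F p (dir_deriv c F p)"
proof -
  have "Ck_on (Suc 0) (cmap c ` U) (in_coords c F)"
    using assms(1) unfolding smooth_in_def smooth_on_def by blast
  then have "in_coords c F differentiable (at (cmap c p))" using assms(2) by simp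
  then show ?thesis by (rule differentiable_has_dir_deriv)
qed

lemma smooth_in_has_dir_deriv2:
  assumes "smooth_in c U F" "p \<in> U"
  shows "((\<lambda>u. frechet_derivative (in_coords c F) (at u) y) has_derivative
     frechet_derivative (\<lambda>u. frechet_derivative (in_coords c F) (at u) y) (at (cmap c p))) (at (cmap c p))"
proof -
  have "Ck_on (Suc (Suc 0)) (cmap c ` U) (in_coords c F)"
    using assms(1) unfolding smooth_in_def smooth_on_def by blast
  then have "(\<lambda>u. frechet_derivative (in_coords c F) (at u) y) differentiable (at (cmap c p))" using assms(2) by simp
  then show ?thesis by (simp add: frechet_derivative_works)
qed

lemma chart_inv: "is_chart c \<Longrightarrow> q \<in> cdom c \<Longrightarrow> inv_into (cdom c) (cmap c) (cmap c q) = q"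
  unfolding is_chart_def homeomorphism_def by auto

lemma chart_open_image:
  assumes "is_chart c" "open U" "U \<subseteq> cdom c"
  shows "open (cmap c ` U)"
proof -
  have "openin (top_of_set (cmap c ` cdom c)) (cmap c ` U)"
    by (rule homeomorphism_imp_open_map) (use assms in \<open>auto simp: is_chart_def intro: open_openin_trans openin_open_eq\<close>)
  then show ?thesis using assms(1) by (auto simp: is_chart_def openin_open_eq)
qed

lemma in_coords_at: "is_chart c \<Longrightarrow> q \<in> cdom c \<Longrightarrow> in_coords c F (cmap c q) = F q"
  by (simp add: in_coords_def chart_inv)

lemma has_dir_deriv_cong:
  assumes c: "is_chart c" and U: "open U" "p \<in> U" "U \<subseteq> cdom c" and eq: "\<And>q. q \<in> U \<Longrightarrow> F q = G q" and F: "has_dir_deriv c F p F'"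
  shows "has_dir_deriv c G p F'"
  unfolding has_dir_deriv_def
proof (rule has_derivative_transform_within_open)
  show "(in_coords c F has_derivative F') (at (cmap c p))" using F by (simp add: has_dir_deriv_def)
  show "open (cmap c ` U)" by (rule chart_open_image[OF c U(1,3)])
  show "cmap c p \<in> cmap c ` U" using U by blast
  show "in_coords c F u = in_coords c G u" if "u \<in> cmap c ` U" for u
    using that U(3) eq by (auto simp: in_coords_at[OF c] subset_iff)
qed

lemma has_dir_deriv_add: "has_dir_deriv c F p F' \<Longrightarrow> has_dir_deriv c G p G' \<Longrightarrow> has_dir_deriv c (\<lambda>q. F q + G q) p (\<lambda>h. F' h + G' h)"
  unfolding has_dir_deriv_def in_coords_def by (rule has_derivative_add)

lemma has_dir_deriv_linear_image:
  fixes F :: "'a \<Rightarrow> 'e::euclidean_space"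
  shows "linear T \<Longrightarrow> has_dir_deriv c F p F' \<Longrightarrow> has_dir_deriv c (\<lambda>q. T (F q)) p (\<lambda>h. T (F' h))"
  unfolding has_dir_deriv_def in_coords_def
  by (rule bounded_linear.has_derivative) (simp add: linear_conv_bounded_linear)

lemma has_dir_deriv_bilinear:
  fixes F :: "'a::topological_space \<Rightarrow> 'e::euclidean_space" and G :: "'a \<Rightarrow> 'f::euclidean_space"
  assumes c: "is_chart c" "p \<in> cdom c" and T: "bilinear T" and "has_dir_deriv c F p F'" "has_dir_deriv c G p G'"
  shows "has_dir_deriv c (\<lambda>q. T (F q) (G q)) p (\<lambda>h. T (F p) (G' h) + T (F' h) (G p))"
  using bounded_bilinear.FDERIV[of T "in_coords c F" F' "cmap c p" UNIV "in_coords c G" G'] assms(4,5) T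
  unfolding has_dir_deriv_def bilinear_conv_bounded_bilinear in_coords_at[OF c] by (simp add: in_coords_def)

lemma bilinear_inner: "bilinear (\<bullet>)"
  unfolding bilinear_def by (auto intro!: linearI simp: inner_add_left inner_add_right)

lemma bilinear_cross0: "bilinear cross0"
  unfolding bilinear_def by (auto intro!: linearI simp: vec_eq_iff forall_7 pl_def algebra_simps)

lemma bilinear_times: "bilinear ((*) :: real \<Rightarrow> real \<Rightarrow> real)"
  unfolding bilinear_def by (auto intro!: linearI simp: algebra_simps)

lemmas has_dir_deriv_inner = has_dir_deriv_bilinear[OF _ _ bilinear_inner]

lemma has_dir_deriv_phi0:
  assumes c: "is_chart c" "p \<in> cdom c" and "has_dir_deriv c F p F'" "has_dir_deriv c G p G'" "has_dir_deriv c H p H'"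
  shows "has_dir_deriv c (\<lambda>q. phi0 (F q) (G q) (H q)) p
    (\<lambda>h. phi0 (F' h) (G p) (H p) + phi0 (F p) (G' h) (H p) + phi0 (F p) (G p) (H' h))"
  using has_dir_deriv_inner[OF c has_dir_deriv_bilinear[OF c bilinear_cross0 assms(3,4)] assms(5)]
  by (simp add: inner_cross0 inner_add_left algebra_simps)

lemma has_dir_deriv_star0:
  assumes c: "is_chart c" "p \<in> cdom c" and A: "has_dir_deriv c A p A'" and F: "has_dir_deriv c F p F'" "has_dir_deriv c G p G'" "has_dir_deriv c H p H'"
  shows "has_dir_deriv c (\<lambda>q. star0 (A q) (F q) (G q) (H q)) p
    (\<lambda>h. star0 (A' h) (F p) (G p) (H p) + star0 (A p) (F' h) (G p) (H p) + star0 (A p) (F p) (G' h) (H p) + star0 (A p) (F p) (G p) (H' h))"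
proof -
  note dc = has_dir_deriv_bilinear[OF c bilinear_cross0] and di = has_dir_deriv_inner[OF c]
  note dm = has_dir_deriv_bilinear[OF c bilinear_times]
  have *: "star0 a b c d = - 1 * (cross0 a b \<bullet> cross0 c d) + ((a \<bullet> c) * (b \<bullet> d) + - 1 * ((a \<bullet> d) * (b \<bullet> c)))" for a b c d
    by (simp add: star0_cross)
  have m1: "linear (\<lambda>x :: real. - 1 * x)" by (rule linearI) simp_all
  note rule1 = has_dir_deriv_linear_image[OF m1]
  have "has_dir_deriv c (\<lambda>q. star0 (A q) (F q) (G q) (H q)) p
    (\<lambda>h. - 1 * (cross0 (A p) (F p) \<bullet> (cross0 (G p) (H' h) + cross0 (G' h) (H p)) + (cross0 (A p) (F' h) + cross0 (A' h) (F p)) \<bullet> cross0 (G p) (H p))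
     + (((A p \<bullet> G p) * (F p \<bullet> H' h + F' h \<bullet> H p) + (A p \<bullet> G' h + A' h \<bullet> G p) * (F p \<bullet> H p))
        + - 1 * ((A p \<bullet> H p) * (F p \<bullet> G' h + F' h \<bullet> G p) + (A p \<bullet> H' h + A' h \<bullet> H p) * (F p \<bullet> G p))))"
    unfolding * by (intro has_dir_deriv_add rule1 di dc dm A F)
  then show ?thesis
    by (simp add: star0_cross inner_add_left inner_add_right algebra_simps)
qed

lemma has_dir_deriv_linear_param:
  fixes M :: "'a::topological_space \<Rightarrow> real ^ 'm \<Rightarrow> 'e::euclidean_space"
  assumes c: "is_chart c" and U: "open U" "p \<in> U" "U \<subseteq> cdom c" and lin: "\<And>q. q \<in> U \<Longrightarrow> linear (M q)"
    and M: "\<And>v. has_dir_deriv c (\<lambda>q. M q v) p (\<lambda>h. M' h v)"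
  shows "linear (M' h)"
proof (rule linearI)
  have add: "has_dir_deriv c (\<lambda>q. M q (x + y)) p (\<lambda>h. M' h x + M' h y)" for x y
    by (rule has_dir_deriv_cong[OF c U _ has_dir_deriv_add[OF M M]]) (simp add: linear_add[OF lin])
  show "M' h (x + y) = M' h x + M' h y" for x y
    using has_dir_deriv_eq[OF add] has_dir_deriv_eq[OF M] by metis
  have cm: "linear (\<lambda>v :: 'e. r *\<^sub>R v)" for r by (rule linearI) (simp_all add: algebra_simps)
  have mul: "has_dir_deriv c (\<lambda>q. M q (r *\<^sub>R x)) p (\<lambda>h. r *\<^sub>R M' h x)" for r x
    by (rule has_dir_deriv_cong[OF c U _ has_dir_deriv_linear_image[OF cm M]]) (simp add: linear_cmul[OF lin])
  show "M' h (r *\<^sub>R x) = r *\<^sub>R M' h x" for r x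
    using has_dir_deriv_eq[OF mul] has_dir_deriv_eq[OF M] by metis
qed

text \<open>Product rule for a linear map applied to a vector. Only the values of the map at
  constant vectors are assumed differentiable, so the vector is expanded in the standard
  basis.\<close>

lemma has_dir_deriv_apply:
  fixes M :: "'a::topological_space \<Rightarrow> real ^ 'm \<Rightarrow> 'e::euclidean_space"
  assumes c: "is_chart c" and U: "open U" "p \<in> U" "U \<subseteq> cdom c" and lin: "\<And>q. q \<in> U \<Longrightarrow> linear (M q)"
    and M: "\<And>v. has_dir_deriv c (\<lambda>q. M q v) p (\<lambda>h. M' h v)" and w: "has_dir_deriv c w p w'"
  shows "has_dir_deriv c (\<lambda>q. M q (w q)) p (\<lambda>h. M' h (w p) + M p (w' h))"
proof -
  have lexp: "f v = (\<Sum>j\<in>UNIV. v $ j *\<^sub>R f (axis j 1))" if "linear f" for f :: "real ^ 'm \<Rightarrow> 'e" and v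
  proof -
    have "v = (\<Sum>j\<in>UNIV. v $ j *\<^sub>R axis j 1)"
      using basis_expansion[of v] by (simp add: scalar_mult_eq_scaleR)
    then show ?thesis using that by (metis (no_types, lifting) linear_cmul linear_sum sum.cong)
  qed
  have p: "p \<in> cdom c" using U by blast
  have sc: "bilinear ((*\<^sub>R) :: real \<Rightarrow> 'e \<Rightarrow> 'e)"
    unfolding bilinear_def by (auto intro!: linearI simp: algebra_simps)
  have nth: "linear (\<lambda>v :: real ^ 'm. v $ j)" for j by (rule linearI) simp_all
  have "has_dir_deriv c (\<lambda>q. w q $ j *\<^sub>R M q (axis j 1)) p (\<lambda>h. w p $ j *\<^sub>R M' h (axis j 1) + w' h $ j *\<^sub>R M p (axis j 1))" for j
    by (rule has_dir_deriv_bilinear[OF c p sc has_dir_deriv_linear_image[OF nth w] M])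
  then have "has_dir_deriv c (\<lambda>q. \<Sum>j\<in>UNIV. w q $ j *\<^sub>R M q (axis j 1)) p (\<lambda>h. \<Sum>j\<in>UNIV. w p $ j *\<^sub>R M' h (axis j 1) + w' h $ j *\<^sub>R M p (axis j 1))"
    unfolding has_dir_deriv_def in_coords_def by (intro has_derivative_sum)
  moreover have "linear (M' h)" for h
    by (rule has_dir_deriv_linear_param[OF c U lin M])
  then have "(\<lambda>h. \<Sum>j\<in>UNIV. w p $ j *\<^sub>R M' h (axis j 1) + w' h $ j *\<^sub>R M p (axis j 1)) = (\<lambda>h. M' h (w p) + M p (w' h))"
    using lexp lin[OF U(2)] by (auto simp: sum.distrib)
  ultimately have "has_dir_deriv c (\<lambda>q. \<Sum>j\<in>UNIV. w q $ j *\<^sub>R M q (axis j 1)) p (\<lambda>h. M' h (w p) + M p (w' h))" by simp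
  then show ?thesis
    by (rule has_dir_deriv_cong[OF c U, rotated]) (use lexp lin in metis)
qed

lemma has_dir_deriv_compose:
  assumes d: "is_chart d" and c: "is_chart c" and V: "open V" "p \<in> V" "V \<subseteq> cdom d" "f ` V \<subseteq> cdom c"
    and f: "has_dir_deriv d (cmap c \<circ> f) p J" and G: "has_dir_deriv c G (f p) G'"
  shows "has_dir_deriv d (\<lambda>q. G (f q)) p (\<lambda>h. G' (J h))"
proof -
  have eq: "in_coords d (cmap c \<circ> f) (cmap d p) = cmap c (f p)"
    using V by (auto simp: in_coords_at[OF d])
  have "has_dir_deriv d (\<lambda>q. in_coords c G (cmap c (f q))) p (\<lambda>h. G' (J h))"
    unfolding has_dir_deriv_def
    using has_derivative_compose[OF f[unfolded has_dir_deriv_def], of "in_coords c G" G'] G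
    unfolding eq has_dir_deriv_def by (simp add: in_coords_def[of d] o_def)
  then show ?thesis
    by (rule has_dir_deriv_cong[OF d V(1-3), rotated]) (use V(4) in \<open>auto simp: in_coords_at[OF c]\<close>)
qed

section \<open>Local frames of \<open>G\<^sub>2\<close>-manifolds\<close>

lemma metric_isometry_bij:
  fixes E :: "real ^ 'n \<Rightarrow> real ^ 'n"
  assumes "metric_form b" "linear E" "\<And>x y. E x \<bullet> E y = b x y"
  shows "inj E" "surj E"
proof -
  show "inj E"
  proof (rule injI)
    fix x y assume "E x = E y"
    then have "b x z = b y z" for z by (simp flip: assms(3))
    then show "x = y" by (rule metric_form_eqI[OF assms(1)])
  qed
  then show "surj E" using assms(2) by (simp add: linear_injective_imp_surjective)
qed

text \<open>\<open>star0\<close> can be expressed through the inner product and the cross product, hence through the metric and \<open>phi0\<close>.\<close>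

lemma star0_unique:
  fixes b :: "7 form2"
  assumes b: "metric_form b" and E: "linear E" "\<And>x y. E x \<bullet> E y = b x y" and E': "linear E'" "\<And>x y. E' x \<bullet> E' y = b x y"
    and eq: "\<And>x y z. phi0 (E x) (E y) (E z) = phi0 (E' x) (E' y) (E' z)"
  shows "star0 (E x) (E y) (E z) (E w) = star0 (E' x) (E' y) (E' z) (E' w)"
proof -
  obtain m where m: "cross0 (E x) (E y) = E m"
    using metric_isometry_bij(2)[OF b E] by (metis surjD)
  have "E' m = cross0 (E' x) (E' y)"
  proof -
    have "E' m \<bullet> v = cross0 (E' x) (E' y) \<bullet> v" for v
    proof -
      obtain c where v: "v = E' c" using metric_isometry_bij(2)[OF b E'] by (metis surjD)
      have "cross0 (E' x) (E' y) \<bullet> E' c = cross0 (E x) (E y) \<bullet> E c" by (simp add: inner_cross0 eq)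
      also have "\<dots> = E' m \<bullet> E' c" by (simp add: m E E')
      finally show ?thesis by (simp add: v)
    qed
    then show ?thesis using vector_eq_rdot by blast
  qed
  moreover have "cross0 (E z) (E w) \<bullet> E m = cross0 (E' z) (E' w) \<bullet> E' m" by (simp add: inner_cross0 eq)
  ultimately show ?thesis by (simp add: star0_cross m E E' inner_commute)
qed

lemma phi0_frame_coords: "phi0 (frame_coords b e x) (frame_coords b e y) (frame_coords b e z) = g2_form b e x y z"
  by (simp add: phi0_def g2_form_def frame_coords_def wedge3_def wedge2_def)

text \<open>The selected frame and \<open>E\<close> induce the same metric and the same three-form,
  hence by \<open>star0_unique\<close> the same four-form.\<close>

lemma g2_star_eq:
  assumes b: "metric_form b" and E: "linear E" "\<And>x y. E x \<bullet> E y = b x y" and f: "\<And>x y z. phi0 (E x) (E y) (E z) = f x y z"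
    and ex: "\<exists>e. orthonormal_basis b e \<and> f = g2_form b e"
  shows "g2_star b f x y z w = star0 (E x) (E y) (E z) (E w)"
proof -
  define e where "e = (SOME e. orthonormal_basis b e \<and> f = g2_form b e)"
  have e: "orthonormal_basis b e" "f = g2_form b e" using someI_ex[OF ex] by (auto simp: e_def)
  note bil = metric_formD(1)[OF b]
  have "star0 (frame_coords b e x) (frame_coords b e y) (frame_coords b e z) (frame_coords b e w) = star0 (E x) (E y) (E z) (E w)"
    by (rule star0_unique[OF b linear_frame_coords[OF bil] frame_coords_isometry[OF bil e(1)] E])
      (simp add: phi0_frame_coords f e(2))
  moreover have "g2_star b f x y z w = star0 (frame_coords b e x) (frame_coords b e y) (frame_coords b e z) (frame_coords b e w)"
    by (simp add: g2_star_def e_def[symmetric] star0_def frame_coords_def wedge4_def wedge3_def wedge2_def)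
  ultimately show ?thesis by simp
qed

lemma riemannian_metric_form:
  assumes "riemannian_manifold N" "c \<in> charts N" "q \<in> cdom c"
  shows "metric_form (metric N c q)"
  using assms unfolding riemannian_manifold_def metric_form_def by blast

lemma riemannian_chart: "riemannian_manifold N \<Longrightarrow> c \<in> charts N \<Longrightarrow> is_chart c"
  unfolding riemannian_manifold_def smooth_atlas_def by blast

lemma has_dir_deriv_vec:
  assumes "\<And>i. has_dir_deriv c (f i) p (f' i)"
  shows "has_dir_deriv c (\<lambda>q. (\<chi> i. f i q) :: real ^ 'b::finite) p (\<lambda>h. \<chi> i. f' i h)"
proof -
  have *: "(\<chi> i. v i) = (\<Sum>i\<in>UNIV. v i *\<^sub>R axis i 1)" for v :: "'b::finite \<Rightarrow> real"
    by (simp add: vec_eq_iff axis_def if_distrib cong: if_cong)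
  show ?thesis
    using assms unfolding * has_dir_deriv_def in_coords_def
    by (intro has_derivative_sum has_derivative_scaleR_left)
qed

text \<open>\<open>E q\<close> sends a tangent vector at \<open>q\<close> to its components in a local \<open>G\<^sub>2\<close>-frame.\<close>

locale g2_local_frame =
  fixes N :: "('a::topological_space, 7) riem" and \<phi> :: "('a, 7) chart \<Rightarrow> 'a \<Rightarrow> 7 form3"
    and c :: "('a, 7) chart" and q0 :: 'a and U :: "'a set" and E :: "'a \<Rightarrow> real ^ 7 \<Rightarrow> real ^ 7"
    and E' :: "real ^ 7 \<Rightarrow> real ^ 7 \<Rightarrow> real ^ 7"
  assumes chart: "is_chart c" and U: "open U" "q0 \<in> U" "U \<subseteq> cdom c"
    and metric: "q \<in> U \<Longrightarrow> metric_form (metric N c q)"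
    and linear_E: "q \<in> U \<Longrightarrow> linear (E q)" and E_inner: "q \<in> U \<Longrightarrow> E q x \<bullet> E q y = metric N c q x y"
    and E_phi: "q \<in> U \<Longrightarrow> phi0 (E q x) (E q y) (E q z) = \<phi> c q x y z"
    and E_star: "q \<in> U \<Longrightarrow> star_phi N \<phi> c q x y z w = star0 (E q x) (E q y) (E q z) (E q w)"
    and E_deriv: "has_dir_deriv c (\<lambda>q. E q y) q0 (\<lambda>h. E' h y)"

lemma g2_local_frame_exists:
  assumes N: "riemannian_manifold N" and \<phi>: "g2_structure N \<phi>" and c: "c \<in> charts N" "q0 \<in> cdom c"
    and n: "metric N c q0 n n = 1"
  obtains U E E' where "g2_local_frame N \<phi> c q0 U E E'" "E q0 n = e0"
proof -
  obtain U and e :: "7 \<Rightarrow> 'a \<Rightarrow> real ^ 7" where Ue: "open U \<and> q0 \<in> U \<and> U \<subseteq> cdom c \<and> (\<forall>i. smooth_in c U (e i)) \<and>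
        (\<forall>q\<in>U. orthonormal_basis (metric N c q) (\<lambda>i. e i q) \<and> \<phi> c q = g2_form (metric N c q) (\<lambda>i. e i q))"
    using bspec[OF bspec[OF conjunct1[OF \<phi>[unfolded g2_structure_def]] c(1)] c(2)] by (elim exE) (rule that)
  then have U: "open U" "q0 \<in> U" "U \<subseteq> cdom c" and e: "\<And>i. smooth_in c U (e i)"
    "\<And>q. q \<in> U \<Longrightarrow> orthonormal_basis (metric N c q) (\<lambda>i. e i q)"
    "\<And>q. q \<in> U \<Longrightarrow> \<phi> c q = g2_form (metric N c q) (\<lambda>i. e i q)"
    by simp_all
  note ch = riemannian_chart[OF N c(1)]
  have met: "metric_form (metric N c q)" if "q \<in> U" for q
    using riemannian_metric_form[OF N c(1)] that U by blast
  note bil = metric_formD(1)[OF met]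
  define E0 where "E0 q = frame_coords (metric N c q) (\<lambda>i. e i q)" for q
  have iso0: "E0 q x \<bullet> E0 q y = metric N c q x y" if "q \<in> U" for q x y
    unfolding E0_def by (rule frame_coords_isometry[OF bil[OF that] e(2)[OF that]])
  \<comment> \<open>One constant \<open>T\<close> keeps the frame smooth but aligns it with
    \<open>n\<close> at \<open>q0\<close> only. The normal therefore moves relative to the frame,
    and its derivative has to be computed later.\<close>
  obtain T where T: "g2_map T" "T (E0 q0 n) = e0"
    using g2_transitive[of "E0 q0 n"] iso0[OF U(2)] n by metis
  have Tl: "linear T" using T by (simp add: g2_map_def)
  define E where "E q x = T (E0 q x)" for q x
  have lin: "linear (E q)" if "q \<in> U" for q
    unfolding E_def[abs_def] E0_def using linear_compose[OF linear_frame_coords[OF bil[OF that]] Tl] by (simp add: o_def)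
  have iso: "E q x \<bullet> E q y = metric N c q x y" if "q \<in> U" for q x y
    using T(1) iso0[OF that] by (simp add: E_def g2_map_def)
  have ph: "phi0 (E q x) (E q y) (E q z) = \<phi> c q x y z" if "q \<in> U" for q x y z
    using T(1) by (simp add: E_def g2_map_def E0_def phi0_frame_coords e(3)[OF that])
  have st: "star_phi N \<phi> c q x y z w = star0 (E q x) (E q y) (E q z) (E q w)" if "q \<in> U" for q x y z w
    unfolding star_phi_def using e(2,3)[OF that]
    by (intro g2_star_eq met[OF that] lin[OF that] iso[OF that] ph[OF that]) blast
  have "\<exists>D. has_dir_deriv c (\<lambda>q. metric N c q (e i q) y) q0 D" for i y
  proof
    show "has_dir_deriv c (\<lambda>q. metric N c q (e i q) y) q0
     (\<lambda>h. dir_deriv c (\<lambda>q. metric N c q (e i q0) y) q0 h + metric N c q0 (dir_deriv c (e i) q0 h) y)"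
  proof (rule has_dir_deriv_apply[OF ch U, where M = "\<lambda>q v. metric N c q v y"])
    show "linear (\<lambda>v. metric N c q v y)" if "q \<in> U" for q using bil[OF that] by (simp add: bilinear_def)
    show "has_dir_deriv c (\<lambda>q. metric N c q v y) q0 (\<lambda>h. dir_deriv c (\<lambda>q. metric N c q v y) q0 h)" for v
      using smooth_in_has_dir_deriv[of c "cdom c"] N c unfolding riemannian_manifold_def by blast
    show "has_dir_deriv c (e i) q0 (dir_deriv c (e i) q0)"
      by (rule smooth_in_has_dir_deriv[OF e(1) U(2)])
  qed
  qed
  then obtain D0 where "\<And>i y. has_dir_deriv c (\<lambda>q. metric N c q (e i q) y) q0 (D0 i y)" by metis
  then have "has_dir_deriv c (\<lambda>q. \<chi> i. metric N c q (e i q) y) q0 (\<lambda>h. \<chi> i. D0 i y h)" for y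
    by (intro has_dir_deriv_vec)
  from has_dir_deriv_linear_image[OF Tl this]
  have "\<exists>D. has_dir_deriv c (\<lambda>q. E q y) q0 D" for y
    unfolding E_def E0_def frame_coords_def by (rule exI[of "has_dir_deriv c (\<lambda>q. T (\<chi> i. metric N c q (e i q) y)) q0"])
  then obtain D where D: "\<And>y. has_dir_deriv c (\<lambda>q. E q y) q0 (D y)" by metis
  have "g2_local_frame N \<phi> c q0 U E (\<lambda>h y. D y h)"
    by (rule g2_local_frame.intro) (rule ch U met lin iso ph st D; (assumption)?)+
  then show ?thesis using that T(2) by (simp add: E_def)
qed

context g2_local_frame
begin

lemma q0: "q0 \<in> cdom c" using U by blast

abbreviation "E0 \<equiv> E q0"
abbreviation "\<Gamma> \<equiv> levi_civita N c q0"

lemmas linear_E0 = linear_E[OF U(2)]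

lemma inj_E: "E0 x = E0 y \<Longrightarrow> x = y" and surj_E: "\<exists>x. E0 x = v"
  using metric_isometry_bij[OF metric[OF U(2)] linear_E0 E_inner[OF U(2)]] by (auto dest: injD) (metis surjD)

definition Einv :: "real ^ 7 \<Rightarrow> real ^ 7" where "Einv v = (SOME x. E0 x = v)"

lemma E_Einv: "E0 (Einv v) = v" unfolding Einv_def using surj_E by (rule someI_ex)

lemma Einv_E: "Einv (E0 x) = x" by (rule inj_E) (rule E_Einv)

lemma linear_Einv: "linear Einv"
  by (rule linearI; rule inj_E) (simp_all add: E_Einv linear_add[OF linear_E0] linear_cmul[OF linear_E0])

lemma linear_E': "linear (E' h)" "linear (\<lambda>h. E' h y)"
  using has_dir_deriv_linear_param[OF chart U linear_E E_deriv] has_dir_deriv_linear[OF E_deriv] by blast+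

lemma metric_deriv: "dir_deriv c (\<lambda>q. metric N c q y z) q0 h = E0 y \<bullet> E' h z + E' h y \<bullet> E0 z"
proof -
  have "has_dir_deriv c (\<lambda>q. metric N c q y z) q0 (\<lambda>h. E0 y \<bullet> E' h z + E' h y \<bullet> E0 z)"
    by (rule has_dir_deriv_cong[OF chart U _ has_dir_deriv_inner[OF chart q0 E_deriv E_deriv]]) (rule E_inner)
  from has_dir_deriv_eq[OF this] show ?thesis by simp
qed

lemma onb_Einv: "orthonormal_basis (metric N c q0) (\<lambda>i. Einv (axis i 1))"
  unfolding orthonormal_basis_def E_inner[OF U(2), symmetric] E_Einv by (simp add: inner_axis_axis)

lemma connection: "connection_form (metric N c q0) (\<lambda>h y z. dir_deriv c (\<lambda>q. metric N c q y z) q0 h) \<Gamma>"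
proof -
  have "trilinear (\<lambda>h y z. dir_deriv c (\<lambda>q. metric N c q y z) q0 h)"
    unfolding trilinear_def metric_deriv
    by (auto intro!: linearI simp: linear_add[OF linear_E'(1)] linear_add[OF linear_E'(2)] linear_cmul[OF linear_E'(1)] linear_cmul[OF linear_E'(2)]
      linear_add[OF linear_E0] linear_cmul[OF linear_E0] inner_add_left inner_add_right algebra_simps)
  moreover have "dir_deriv c (\<lambda>q. metric N c q y z) q0 h = dir_deriv c (\<lambda>q. metric N c q z y) q0 h" for h y z
    unfolding metric_deriv by (simp add: inner_commute)
  ultimately obtain G where G: "connection_form (metric N c q0) (\<lambda>h y z. dir_deriv c (\<lambda>q. metric N c q y z) q0 h) G"
    using connection_form_exists[OF metric[OF U(2)] onb_Einv] by blast
  then show ?thesis using levi_civita_eq[OF metric[OF U(2)] G] by simp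
qed

lemma bilinear_connection: "bilinear \<Gamma>" and connection_sym: "\<Gamma> x y = \<Gamma> y x"
  using connection unfolding connection_form_def by blast+

text \<open>The matrix of connection one-forms of the frame.\<close>

definition W :: "real ^ 7 \<Rightarrow> real ^ 7 \<Rightarrow> real ^ 7" where
  "W h v = E' h (Einv v) - E0 (\<Gamma> h (Einv v))"

text \<open>The Christoffel term is what covariant differentiation subtracts again. Tensors with
  constant coefficients in the frame thus have covariant derivatives involving \<open>W\<close>
  alone.\<close>

lemma E'_eq: "E' h y = E0 (\<Gamma> h y) + W h (E0 y)"
  by (simp add: W_def Einv_E)

lemma skew_W: "skew_map (W h)"
  unfolding skew_map_def
proof (intro conjI allI)
  have "linear (\<Gamma> h)" using bilinear_connection by (simp add: bilinear_def)
  then show "linear (W h)"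
    unfolding W_def by (intro linear_compose_sub linear_compose[OF linear_Einv linear_E'(1), unfolded o_def]
       linear_compose[OF linear_compose[OF linear_Einv _] linear_E0, unfolded o_def])
  fix x y
  have "E0 (Einv x) \<bullet> E' h (Einv y) + E' h (Einv x) \<bullet> E0 (Einv y)
     = E0 (\<Gamma> h (Einv x)) \<bullet> E0 (Einv y) + E0 (Einv x) \<bullet> E0 (\<Gamma> h (Einv y))"
    using connection unfolding connection_form_def metric_deriv E_inner[OF U(2)] by blast
  then show "W h x \<bullet> y = - (x \<bullet> W h y)"
    by (simp add: W_def E_Einv inner_diff_left inner_diff_right)
qed

definition \<rho> :: "real ^ 7 \<Rightarrow> real ^ 7" where "\<rho> h = rho0 (W h)"

lemma nabla_phi: "nabla3 N \<phi> c q0 h x y z = star0 (\<rho> h) (E0 x) (E0 y) (E0 z)"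
proof -
  have "has_dir_deriv c (\<lambda>q. \<phi> c q x y z) q0
    (\<lambda>h. phi0 (E' h x) (E0 y) (E0 z) + phi0 (E0 x) (E' h y) (E0 z) + phi0 (E0 x) (E0 y) (E' h z))"
    by (rule has_dir_deriv_cong[OF chart U _ has_dir_deriv_phi0[OF chart q0 E_deriv E_deriv E_deriv]]) (rule E_phi)
  from has_dir_deriv_eq[OF this] show ?thesis
    unfolding nabla3_def Let_def \<rho>_def skew_map_phi0[OF skew_W, symmetric] E_phi[OF U(2), symmetric]
    by (simp add: E'_eq linear_add[OF phi0_linear(1)] linear_add[OF phi0_linear(2)] linear_add[OF phi0_linear(3)])
qed

text \<open>The contraction constant 24 divided by 3! is cancelled by the factor 1/4 in
  \<open>r_bar\<close>.\<close>

lemma r_bar_eq: "r_bar N \<phi> c q0 h y = \<rho> h \<bullet> E0 y"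
proof -
  have *: "trilinear (\<lambda>x y z. star0 u (E0 x) (E0 y) (E0 z))" for u
    unfolding trilinear_def
    by (intro conjI allI linear_compose[OF linear_E0 star0_linear(2), unfolded o_def]
      linear_compose[OF linear_E0 star0_linear(3), unfolded o_def] linear_compose[OF linear_E0 star0_linear(4), unfolded o_def])
  have "inner_form3 (metric N c q0) (\<lambda>x y z. star0 (\<rho> h) (E0 x) (E0 y) (E0 z)) (\<lambda>x y z. star0 (E0 w) (E0 x) (E0 y) (E0 z)) = 4 * (\<rho> h \<bullet> E0 w)" for w
    unfolding inner_form3_onb[OF metric[OF U(2)] onb_Einv * *] E_Einv star0_contraction by simp
  moreover have "nabla3 N \<phi> c q0 h = (\<lambda>x y z. star0 (\<rho> h) (E0 x) (E0 y) (E0 z))"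
    "star_phi N \<phi> c q0 y = (\<lambda>x y' z. star0 (E0 y) (E0 x) (E0 y') (E0 z))"
    by (simp_all add: fun_eq_iff nabla_phi E_star[OF U(2)])
  ultimately show ?thesis unfolding r_bar_def by simp
qed

end

section \<open>Hypersurfaces\<close>

lemma cross_product_eq:
  assumes b: "metric_form b" and E: "linear E" "\<And>x y. E x \<bullet> E y = b x y" and f: "\<And>x y z. phi0 (E x) (E y) (E z) = f x y z"
    and w: "E w = cross0 (E x) (E y)"
  shows "cross_product b f x y = w"
  unfolding cross_product_def
proof (rule the_equality)
  show w': "\<forall>z. b w z = f x y z" by (simp flip: E(2) f add: w inner_cross0)
  show "v = w" if "\<forall>z. b v z = f x y z" for v
    by (rule metric_form_eqI[OF b]) (simp add: that w')
qed

text \<open>The frame is chosen such that its zeroth vector at \<open>\<iota> p\<close> is the normal.\<close>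

locale hypersurface_point = g2_local_frame N \<phi> c "\<iota> p" U E E'
  for N :: "('a::topological_space, 7) riem" and \<phi> c U E E' and \<iota> :: "'b::topological_space \<Rightarrow> 'a" and p +
  fixes A :: "('b, 6) chart set" and d :: "('b, 6) chart" and n :: "('a, 7) chart \<Rightarrow> 'b \<Rightarrow> real ^ 7"
  assumes N: "riemannian_manifold N" and g2: "g2_structure N \<phi>" and hyp: "hypersurface N A \<iota>" and unit: "unit_normal_field N A \<iota> n"
    and d: "d \<in> A" "p \<in> cdom d" and amb_p: "amb N \<iota> p = c" and c: "c \<in> charts N" and E_n: "E (\<iota> p) (n c p) = e0"
begin

definition "V = cdom d \<inter> \<iota> -` U"
definition "J q y = dir_deriv d (cmap c \<circ> \<iota>) q y"
definition "F q y = E (\<iota> q) (J q y)"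
definition "Nn q = E (\<iota> q) (n c q)"

lemma d_chart: "is_chart d"
  using hyp d unfolding hypersurface_def smooth_atlas_def by blast

lemma V: "open V" "p \<in> V" "V \<subseteq> cdom d" "\<iota> ` V \<subseteq> cdom c"
proof -
  have "continuous_on (cdom d) \<iota>"
    using hyp d(1) continuous_on_subset[of "carrier_of A" \<iota> "cdom d"] unfolding hypersurface_def carrier_of_def by blast
  then show "open V" unfolding V_def
    using continuous_open_preimage d_chart U(1) unfolding is_chart_def by blast
qed (use d U in \<open>auto simp: V_def\<close>)

lemma in_V: "q \<in> V \<Longrightarrow> q \<in> cdom d" "q \<in> V \<Longrightarrow> \<iota> q \<in> U" "q \<in> V \<Longrightarrow> \<iota> q \<in> cdom c" "q \<in> V \<Longrightarrow> q \<in> carrier_of A"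
  using U d by (auto simp: V_def carrier_of_def)

lemma smooth_c: "smooth_in d (cdom d \<inter> \<iota> -` cdom c) (cmap c \<circ> \<iota>)"
  using hyp d c unfolding hypersurface_def by blast

lemma J_deriv: "q \<in> V \<Longrightarrow> has_dir_deriv d (cmap c \<circ> \<iota>) q (J q)"
  using smooth_in_has_dir_deriv[OF smooth_c, of q] in_V unfolding J_def[abs_def] by simp

lemma linear_J: "q \<in> V \<Longrightarrow> linear (J q)"
  by (rule has_dir_deriv_linear[OF J_deriv])

lemma inj_J: "q \<in> V \<Longrightarrow> inj (J q)"
  using hyp d c in_V unfolding hypersurface_def J_def[abs_def] by (metis IntI vimageI)

lemma normal:
  assumes "q \<in> V"
  shows "metric N c (\<iota> q) (n c q) (n c q) = 1" "metric N c (\<iota> q) (J q x) (n c q) = 0"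
proof -
  have "q \<in> cdom d \<inter> \<iota> -` cdom c" using in_V[OF assms] by simp
  then show "metric N c (\<iota> q) (n c q) (n c q) = 1" "metric N c (\<iota> q) (J q x) (n c q) = 0"
    using unit d c unfolding unit_normal_field_def J_def by blast+
qed

lemma linear_F: "q \<in> V \<Longrightarrow> linear (F q)"
  unfolding F_def[abs_def] using linear_compose[OF linear_J linear_E] in_V by (simp add: o_def)

lemma inj_F: assumes "q \<in> V" shows "inj (F q)"
proof -
  have "inj (E (\<iota> q))"
    using metric_isometry_bij(1)[OF metric linear_E E_inner] in_V[OF assms] by blast
  then show ?thesis using inj_compose[OF _ inj_J[OF assms]] unfolding F_def[abs_def] by (simp add: o_def)
qed

lemma Nn: "q \<in> V \<Longrightarrow> Nn q \<bullet> Nn q = 1" "q \<in> V \<Longrightarrow> Nn q \<bullet> F q x = 0"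
  using normal in_V by (simp_all add: Nn_def F_def inner_commute[of _ "E _ (J _ _)"] E_inner)

section \<open>Independence of the selected ambient chart\<close>

lemma amb:
  assumes "q \<in> V"
  shows "amb N \<iota> q \<in> charts N" "\<iota> q \<in> cdom (amb N \<iota> q)"
  using someI[of "\<lambda>c. c \<in> charts N \<and> \<iota> q \<in> cdom c" c] c in_V[OF assms] by (auto simp: amb_def chart_at_def)

text \<open>Near \<open>p\<close> the chart \<open>amb N \<iota> q\<close> may differ from
  \<open>c\<close>. \<open>T q\<close> converts components, so that the induced tensors become
  expressions in the fixed chart \<open>c\<close> that can be differentiated.\<close>

definition "T q = dir_deriv c (cmap (amb N \<iota> q)) (\<iota> q)"

lemma T_deriv:
  assumes "q \<in> V" shows "has_dir_deriv c (cmap (amb N \<iota> q)) (\<iota> q) (T q)"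
proof -
  have "smooth_in c (cdom c \<inter> cdom (amb N \<iota> q)) (cmap (amb N \<iota> q))"
    using N c amb(1)[OF assms] unfolding riemannian_manifold_def smooth_atlas_def by blast
  then show ?thesis unfolding T_def by (rule smooth_in_has_dir_deriv) (use amb(2) in_V assms in auto)
qed

lemma linear_T: "q \<in> V \<Longrightarrow> linear (T q)"
  by (rule has_dir_deriv_linear[OF T_deriv])

lemma push_T:
  assumes "q \<in> V" shows "push N \<iota> d q x = T q (J q x)"
proof -
  have "has_dir_deriv d (\<lambda>q'. cmap (amb N \<iota> q) (\<iota> q')) q (\<lambda>h. T q (J q h))"
    by (rule has_dir_deriv_compose[OF d_chart chart V(1) assms V(3,4) J_deriv[OF assms] T_deriv[OF assms]])
  from has_dir_deriv_eq[OF this] show ?thesis by (simp add: push_def o_def)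
qed

lemma n_T: "q \<in> V \<Longrightarrow> n (amb N \<iota> q) q = T q (n c q)"
  using unit c amb in_V unfolding unit_normal_field_def T_def by (metis IntI vimageI)

lemma metric_T: "q \<in> V \<Longrightarrow> metric N (amb N \<iota> q) (\<iota> q) (T q x) (T q y) = metric N c (\<iota> q) x y"
  using N c amb in_V unfolding riemannian_manifold_def T_def by (metis IntI)

lemma phi_T: "q \<in> V \<Longrightarrow> \<phi> (amb N \<iota> q) (\<iota> q) (T q x) (T q y) (T q z) = \<phi> c (\<iota> q) x y z"
  using g2 c amb in_V unfolding g2_structure_def T_def by (metis IntI)

lemma amb_frame:
  assumes q: "q \<in> V"
  obtains E2 where "linear E2" "\<And>x y. E2 x \<bullet> E2 y = metric N (amb N \<iota> q) (\<iota> q) x y"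
    "\<And>x y z. phi0 (E2 x) (E2 y) (E2 z) = \<phi> (amb N \<iota> q) (\<iota> q) x y z"
    "\<And>x y z w. star_phi N \<phi> (amb N \<iota> q) (\<iota> q) x y z w = star0 (E2 x) (E2 y) (E2 z) (E2 w)"
proof -
  have "metric N (amb N \<iota> q) (\<iota> q) (n (amb N \<iota> q) q) (n (amb N \<iota> q) q) = 1"
    by (simp add: n_T q metric_T normal)
  from g2_local_frame_exists[OF N g2 amb[OF q] this]
  obtain U2 E2 E2' where "g2_local_frame N \<phi> (amb N \<iota> q) (\<iota> q) U2 E2 E2'" .
  then interpret E2: g2_local_frame N \<phi> "amb N \<iota> q" "\<iota> q" U2 E2 E2' .
  show ?thesis by (rule that[OF E2.linear_E E2.E_inner E2.E_phi E2.E_star]) (rule E2.U)+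
qed

text \<open>\<open>star_phi\<close> is defined chart by chart; its invariance is inherited from that
  of the metric and of \<open>\<phi>\<close> through \<open>star0_unique\<close>.\<close>

lemma star_T:
  assumes q: "q \<in> V"
  shows "star_phi N \<phi> (amb N \<iota> q) (\<iota> q) (T q x) (T q y) (T q z) (T q w) = star0 (E (\<iota> q) x) (E (\<iota> q) y) (E (\<iota> q) z) (E (\<iota> q) w)"
proof -
  obtain E2 where E2: "linear E2" "\<And>x y. E2 x \<bullet> E2 y = metric N (amb N \<iota> q) (\<iota> q) x y"
    "\<And>x y z. phi0 (E2 x) (E2 y) (E2 z) = \<phi> (amb N \<iota> q) (\<iota> q) x y z"
    "\<And>x y z w. star_phi N \<phi> (amb N \<iota> q) (\<iota> q) x y z w = star0 (E2 x) (E2 y) (E2 z) (E2 w)"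
    by (rule amb_frame[OF q]) blast
  note Uq = in_V(2)[OF q]
  have "star0 (E2 (T q x)) (E2 (T q y)) (E2 (T q z)) (E2 (T q w)) = star0 (E (\<iota> q) x) (E (\<iota> q) y) (E (\<iota> q) z) (E (\<iota> q) w)"
    by (rule star0_unique[OF metric[OF Uq], where E = "\<lambda>x. E2 (T q x)"])
      (simp_all add: E2(2,3) metric_T[OF q] phi_T[OF q] E_inner[OF Uq] E_phi[OF Uq] linear_E[OF Uq]
        linear_compose[OF linear_T[OF q] E2(1), unfolded o_def])
  then show ?thesis by (simp add: E2(4))
qed

lemma induced_metric_F: "q \<in> V \<Longrightarrow> induced_metric N \<iota> d q x y = F q x \<bullet> F q y"
  by (simp add: induced_metric_def push_T metric_T F_def E_inner in_V)

lemma pull_phi_F: "q \<in> V \<Longrightarrow> pull_phi N \<phi> \<iota> d q x y z = phi0 (F q x) (F q y) (F q z)"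
  by (simp add: pull_phi_def push_T phi_T F_def E_phi in_V)

lemma pull_n_star_phi_F: "q \<in> V \<Longrightarrow> pull_n_star_phi N \<phi> \<iota> n d q x y z = star0 (Nn q) (F q x) (F q y) (F q z)"
  by (simp add: pull_n_star_phi_def push_T n_T star_T F_def Nn_def)

text \<open>The cross product with the normal is orthogonal to the normal, hence tangential by
  dimension; injectivity of the differential makes the preimage unique, as the \<open>THE\<close>
  requires.\<close>

lemma induced_acs_F:
  assumes q: "q \<in> V" shows "F q (induced_acs N \<phi> \<iota> n d q x) = cross0 (Nn q) (F q x)"
proof -
  note Uq = in_V(2)[OF q]
  obtain E2 where E2: "linear E2" "\<And>x y. E2 x \<bullet> E2 y = metric N (amb N \<iota> q) (\<iota> q) x y"
    "\<And>x y z. phi0 (E2 x) (E2 y) (E2 z) = \<phi> (amb N \<iota> q) (\<iota> q) x y z"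
    by (rule amb_frame[OF q]) blast
  have "Nn q \<noteq> 0" using Nn(1)[OF q] by auto
  moreover have "Nn q \<bullet> cross0 (Nn q) (F q x) = 0"
    unfolding inner_commute[of "Nn q"] inner_cross0 phi0_explicit pl_def by (simp add: algebra_simps)
  ultimately obtain y where y: "F q y = cross0 (Nn q) (F q x)"
    using hyperplane_surj[OF linear_F[OF q] inj_F[OF q] _ Nn(2)[OF q]] by blast
  have met: "metric_form (metric N (amb N \<iota> q) (\<iota> q))"
    by (rule riemannian_metric_form[OF N amb[OF q]])
  have iso: "E2 (T q u) \<bullet> E2 (T q v) = E (\<iota> q) u \<bullet> E (\<iota> q) v" for u v
    by (simp add: E2(2) metric_T[OF q] E_inner[OF Uq])
  have "inj (\<lambda>u. E2 (T q u))"
    by (rule metric_isometry_bij(1)[OF metric[OF Uq] linear_compose[OF linear_T[OF q] E2(1), unfolded o_def]])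
      (simp add: iso E_inner[OF Uq])
  then have "surj (\<lambda>u. E2 (T q u))"
    by (intro linear_injective_imp_surjective linear_compose[OF linear_T[OF q] E2(1), unfolded o_def]) auto
  then have surj2: "\<exists>u. E2 (T q u) = v" for v by (metis surjD)
  have "E2 (T q (J q y)) = cross0 (E2 (T q (n c q))) (E2 (T q (J q x)))"
  proof -
    have "E2 (T q (J q y)) \<bullet> v = cross0 (E2 (T q (n c q))) (E2 (T q (J q x))) \<bullet> v" for v
    proof -
      obtain u where u: "v = E2 (T q u)" using surj2 by metis
      have "cross0 (E2 (T q (n c q))) (E2 (T q (J q x))) \<bullet> E2 (T q u) = phi0 (Nn q) (F q x) (E (\<iota> q) u)"
        by (simp add: inner_cross0 E2(3) phi_T[OF q] Nn_def F_def E_phi[OF Uq])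
      also have "\<dots> = F q y \<bullet> E (\<iota> q) u" by (simp add: y inner_cross0)
      finally show ?thesis by (simp add: u iso F_def)
    qed
    then show ?thesis using vector_eq_rdot by blast
  qed
  from cross_product_eq[OF met E2 this]
  have cp: "cross_product (metric N (amb N \<iota> q) (\<iota> q)) (\<phi> (amb N \<iota> q) (\<iota> q)) (n (amb N \<iota> q) q) (push N \<iota> d q x) = push N \<iota> d q y"
    by (simp add: push_T[OF q] n_T[OF q])
  have "induced_acs N \<phi> \<iota> n d q x = y"
    unfolding induced_acs_def Let_def cp
  proof (rule the_equality)
    fix y' assume "push N \<iota> d q y' = push N \<iota> d q y"
    then have "E2 (T q (J q y')) = E2 (T q (J q y))" by (simp add: push_T[OF q])
    then have "J q y' = J q y" using \<open>inj (\<lambda>u. E2 (T q u))\<close> by (auto dest: injD)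
    then show "y' = y" using inj_J[OF q] by (auto dest: injD)
  qed simp
  then show ?thesis by (simp add: y)
qed

end

section \<open>Second fundamental form, shape operator and induced connection\<close>

context hypersurface_point
begin

lemmas p = V(2)
abbreviation "Fp \<equiv> F p"
abbreviation "X \<equiv> J p"
abbreviation "acs_p \<equiv> induced_acs N \<phi> \<iota> n d p"

lemma Nn_p: "Nn p = e0" by (simp add: Nn_def E_n)

lemma Fp_0: "Fp x $ 0 = 0"
  using Nn(2)[OF p, of x] by (simp add: Nn_p inner_axis')

sublocale su3: su3_frame Fp acs_p
  rewrites "su3_frame.g Fp = induced_metric N \<iota> d p" and "su3_frame.\<psi> Fp = pull_phi N \<phi> \<iota> d p"
proof -
  show frame: "su3_frame Fp acs_p"
    using linear_F[OF p] inj_F[OF p] Fp_0 induced_acs_F[OF p] by (intro su3_frame.intro) (simp_all add: Nn_p del: cross0_nth)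
  show "su3_frame.g Fp = induced_metric N \<iota> d p"
    by (intro ext) (simp add: su3_frame.g_def[OF frame] induced_metric_F[OF p])
  show "su3_frame.\<psi> Fp = pull_phi N \<phi> \<iota> d p"
    by (intro ext) (simp add: su3_frame.\<psi>_def[OF frame] pull_phi_F[OF p])
qed

lemma push_p: "push N \<iota> d p x = X x"
  by (simp add: push_def J_def amb_p)

definition "D2 x y = dir_deriv d (\<lambda>q. J q y) p x"

text \<open>The same second derivative twice: on raw coordinates for the symmetry theorem, and for
  \<open>J\<close> in the calculus of charts. The two functions agree on the image of
  \<open>V\<close>.\<close>

lemma J_deriv2:
  shows "((\<lambda>u. frechet_derivative (in_coords d (cmap c \<circ> \<iota>)) (at u) y) has_derivative (\<lambda>x. D2 x y)) (at (cmap d p))"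
    and "has_dir_deriv d (\<lambda>q. J q y) p (\<lambda>x. D2 x y)"
proof -
  let ?f = "in_coords d (cmap c \<circ> \<iota>)"
  have "p \<in> cdom d \<inter> \<iota> -` cdom c" using in_V[OF p] by simp
  note * = smooth_in_has_dir_deriv2[OF smooth_c this, of y]
  have eq: "in_coords d (\<lambda>q. J q y) u = frechet_derivative ?f (at u) y" if "u \<in> cmap d ` V" for u
    using that in_V by (auto simp: in_coords_at[OF d_chart] J_def dir_deriv_def)
  have **: "(in_coords d (\<lambda>q. J q y) has_derivative frechet_derivative (\<lambda>u. frechet_derivative ?f (at u) y) (at (cmap d p))) (at (cmap d p))"
    by (rule has_derivative_transform_within_open[OF * chart_open_image[OF d_chart V(1,3)]]) (use p eq in auto)
  then have "has_dir_deriv d (\<lambda>q. J q y) p (frechet_derivative (\<lambda>u. frechet_derivative ?f (at u) y) (at (cmap d p)))"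
    by (simp add: has_dir_deriv_def)
  from has_dir_deriv_eq[OF this] have eq2: "frechet_derivative (\<lambda>u. frechet_derivative ?f (at u) y) (at (cmap d p)) = (\<lambda>x. D2 x y)"
    by (simp add: D2_def)
  show "((\<lambda>u. frechet_derivative ?f (at u) y) has_derivative (\<lambda>x. D2 x y)) (at (cmap d p))"
    using * unfolding eq2 .
  show "has_dir_deriv d (\<lambda>q. J q y) p (\<lambda>x. D2 x y)"
    using ** unfolding eq2 has_dir_deriv_def .
qed

lemma D2_sym: "D2 x y = D2 y x"
proof (rule second_derivative_symmetric[OF chart_open_image[OF d_chart V(1,3)] _ _ J_deriv2(1) J_deriv2(1)])
  show "cmap d p \<in> cmap d ` V" using p by blast
  fix u assume "u \<in> cmap d ` V"
  then obtain q where q: "q \<in> V" "u = cmap d q" by blast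
  have "(in_coords d (cmap c \<circ> \<iota>) has_derivative J q) (at u)"
    using J_deriv[OF q(1)] by (simp add: has_dir_deriv_def q(2))
  then show "(in_coords d (cmap c \<circ> \<iota>) has_derivative frechet_derivative (in_coords d (cmap c \<circ> \<iota>)) (at u)) (at u)"
    by (metis differentiableI frechet_derivative_works)
qed

lemma linear_D2: "linear (\<lambda>x. D2 x y)" "linear (D2 x)"
proof -
  show *: "linear (\<lambda>x. D2 x y)" for y by (rule has_dir_deriv_linear[OF J_deriv2(2)])
  have "D2 x = (\<lambda>y. D2 y x)" by (rule ext) (rule D2_sym)
  then show "linear (D2 x)" using *[of x] by simp
qed

text \<open>The ambient derivative of a coordinate field, in frame components; \<open>G\<close> below is its tangential part.\<close>

definition "II x y = E0 (D2 x y + \<Gamma> (X x) (X y))"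

lemma II_sym: "II x y = II y x"
  by (simp add: II_def D2_sym[of x y] connection_sym[of "X x"])

lemma linear_II: "linear (\<lambda>x. II x y)" "linear (II x)"
proof -
  have G: "linear (\<lambda>x. \<Gamma> (X x) v)" for v
    using bilinear_connection linear_compose[OF linear_J[OF p], of "\<lambda>x. \<Gamma> x v"] by (simp add: bilinear_def o_def)
  show *: "linear (\<lambda>x. II x y)" for y
    unfolding II_def using linear_compose[OF linear_compose_add[OF linear_D2(1) G] linear_E0] by (simp add: o_def)
  have "II x = (\<lambda>y. II y x)" by (rule ext) (rule II_sym)
  then show "linear (II x)" using *[of x] by simp
qed

abbreviation "B \<equiv> second_ff N \<iota> n d p"

lemma B_eq: "B x y = II x y $ 0"
proof -
  have "B x y = metric N c (\<iota> p) (D2 x y + \<Gamma> (X x) (X y)) (n c p)"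
    by (simp add: second_ff_def Let_def amb_p push_p D2_def J_def)
  also have "\<dots> = II x y \<bullet> e0" by (simp add: II_def E_inner[OF U(2), symmetric] E_n)
  finally show ?thesis by (simp add: inner_axis)
qed

lemma bilinear_B: "bilinear B" and B_sym: "B x y = B y x"
  unfolding bilinear_def B_eq
  by (auto intro!: linearI simp: linear_add[OF linear_II(1)] linear_add[OF linear_II(2)] linear_cmul[OF linear_II(1)]
    linear_cmul[OF linear_II(2)] II_sym[of x])

lemma F_deriv: "has_dir_deriv d (\<lambda>q. F q y) p (\<lambda>x. W (X x) (Fp y) + II x y)"
proof -
  have "has_dir_deriv d (\<lambda>q. E (\<iota> q) (J q y)) p (\<lambda>x. E' (X x) (X y) + E0 (D2 x y))"
  proof (rule has_dir_deriv_apply[OF d_chart V(1-3), where M = "\<lambda>q. E (\<iota> q)"])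
    show "linear (E (\<iota> q))" if "q \<in> V" for q using linear_E in_V that by blast
    show "has_dir_deriv d (\<lambda>q. E (\<iota> q) v) p (\<lambda>h. E' (X h) v)" for v
      by (rule has_dir_deriv_compose[OF d_chart chart V J_deriv[OF p] E_deriv])
  qed (rule J_deriv2)
  then show ?thesis
    by (simp add: F_def E'_eq II_def linear_add[OF linear_E0] algebra_simps)
qed

text \<open>The Weingarten formula, from differentiating \<open>Nn q \<bullet> Nn q = 1\<close> and
  \<open>Nn q \<bullet> F q y = 0\<close>. \<open>S\<close> is the shape operator;
  \<open>W (X x) e0\<close> is the motion of the frame.\<close>

lemma Nn_deriv: obtains S where "linear S" "has_dir_deriv d Nn p (\<lambda>x. W (X x) e0 - Fp (S x))" "\<And>x y. Fp (S x) \<bullet> Fp y = B x y"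
proof -
  have "smooth_in d (cdom d \<inter> \<iota> -` cdom c) (n c)"
    using unit d c unfolding unit_normal_field_def by blast
  then have n: "has_dir_deriv d (n c) p (dir_deriv d (n c) p)"
    by (rule smooth_in_has_dir_deriv) (use in_V[OF p] in simp)
  define DN where "DN x = E' (X x) (n c p) + E0 (dir_deriv d (n c) p x)" for x
  have DN: "has_dir_deriv d Nn p DN"
    unfolding DN_def[abs_def] Nn_def[abs_def]
  proof (rule has_dir_deriv_apply[OF d_chart V(1-3) _ _ n, where M = "\<lambda>q. E (\<iota> q)"])
    show "linear (E (\<iota> q))" if "q \<in> V" for q using linear_E in_V that by blast
    show "has_dir_deriv d (\<lambda>q. E (\<iota> q) v) p (\<lambda>h. E' (X h) v)" for v
      by (rule has_dir_deriv_compose[OF d_chart chart V J_deriv[OF p] E_deriv])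
  qed
  note inner = has_dir_deriv_inner[OF d_chart d(2)]
  have const: "has_dir_deriv d (\<lambda>q. k :: real) p (\<lambda>x. 0)" for k
    by (simp add: has_dir_deriv_def in_coords_def)
  have "has_dir_deriv d (\<lambda>q. 1 :: real) p (\<lambda>x. Nn p \<bullet> DN x + DN x \<bullet> Nn p)"
    by (rule has_dir_deriv_cong[OF d_chart V(1-3) _ inner[OF DN DN]]) (rule Nn)
  from has_dir_deriv_eq[OF this] has_dir_deriv_eq[OF const[of 1]]
  have "Nn p \<bullet> DN x + DN x \<bullet> Nn p = 0" for x by metis
  then have 0: "DN x $ 0 = 0" for x by (simp add: Nn_p inner_axis inner_axis')
  have "has_dir_deriv d (\<lambda>q. 0 :: real) p (\<lambda>x. Nn p \<bullet> (W (X x) (Fp y) + II x y) + DN x \<bullet> Fp y)" for y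
    by (rule has_dir_deriv_cong[OF d_chart V(1-3) _ inner[OF DN F_deriv]]) (rule Nn)
  from has_dir_deriv_eq[OF this] has_dir_deriv_eq[OF const[of 0]]
  have ortho: "Nn p \<bullet> (W (X x) (Fp y) + II x y) + DN x \<bullet> Fp y = 0" for x y by metis
  have skew: "e0 \<bullet> W h v = - (W h e0 \<bullet> v)" for h v using skew_W[of h] by (simp add: skew_map_def)
  have 1: "(W (X x) e0 - DN x) \<bullet> Fp y = B x y" for x y
  proof -
    have "e0 \<bullet> W (X x) (Fp y) + e0 \<bullet> II x y + DN x \<bullet> Fp y = 0"
      using ortho[of x y] by (simp only: Nn_p inner_add_right)
    moreover have "e0 \<bullet> II x y = B x y" by (simp add: B_eq inner_axis')
    ultimately show ?thesis unfolding skew inner_diff_left by linarith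
  qed
  have "(W (X x) e0 - DN x) $ 0 = 0" for x
    using 0 skew_map_nth(3)[OF skew_W] by simp
  then have "\<exists>y. Fp y = W (X x) e0 - DN x" for x by (metis su3.F_surj)
  then obtain S where S: "\<And>x. Fp (S x) = W (X x) e0 - DN x" by metis
  have SB: "Fp (S x) \<bullet> Fp y = B x y" for x y by (simp add: S 1)
  have "linear S"
    by (rule linearI; rule metric_form_eqI[OF su3.metric_g])
      (simp_all add: induced_metric_F[OF p] linear_add[OF linear_F[OF p]] linear_cmul[OF linear_F[OF p]] SB inner_add_left
        bilinear_ladd[OF bilinear_B] bilinear_lmul[OF bilinear_B])
  moreover have "DN = (\<lambda>x. W (X x) e0 - Fp (S x))" by (simp add: S)
  ultimately show ?thesis using that[OF _ _ SB] DN by simp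
qed

definition "S = (SOME S. linear S \<and> has_dir_deriv d Nn p (\<lambda>x. W (X x) e0 - Fp (S x)) \<and> (\<forall>x y. Fp (S x) \<bullet> Fp y = B x y))"

lemma S: "linear S" "has_dir_deriv d Nn p (\<lambda>x. W (X x) e0 - Fp (S x))" "Fp (S x) \<bullet> Fp y = B x y"
proof -
  have "\<exists>S. linear S \<and> has_dir_deriv d Nn p (\<lambda>x. W (X x) e0 - Fp (S x)) \<and> (\<forall>x y. Fp (S x) \<bullet> Fp y = B x y)"
    by (rule Nn_deriv) blast
  from someI_ex[OF this, folded S_def]
  show "linear S" "has_dir_deriv d Nn p (\<lambda>x. W (X x) e0 - Fp (S x))" "Fp (S x) \<bullet> Fp y = B x y" by blast+
qed

definition "G x y = (SOME z. Fp z = II x y - B x y *\<^sub>R e0)"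

lemma G: "II x y = Fp (G x y) + B x y *\<^sub>R e0"
proof -
  have "(II x y - B x y *\<^sub>R e0) $ 0 = 0" by (simp add: B_eq axis_1_nth)
  then have "\<exists>z. Fp z = II x y - B x y *\<^sub>R e0" by (metis su3.F_surj)
  from someI_ex[OF this] show ?thesis by (simp add: G_def)
qed

lemma G_metric: "Fp (G x y) \<bullet> Fp z = II x y \<bullet> Fp z"
  unfolding G by (simp add: inner_add_left inner_axis' Fp_0)

text \<open>When the metric is differentiated in frame components, the terms in \<open>W\<close>
  cancel by skewness and normal parts are orthogonal to tangent vectors. What remains are the terms
  in \<open>G\<close>, which is symmetric because \<open>II\<close> is.\<close>

lemma induced_connection:
  assumes "metric S' = induced_metric N \<iota>"
  shows "levi_civita S' d p = G"
proof (rule levi_civita_eq)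
  show met: "metric_form (metric S' d p)" using su3.metric_g by (simp add: assms)
  have "bilinear G"
    unfolding bilinear_def
    by (intro conjI allI linearI; rule metric_form_eqI[OF su3.metric_g])
      (simp_all add: induced_metric_F[OF p] linear_add[OF linear_F[OF p]] linear_cmul[OF linear_F[OF p]] inner_add_left G_metric
       linear_add[OF linear_II(1)] linear_add[OF linear_II(2)] linear_cmul[OF linear_II(1)] linear_cmul[OF linear_II(2)])
  moreover have "G x y = G y x" for x y
    unfolding G_def II_sym[of x] B_sym[of x] ..
  moreover have "dir_deriv d (\<lambda>q. induced_metric N \<iota> d q y z) p x = induced_metric N \<iota> d p (G x y) z + induced_metric N \<iota> d p y (G x z)" for x y z
  proof -
    have "has_dir_deriv d (\<lambda>q. induced_metric N \<iota> d q y z) p (\<lambda>x. Fp y \<bullet> (W (X x) (Fp z) + II x z) + (W (X x) (Fp y) + II x y) \<bullet> Fp z)"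
      by (rule has_dir_deriv_cong[OF d_chart V(1-3) _ has_dir_deriv_inner[OF d_chart d(2) F_deriv F_deriv]])
        (simp add: induced_metric_F)
    moreover have "W h u \<bullet> v = - (u \<bullet> W h v)" for h u v using skew_W[of h] by (simp add: skew_map_def)
    moreover have "Fp y \<bullet> Fp (G x z) = Fp y \<bullet> II x z" using G_metric[of x z y] by (simp add: inner_commute)
    ultimately show ?thesis
      by (simp add: has_dir_deriv_eq induced_metric_F[OF p] G_metric inner_add_left inner_add_right)
  qed
  ultimately show "connection_form (metric S' d p) (\<lambda>x y z. dir_deriv d (\<lambda>q. metric S' d q y z) p x) G"
    unfolding connection_form_def assms by blast
qed

abbreviation "R \<equiv> r_tt N \<phi> \<iota> d p"

lemma R_eq: "R x y = \<rho> (X x) \<bullet> Fp y"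
  by (simp add: r_tt_def amb_p push_p r_bar_eq F_def)

lemma r_tn_eq: "r_tn N \<phi> \<iota> n d p x = \<rho> (X x) $ 0"
  by (simp add: r_tn_def amb_p push_p r_bar_eq E_n inner_axis)

text \<open>In terms of the bilinear forms, \<open>L\<close> is \<open>B - I\<^sub>(\<^sub>2\<^sub>) \<iota>\<^sup>*r\<close>.\<close>

definition "L x = (SOME z. Fp z = Fp (S x) - cross0 e0 (\<rho> (X x)))"

lemma L: "Fp (L x) = Fp (S x) - cross0 e0 (\<rho> (X x))"
proof -
  have "(Fp (S x) - cross0 e0 (\<rho> (X x))) $ 0 = 0" by (simp add: Fp_0 pl_def axis_1_nth)
  then have "\<exists>z. Fp z = Fp (S x) - cross0 e0 (\<rho> (X x))" by (metis su3.F_surj)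
  then show ?thesis unfolding L_def by (rule someI_ex)
qed

lemma g_L: "induced_metric N \<iota> d p (L x) y = B x y + R x (acs_p y)"
proof -
  have "cross0 e0 (\<rho> (X x)) \<bullet> Fp y = - (\<rho> (X x) \<bullet> cross0 e0 (Fp y))"
    unfolding inner_commute[of "\<rho> (X x)"] inner_cross0 by (rule phi0_alternating(2))
  then show ?thesis
    by (simp add: induced_metric_F[OF p] L inner_diff_left S R_eq su3.F_I)
qed

end

lemma star0_e0: "b $ 0 = 0 \<Longrightarrow> c $ 0 = 0 \<Longrightarrow> star0 e0 r b c = - phi0 (cross0 e0 r) b c"
  unfolding star0_phi0 phi0_rotate[of "cross0 e0 r"] by (simp add: inner_axis')

lemma phi0_repeat: "phi0 a a b = 0" "phi0 a b a = 0" "phi0 b a a = 0"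
  unfolding phi0_explicit pl_def by (simp_all add: algebra_simps)

lemma star0_repeat: "star0 a a b c = 0" "star0 a b a c = 0" "star0 a b c a = 0"
  using star0_alternating(1)[of a a b c] star0_alternating(2)[of a a b c] star0_alternating(1)[of a b a c]
    star0_alternating(3)[of a b a c] star0_alternating(2)[of a b a c] by simp_all

section \<open>Covariant derivatives of omega and psi\<close>

context hypersurface_point
begin

text \<open>\<open>kaehler_form\<close> is \<open>phi0\<close> with the normal in the first slot.
  \<open>W\<close> acts on all three slots and produces \<open>star0 (\<rho> (X x))\<close>, the
  \<open>G\<close> terms cancel against the connection, the normal part of \<open>II\<close> meets a
  second e_0, and only the shape operator survives besides.\<close>

lemma nabla_kaehler:
  assumes "metric S' = induced_metric N \<iota>" "acs S' = induced_acs N \<phi> \<iota> n"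
  shows "nabla2 S' (kaehler_form S') d p x y z = pull_phi N \<phi> \<iota> d p (L x) y z"
proof -
  have kf: "kaehler_form S' d q y z = phi0 (Nn q) (F q z) (F q y)" if "q \<in> V" for q y z
    using that by (simp add: kaehler_form_def assms induced_metric_F induced_acs_F inner_commute[of "F q y"] inner_cross0 del: cross0_nth)
  have "has_dir_deriv d (\<lambda>q. kaehler_form S' d q y z) p
    (\<lambda>x. phi0 (W (X x) e0 - Fp (S x)) (Fp z) (Fp y) + phi0 (Nn p) (W (X x) (Fp z) + II x z) (Fp y) + phi0 (Nn p) (Fp z) (W (X x) (Fp y) + II x y))"
    by (rule has_dir_deriv_cong[OF d_chart V(1-3) _ has_dir_deriv_phi0[OF d_chart d(2) S(2) F_deriv F_deriv]]) (simp add: kf)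
  from has_dir_deriv_eq[OF this]
  have "nabla2 S' (kaehler_form S') d p x y z = star0 (\<rho> (X x)) e0 (Fp z) (Fp y) - phi0 (Fp (S x)) (Fp z) (Fp y)"
    unfolding nabla2_def Let_def induced_connection[OF assms(1)] kf[OF p] \<rho>_def skew_map_phi0[OF skew_W, symmetric]
    by (simp add: Nn_p G linear_add[OF phi0_linear(1)] linear_add[OF phi0_linear(2)] linear_add[OF phi0_linear(3)]
      linear_diff[OF phi0_linear(1)] linear_cmul[OF phi0_linear(2)] linear_cmul[OF phi0_linear(3)] phi0_repeat)
  also have "star0 (\<rho> (X x)) e0 (Fp z) (Fp y) = star0 e0 (\<rho> (X x)) (Fp y) (Fp z)"
    using star0_alternating(1)[of "\<rho> (X x)" e0 "Fp z" "Fp y"] star0_alternating(3)[of e0 "\<rho> (X x)" "Fp z" "Fp y"] by simp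
  also have "\<dots> = - phi0 (cross0 e0 (\<rho> (X x))) (Fp y) (Fp z)" by (intro star0_e0 Fp_0)
  also have "phi0 (Fp (S x)) (Fp z) (Fp y) = - phi0 (Fp (S x)) (Fp y) (Fp z)" by (rule phi0_alternating)
  finally show ?thesis
    by (simp add: pull_phi_F[OF p] L linear_diff[OF phi0_linear(1)] del: cross0_nth)
qed

lemmas Fp_lin = linear_add[OF linear_F[OF p]] linear_cmul[OF linear_F[OF p]]
lemmas phi0_lin = linear_add[OF phi0_linear(1)] linear_add[OF phi0_linear(2)] linear_add[OF phi0_linear(3)]
  linear_cmul[OF phi0_linear(1)] linear_cmul[OF phi0_linear(2)] linear_cmul[OF phi0_linear(3)]
lemmas star0_lin = linear_add[OF star0_linear(1)] linear_add[OF star0_linear(2)] linear_add[OF star0_linear(3)] linear_add[OF star0_linear(4)]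
  linear_cmul[OF star0_linear(1)] linear_cmul[OF star0_linear(2)] linear_cmul[OF star0_linear(3)] linear_cmul[OF star0_linear(4)]
lemmas B_lin = bilinear_ladd[OF bilinear_B] bilinear_lmul[OF bilinear_B] bilinear_radd[OF bilinear_B] bilinear_rmul[OF bilinear_B]

lemma linear_W: "linear (W h)" using skew_W by (simp add: skew_map_def)
lemmas W_lin = linear_add[OF linear_W] linear_cmul[OF linear_W]

text \<open>Besides the \<open>\<rho>\<close> term, whose contraction is 24 / 6 = 4 times its normal
  component, the derivative contains \<open>B x\<close> wedge omega, which is orthogonal to psi_- by
  type.\<close>

lemma nabla_psi_0:
  assumes "metric S' = induced_metric N \<iota>"
  shows "inner_form3 (induced_metric N \<iota> d p) (nabla3 S' (pull_phi N \<phi> \<iota>) d p x) (pull_n_star_phi N \<phi> \<iota> n d p) = 4 * r_tn N \<phi> \<iota> n d p x"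
proof -
  have "has_dir_deriv d (\<lambda>q. pull_phi N \<phi> \<iota> d q y z w) p
    (\<lambda>x. phi0 (W (X x) (Fp y) + II x y) (Fp z) (Fp w) + phi0 (Fp y) (W (X x) (Fp z) + II x z) (Fp w) + phi0 (Fp y) (Fp z) (W (X x) (Fp w) + II x w))" for y z w
    by (rule has_dir_deriv_cong[OF d_chart V(1-3) _ has_dir_deriv_phi0[OF d_chart d(2) F_deriv F_deriv F_deriv]]) (simp add: pull_phi_F)
  from has_dir_deriv_eq[OF this]
  have 1: "nabla3 S' (pull_phi N \<phi> \<iota>) d p x = (\<lambda>y z w. star0 (\<rho> (X x)) (Fp y) (Fp z) (Fp w)
     + (B x y * phi0 e0 (Fp z) (Fp w) + B x z * phi0 (Fp y) e0 (Fp w) + B x w * phi0 (Fp y) (Fp z) e0))"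
    unfolding nabla3_def Let_def induced_connection[OF assms(1)] pull_phi_F[OF p] \<rho>_def skew_map_phi0[OF skew_W, symmetric]
    by (intro ext) (simp add: G phi0_lin)
  have 2: "pull_n_star_phi N \<phi> \<iota> n d p = (\<lambda>y z w. star0 e0 (Fp y) (Fp z) (Fp w))"
    by (intro ext) (simp add: pull_n_star_phi_F[OF p] Nn_p)
  have t1: "trilinear (\<lambda>y z w. star0 (\<rho> (X x)) (Fp y) (Fp z) (Fp w)
     + (B x y * phi0 e0 (Fp z) (Fp w) + B x z * phi0 (Fp y) e0 (Fp w) + B x w * phi0 (Fp y) (Fp z) e0))"
    unfolding trilinear_def by (intro conjI allI linearI; simp add: Fp_lin phi0_lin star0_lin B_lin algebra_simps)
  have t2: "trilinear (\<lambda>y z w. star0 e0 (Fp y) (Fp z) (Fp w))"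
    unfolding trilinear_def by (intro conjI allI linearI; simp add: Fp_lin star0_lin)
  show ?thesis
    unfolding 1 2 inner_form3_onb[OF su3.metric_g su3.onb_e t1 t2] su3.F_e
    using star0_tan_contraction[of "\<rho> (X x)"] tan_contraction_omega[of "\<lambda>i. B x (su3.e i)"]
    by (simp add: distrib_right sum.distrib r_tn_eq)
qed

text \<open>Here the normal inside the four-form is differentiated too. The shape operator term is
  orthogonal to psi_+, normal parts of \<open>II\<close> repeat e_0, and the two minus signs in
  front of the \<open>W\<close> terms cancel.\<close>

lemma nabla_psi_1:
  assumes "metric S' = induced_metric N \<iota>"
  shows "inner_form3 (induced_metric N \<iota> d p) (nabla3 S' (\<lambda>d p x y z. - pull_n_star_phi N \<phi> \<iota> n d p x y z) d p x) (pull_phi N \<phi> \<iota> d p) = 4 * r_tn N \<phi> \<iota> n d p x"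
proof -
  have neg: "linear (\<lambda>x :: real. - x)" by (rule linearI) simp_all
  have "has_dir_deriv d (\<lambda>q. - pull_n_star_phi N \<phi> \<iota> n d q y z w) p
    (\<lambda>x. - (star0 (W (X x) e0 - Fp (S x)) (Fp y) (Fp z) (Fp w) + star0 (Nn p) (W (X x) (Fp y) + II x y) (Fp z) (Fp w)
       + star0 (Nn p) (Fp y) (W (X x) (Fp z) + II x z) (Fp w) + star0 (Nn p) (Fp y) (Fp z) (W (X x) (Fp w) + II x w)))" for y z w
    by (rule has_dir_deriv_cong[OF d_chart V(1-3) _ has_dir_deriv_linear_image[OF neg has_dir_deriv_star0[OF d_chart d(2) S(2) F_deriv F_deriv F_deriv]]]) (simp add: pull_n_star_phi_F)
  from has_dir_deriv_eq[OF this]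
  have 1: "nabla3 S' (\<lambda>d p x y z. - pull_n_star_phi N \<phi> \<iota> n d p x y z) d p x = (\<lambda>y z w. star0 (Fp (S x)) (Fp y) (Fp z) (Fp w)
     - (star0 (W (X x) e0) (Fp y) (Fp z) (Fp w) + star0 e0 (W (X x) (Fp y)) (Fp z) (Fp w)
       + star0 e0 (Fp y) (W (X x) (Fp z)) (Fp w) + star0 e0 (Fp y) (Fp z) (W (X x) (Fp w))))"
    unfolding nabla3_def Let_def induced_connection[OF assms(1)] pull_n_star_phi_F[OF p]
    by (intro ext) (simp add: Nn_p G star0_lin star0_repeat linear_diff[OF star0_linear(1)])
  have 2: "pull_phi N \<phi> \<iota> d p = (\<lambda>y z w. phi0 (Fp y) (Fp z) (Fp w))"
    by (intro ext) (simp add: pull_phi_F[OF p])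
  have t1: "trilinear (\<lambda>y z w. star0 (Fp (S x)) (Fp y) (Fp z) (Fp w)
     - (star0 (W (X x) e0) (Fp y) (Fp z) (Fp w) + star0 e0 (W (X x) (Fp y)) (Fp z) (Fp w)
       + star0 e0 (Fp y) (W (X x) (Fp z)) (Fp w) + star0 e0 (Fp y) (Fp z) (W (X x) (Fp w))))"
    unfolding trilinear_def by (intro conjI allI linearI; simp add: Fp_lin star0_lin W_lin algebra_simps)
  have t2: "trilinear (\<lambda>y z w. phi0 (Fp y) (Fp z) (Fp w))"
    unfolding trilinear_def by (intro conjI allI linearI; simp add: Fp_lin phi0_lin)
  show ?thesis
    unfolding 1 2 inner_form3_onb[OF su3.metric_g su3.onb_e t1 t2] su3.F_e
    unfolding left_diff_distrib sum_subtractf tan_contraction_star_phi tan_contraction_skew[OF skew_W]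
    by (simp add: r_tn_eq \<rho>_def)
qed

definition "type_at S' Cs = (torsion_of_type (metric S' d p) (acs S' d p) (psi_plus S' d p) (nabla2 S' (kaehler_form S') d p) Cs
   \<and> (W5 \<notin> Cs \<longrightarrow> (\<forall>x. W5_form S' d p x = 0)))"

lemma W5_form_eq:
  assumes "\<theta> = 0 \<or> \<theta> = pi / 2"
  shows "W5_form (induced_su3 N \<phi> A \<iota> n \<theta>) d p x = - r_tn N \<phi> \<iota> n d p (acs_p x) / 3"
  using assms
proof
  assume [simp]: "\<theta> = 0"
  show ?thesis using nabla_psi_0[of "induced_su3 N \<phi> A \<iota> n 0" "acs_p x"] by (simp add: W5_form_def induced_su3_def)
next
  assume [simp]: "\<theta> = pi / 2"
  show ?thesis using nabla_psi_1[of "induced_su3 N \<phi> A \<iota> n (pi / 2)" "acs_p x"] by (simp add: W5_form_def induced_su3_def)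
qed

sublocale alg: su3_algebra "induced_metric N \<iota> d p" acs_p "pull_phi N \<phi> \<iota> d p" su3.e
  by (rule su3.su3_algebra)

lemma W5_form_0:
  assumes "\<theta> = 0 \<or> \<theta> = pi / 2"
  shows "(\<forall>x. W5_form (induced_su3 N \<phi> A \<iota> n \<theta>) d p x = 0) \<longleftrightarrow> (\<forall>x. r_tn N \<phi> \<iota> n d p x = 0)"
proof -
  have "(\<forall>x. r_tn N \<phi> \<iota> n d p x = 0)" if "\<forall>x. r_tn N \<phi> \<iota> n d p (acs_p x) = 0"
    using that by (metis alg.II minus_minus alg.I_simps(3))
  then show ?thesis unfolding W5_form_eq[OF assms] by auto
qed

lemma torsion_eq: "nabla2 (induced_su3 N \<phi> A \<iota> n \<theta>) (kaehler_form (induced_su3 N \<phi> A \<iota> n \<theta>)) d p = alg.tors L"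
  by (intro ext) (simp add: alg.tors_def nabla_kaehler induced_su3_def)

lemma psi_plus_0: "psi_plus (induced_su3 N \<phi> A \<iota> n 0) d p = pull_phi N \<phi> \<iota> d p"
  by (intro ext) (simp add: induced_su3_def)

text \<open>For tangential arguments, contracting minus the four-form with the normal amounts to
  \<open>phi0\<close> with \<open>I\<close> in one slot; thus the rotated algebra applies.\<close>

lemma psi_plus_1: "psi_plus (induced_su3 N \<phi> A \<iota> n (pi / 2)) d p = (\<lambda>x. pull_phi N \<phi> \<iota> d p (acs_p x))"
  by (intro ext) (simp add: induced_su3_def pull_phi_F[OF p] pull_n_star_phi_F[OF p] Nn_p star0_e0 Fp_0 su3.F_I del: cross0_nth)

section \<open>Consequences of type X3 and the pointwise equivalences\<close>

context
  assumes X3: "g2_type_X3 N \<phi>"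
begin

lemma r_bar_sym: "r_bar N \<phi> c (\<iota> p) x y = r_bar N \<phi> c (\<iota> p) y x"
  using X3 c q0 unfolding g2_type_X3_def by blast

lemma bilinear_r_bar: "bilinear (r_bar N \<phi> c (\<iota> p))"
proof -
  have 1: "linear (\<lambda>y. r_bar N \<phi> c (\<iota> p) x y)" for x
    unfolding r_bar_eq by (rule linearI) (simp_all add: linear_add[OF linear_E0] linear_cmul[OF linear_E0] inner_add_right)
  moreover have "linear (\<lambda>x. r_bar N \<phi> c (\<iota> p) x y)" for y
    unfolding r_bar_sym[of _ y] by (rule 1)
  ultimately show ?thesis by (simp add: bilinear_def)
qed

lemma R_r_bar: "R x y = r_bar N \<phi> c (\<iota> p) (X x) (X y)"
  by (simp add: r_tt_def amb_p push_p)

lemma bilinear_R: "bilinear R" and R_sym: "R x y = R y x"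
proof -
  show "R x y = R y x" for x y unfolding R_r_bar by (rule r_bar_sym)
  note X = linear_add[OF linear_J[OF p]] linear_cmul[OF linear_J[OF p]]
  show "bilinear R" unfolding bilinear_def R_r_bar
    by (auto intro!: linearI simp: X bilinear_ladd[OF bilinear_r_bar] bilinear_lmul[OF bilinear_r_bar]
     bilinear_radd[OF bilinear_r_bar] bilinear_rmul[OF bilinear_r_bar])
qed

text \<open>In a basis containing \<open>n\<close> the full trace of \<open>r_bar\<close> is zero,
  and its only non-tangential term is the normal one.\<close>

lemma tr_R: "(\<Sum>i\<in>UNIV. R (su3.e i) (su3.e i)) = - r_nn N \<phi> \<iota> n p"
proof -
  have "trace_form (metric N c (\<iota> p)) (r_bar N \<phi> c (\<iota> p)) = 0"
    using X3 c q0 unfolding g2_type_X3_def by blast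
  then have "(\<Sum>i\<in>UNIV. r_bar N \<phi> c (\<iota> p) (Einv (axis i 1)) (Einv (axis i 1))) = 0"
    unfolding trace_form_onb[OF metric[OF U(2)] onb_Einv bilinear_r_bar] .
  moreover have "Einv (tan_ax j) = X (su3.e j)" for j
    using Einv_E[of "X (su3.e j)"] su3.F_e[of j] by (simp add: F_def)
  moreover have "Einv e0 = n c p" using Einv_E[of "n c p"] E_n by simp
  ultimately show ?thesis
    unfolding sum_axis_tan[of "\<lambda>v. r_bar N \<phi> c (\<iota> p) (Einv v) (Einv v)"]
    by (simp add: R_r_bar r_nn_def amb_p)
qed

lemma mean_curv_eq: "mean_curv N \<iota> n d p = (\<Sum>i\<in>UNIV. B (su3.e i) (su3.e i)) / 6"
  unfolding mean_curv_def trace_form_onb[OF su3.metric_g su3.onb_e bilinear_B] ..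

lemma linear_L: "linear L"
  by (rule linearI; rule metric_form_eqI[OF su3.metric_g])
    (simp_all add: g_L alg.g_simps B_lin bilinear_ladd[OF bilinear_R] bilinear_lmul[OF bilinear_R] algebra_simps)

lemmas types_0 = alg.torsion_types[OF linear_L g_L bilinear_B B_sym bilinear_R R_sym]
lemmas types_1 = alg.torsion_types_rotated[OF linear_L g_L bilinear_B B_sym bilinear_R R_sym]

lemma type_at_iff:
  "type_at (induced_su3 N \<phi> A \<iota> n 0) Cs \<longleftrightarrow> torsion_of_type (induced_metric N \<iota> d p) acs_p (pull_phi N \<phi> \<iota> d p) (alg.tors L) Cs
    \<and> (W5 \<notin> Cs \<longrightarrow> (\<forall>x. r_tn N \<phi> \<iota> n d p x = 0))"
  "type_at (induced_su3 N \<phi> A \<iota> n (pi / 2)) Cs \<longleftrightarrow> torsion_of_type (induced_metric N \<iota> d p) acs_p (\<lambda>x. pull_phi N \<phi> \<iota> d p (acs_p x)) (alg.tors L) Cs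
    \<and> (W5 \<notin> Cs \<longrightarrow> (\<forall>x. r_tn N \<phi> \<iota> n d p x = 0))"
  unfolding type_at_def torsion_eq psi_plus_0 psi_plus_1 W5_form_0[OF disjI1[OF refl]] W5_form_0[OF disjI2[OF refl]]
  by (simp_all add: induced_su3_def)

lemma R_cond: "(\<forall>x y. R x y + I12 acs_p R x y = (\<Sum>i\<in>UNIV. R (su3.e i) (su3.e i)) / 3 * induced_metric N \<iota> d p x y)
  \<longleftrightarrow> (\<forall>x y. 3 * (R x y + I12 acs_p R x y) = - r_nn N \<phi> \<iota> n p * induced_metric N \<iota> d p x y)"
  unfolding tr_R by (intro arg_cong[where f = All] ext) auto

lemma B_cond: "(\<forall>x y. B x y + I12 acs_p B x y = (\<Sum>i\<in>UNIV. B (su3.e i) (su3.e i)) / 3 * induced_metric N \<iota> d p x y)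
  \<longleftrightarrow> (\<forall>x y. B x y + I12 acs_p B x y = 2 * mean_curv N \<iota> n d p * induced_metric N \<iota> d p x y)"
  unfolding mean_curv_eq by simp

lemma type_at_both:
  assumes "\<theta> = 0 \<or> \<theta> = pi / 2"
  shows "type_at (induced_su3 N \<phi> A \<iota> n \<theta>) {W1p, W1m, W2p, W2m, W3, W5}"
    and "type_at (induced_su3 N \<phi> A \<iota> n \<theta>) {W1p, W1m, W2p, W2m, W3} \<longleftrightarrow> (\<forall>x. r_tn N \<phi> \<iota> n d p x = 0)"
    and "type_at (induced_su3 N \<phi> A \<iota> n \<theta>) {W1p, W1m, W2p, W2m, W5}
      \<longleftrightarrow> (\<forall>x y. I1 acs_p R x y + I2 acs_p R x y = B x y - I12 acs_p B x y)"
  using assms by (auto simp only: type_at_iff types_0(1,2,3) types_1(1,2,3))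

lemma type_at_each:
  "type_at (induced_su3 N \<phi> A \<iota> n 0) {W1p, W1m, W2p, W3, W5} \<longleftrightarrow> (\<forall>x y. 3 * (R x y + I12 acs_p R x y) = - r_nn N \<phi> \<iota> n p * induced_metric N \<iota> d p x y)"
  "type_at (induced_su3 N \<phi> A \<iota> n (pi / 2)) {W1p, W1m, W2p, W3, W5} \<longleftrightarrow> (\<forall>x y. B x y + I12 acs_p B x y = 2 * mean_curv N \<iota> n d p * induced_metric N \<iota> d p x y)"
  "type_at (induced_su3 N \<phi> A \<iota> n 0) {W1p, W1m, W2m, W3, W5} \<longleftrightarrow> (\<forall>x y. B x y + I12 acs_p B x y = 2 * mean_curv N \<iota> n d p * induced_metric N \<iota> d p x y)"
  "type_at (induced_su3 N \<phi> A \<iota> n (pi / 2)) {W1p, W1m, W2m, W3, W5} \<longleftrightarrow> (\<forall>x y. 3 * (R x y + I12 acs_p R x y) = - r_nn N \<phi> \<iota> n p * induced_metric N \<iota> d p x y)"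
  "type_at (induced_su3 N \<phi> A \<iota> n 0) {W1p, W2p, W2m, W3, W5} \<longleftrightarrow> r_nn N \<phi> \<iota> n p = 0"
  "type_at (induced_su3 N \<phi> A \<iota> n (pi / 2)) {W1p, W2p, W2m, W3, W5} \<longleftrightarrow> mean_curv N \<iota> n d p = 0"
  "type_at (induced_su3 N \<phi> A \<iota> n 0) {W1m, W2p, W2m, W3, W5} \<longleftrightarrow> mean_curv N \<iota> n d p = 0"
  "type_at (induced_su3 N \<phi> A \<iota> n (pi / 2)) {W1m, W2p, W2m, W3, W5} \<longleftrightarrow> r_nn N \<phi> \<iota> n p = 0"
  unfolding type_at_iff types_0 types_1 R_cond B_cond unfolding tr_R mean_curv_eq by simp_all

end

end

lemma su3_of_type_iff:
  "su3_of_type S Cs \<longleftrightarrow> (\<forall>d\<in>charts S. \<forall>p\<in>cdom d.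
     torsion_of_type (metric S d p) (acs S d p) (psi_plus S d p) (nabla2 S (kaehler_form S) d p) Cs
     \<and> (W5 \<notin> Cs \<longrightarrow> (\<forall>x. W5_form S d p x = 0)))"
  unfolding su3_of_type_def torsion_of_type_def ..

lemma hypersurface_point_exists:
  assumes N: "riemannian_manifold N" and g2: "g2_structure N \<phi>" and hyp: "hypersurface N A \<iota>" and unit: "unit_normal_field N A \<iota> n"
    and d: "d \<in> A" "p \<in> cdom d"
  obtains U E E' where "hypersurface_point N \<phi> (amb N \<iota> p) U E E' \<iota> p A d n"
proof -
  let ?c = "amb N \<iota> p"
  have "\<iota> p \<in> carrier_of (charts N)"
    using hyp d unfolding hypersurface_def carrier_of_def by blast
  then have "\<exists>c. c \<in> charts N \<and> \<iota> p \<in> cdom c" by (auto simp: carrier_of_def)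
  from someI_ex[OF this] have c: "?c \<in> charts N" "\<iota> p \<in> cdom ?c"
    by (auto simp: amb_def chart_at_def)
  have "metric N ?c (\<iota> p) (n ?c p) (n ?c p) = 1"
    using unit d c unfolding unit_normal_field_def by blast
  from g2_local_frame_exists[OF N g2 c this]
  obtain U E E' where "g2_local_frame N \<phi> ?c (\<iota> p) U E E'" "E (\<iota> p) (n ?c p) = e0" .
  then have "hypersurface_point N \<phi> ?c U E E' \<iota> p A d n"
    by (intro hypersurface_point.intro hypersurface_point_axioms.intro N g2 hyp unit d c refl)
  then show ?thesis by (rule that)
qed

theorem theorem4p10:
  fixes N :: "('a::{t2_space, second_countable_topology}, 7) riem"
    and \<phi> :: "('a, 7) chart \<Rightarrow> 'a \<Rightarrow> 7 form3"
    and A :: "('b::{t2_space, second_countable_topology}, 6) chart set"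
    and \<iota> :: "'b \<Rightarrow> 'a"
    and n :: "('a, 7) chart \<Rightarrow> 'b \<Rightarrow> real ^ 7"
  assumes "riemannian_manifold N"
    and "g2_structure N \<phi>"
    and "g2_type_X3 N \<phi>"
    and "hypersurface N A \<iota>"
    and "unit_normal_field N A \<iota> n"
  shows "(\<forall>\<theta>\<in>{0, pi / 2}. su3_of_type (induced_su3 N \<phi> A \<iota> n \<theta>) {W1p, W1m, W2p, W2m, W3, W5})
    \<and> (\<forall>\<theta>\<in>{0, pi / 2}. su3_of_type (induced_su3 N \<phi> A \<iota> n \<theta>) {W1p, W1m, W2p, W2m, W3}
         \<longleftrightarrow> (\<forall>d\<in>A. \<forall>p\<in>cdom d. \<forall>x. r_tn N \<phi> \<iota> n d p x = 0))
    \<and> (\<forall>\<theta>\<in>{0, pi / 2}. su3_of_type (induced_su3 N \<phi> A \<iota> n \<theta>) {W1p, W1m, W2p, W2m, W5}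
         \<longleftrightarrow> (\<forall>d\<in>A. \<forall>p\<in>cdom d. \<forall>x y.
               I1 (induced_acs N \<phi> \<iota> n d p) (r_tt N \<phi> \<iota> d p) x y
               + I2 (induced_acs N \<phi> \<iota> n d p) (r_tt N \<phi> \<iota> d p) x y
               = second_ff N \<iota> n d p x y
                 - I12 (induced_acs N \<phi> \<iota> n d p) (second_ff N \<iota> n d p) x y))
    \<and> (su3_of_type (induced_su3 N \<phi> A \<iota> n 0) {W1p, W1m, W2p, W3, W5} \<longleftrightarrow> r_equation N \<phi> A \<iota> n)
    \<and> (su3_of_type (induced_su3 N \<phi> A \<iota> n (pi / 2)) {W1p, W1m, W2p, W3, W5} \<longleftrightarrow> B_equation N \<phi> A \<iota> n)
    \<and> (su3_of_type (induced_su3 N \<phi> A \<iota> n 0) {W1p, W1m, W2m, W3, W5} \<longleftrightarrow> B_equation N \<phi> A \<iota> n)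
    \<and> (su3_of_type (induced_su3 N \<phi> A \<iota> n (pi / 2)) {W1p, W1m, W2m, W3, W5} \<longleftrightarrow> r_equation N \<phi> A \<iota> n)
    \<and> (su3_of_type (induced_su3 N \<phi> A \<iota> n 0) {W1p, W2p, W2m, W3, W5}
         \<longleftrightarrow> (\<forall>p\<in>carrier_of A. r_nn N \<phi> \<iota> n p = 0))
    \<and> (su3_of_type (induced_su3 N \<phi> A \<iota> n (pi / 2)) {W1p, W2p, W2m, W3, W5} \<longleftrightarrow> minimal_variety N A \<iota> n)
    \<and> (su3_of_type (induced_su3 N \<phi> A \<iota> n 0) {W1m, W2p, W2m, W3, W5} \<longleftrightarrow> minimal_variety N A \<iota> n)
    \<and> (su3_of_type (induced_su3 N \<phi> A \<iota> n (pi / 2)) {W1m, W2p, W2m, W3, W5}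
         \<longleftrightarrow> (\<forall>p\<in>carrier_of A. r_nn N \<phi> \<iota> n p = 0))"
proof -
  let ?S = "induced_su3 N \<phi> A \<iota> n"
  \<comment> \<open>The pointwise condition is restated outside the locale, since a suitable frame
    is obtained for one point at a time.\<close>
  define ty where "ty S Cs d p \<longleftrightarrow> torsion_of_type (metric S d p) (acs S d p) (psi_plus S d p) (nabla2 S (kaehler_form S) d p) Cs
     \<and> (W5 \<notin> Cs \<longrightarrow> (\<forall>x. W5_form S d p x = 0))" for S :: "'b su3" and Cs d p
  have type: "su3_of_type (?S \<theta>) Cs \<longleftrightarrow> (\<forall>d\<in>A. \<forall>p\<in>cdom d. ty (?S \<theta>) Cs d p)" for \<theta> Cs
    unfolding su3_of_type_iff ty_def by (simp add: induced_su3_def)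
  have both: "ty (?S \<theta>) {W1p, W1m, W2p, W2m, W3, W5} d p"
    "ty (?S \<theta>) {W1p, W1m, W2p, W2m, W3} d p \<longleftrightarrow> (\<forall>x. r_tn N \<phi> \<iota> n d p x = 0)"
    "ty (?S \<theta>) {W1p, W1m, W2p, W2m, W5} d p \<longleftrightarrow> (\<forall>x y.
               I1 (induced_acs N \<phi> \<iota> n d p) (r_tt N \<phi> \<iota> d p) x y
               + I2 (induced_acs N \<phi> \<iota> n d p) (r_tt N \<phi> \<iota> d p) x y
               = second_ff N \<iota> n d p x y
                 - I12 (induced_acs N \<phi> \<iota> n d p) (second_ff N \<iota> n d p) x y)"
    if dp: "d \<in> A" "p \<in> cdom d" and th: "\<theta> = 0 \<or> \<theta> = pi / 2" for d p \<theta>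
  proof -
    obtain U E E' where "hypersurface_point N \<phi> (amb N \<iota> p) U E E' \<iota> p A d n"
      using hypersurface_point_exists[OF assms(1,2,4,5) dp] .
    then interpret hypersurface_point N \<phi> "amb N \<iota> p" U E E' \<iota> p A d n .
    note type_at_both[OF assms(3) th, unfolded type_at_def, folded ty_def]
    then show "ty (?S \<theta>) {W1p, W1m, W2p, W2m, W3, W5} d p"
      "ty (?S \<theta>) {W1p, W1m, W2p, W2m, W3} d p \<longleftrightarrow> (\<forall>x. r_tn N \<phi> \<iota> n d p x = 0)"
      "ty (?S \<theta>) {W1p, W1m, W2p, W2m, W5} d p \<longleftrightarrow> (\<forall>x y.
               I1 (induced_acs N \<phi> \<iota> n d p) (r_tt N \<phi> \<iota> d p) x y
               + I2 (induced_acs N \<phi> \<iota> n d p) (r_tt N \<phi> \<iota> d p) x y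
               = second_ff N \<iota> n d p x y
                 - I12 (induced_acs N \<phi> \<iota> n d p) (second_ff N \<iota> n d p) x y)" .
  qed
  let ?R = "\<lambda>d p. \<forall>x y. 3 * (r_tt N \<phi> \<iota> d p x y + I12 (induced_acs N \<phi> \<iota> n d p) (r_tt N \<phi> \<iota> d p) x y)
       = - r_nn N \<phi> \<iota> n p * induced_metric N \<iota> d p x y"
  let ?B = "\<lambda>d p. \<forall>x y. second_ff N \<iota> n d p x y + I12 (induced_acs N \<phi> \<iota> n d p) (second_ff N \<iota> n d p) x y
       = 2 * mean_curv N \<iota> n d p * induced_metric N \<iota> d p x y"
  have each: "ty (?S 0) {W1p, W1m, W2p, W3, W5} d p \<longleftrightarrow> ?R d p"
    "ty (?S (pi / 2)) {W1p, W1m, W2p, W3, W5} d p \<longleftrightarrow> ?B d p"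
    "ty (?S 0) {W1p, W1m, W2m, W3, W5} d p \<longleftrightarrow> ?B d p"
    "ty (?S (pi / 2)) {W1p, W1m, W2m, W3, W5} d p \<longleftrightarrow> ?R d p"
    "ty (?S 0) {W1p, W2p, W2m, W3, W5} d p \<longleftrightarrow> r_nn N \<phi> \<iota> n p = 0"
    "ty (?S (pi / 2)) {W1p, W2p, W2m, W3, W5} d p \<longleftrightarrow> mean_curv N \<iota> n d p = 0"
    "ty (?S 0) {W1m, W2p, W2m, W3, W5} d p \<longleftrightarrow> mean_curv N \<iota> n d p = 0"
    "ty (?S (pi / 2)) {W1m, W2p, W2m, W3, W5} d p \<longleftrightarrow> r_nn N \<phi> \<iota> n p = 0"
    if dp: "d \<in> A" "p \<in> cdom d" for d p
  proof -
    obtain U E E' where "hypersurface_point N \<phi> (amb N \<iota> p) U E E' \<iota> p A d n"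
      using hypersurface_point_exists[OF assms(1,2,4,5) dp] .
    then interpret hypersurface_point N \<phi> "amb N \<iota> p" U E E' \<iota> p A d n .
    note t = type_at_each[OF assms(3), unfolded type_at_def, folded ty_def]
    show "ty (?S 0) {W1p, W1m, W2p, W3, W5} d p \<longleftrightarrow> ?R d p"
      "ty (?S (pi / 2)) {W1p, W1m, W2p, W3, W5} d p \<longleftrightarrow> ?B d p"
      "ty (?S 0) {W1p, W1m, W2m, W3, W5} d p \<longleftrightarrow> ?B d p"
      "ty (?S (pi / 2)) {W1p, W1m, W2m, W3, W5} d p \<longleftrightarrow> ?R d p"
      "ty (?S 0) {W1p, W2p, W2m, W3, W5} d p \<longleftrightarrow> r_nn N \<phi> \<iota> n p = 0"
      "ty (?S (pi / 2)) {W1p, W2p, W2m, W3, W5} d p \<longleftrightarrow> mean_curv N \<iota> n d p = 0"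
      "ty (?S 0) {W1m, W2p, W2m, W3, W5} d p \<longleftrightarrow> mean_curv N \<iota> n d p = 0"
      "ty (?S (pi / 2)) {W1m, W2p, W2m, W3, W5} d p \<longleftrightarrow> r_nn N \<phi> \<iota> n p = 0"
      by (rule t)+
  qed
  show ?thesis
    unfolding type r_equation_def B_equation_def minimal_variety_def carrier_of_def
    by (intro conjI) (auto simp: both each)
qed

end
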